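(* Let $n\ge1$, let $\Gamma$ be a lattice in $SU(n,1)$, and let $\kappa\ge1$ with $\kappa\in\tfrac12\mathbb Z$ and $(n+1)\kappa\in\mathbb Z$. For any $f\in S_{2(n+1)\kappa}(\Gamma)$ and any loxodromic element $\gamma_0\in\Gamma$, $$(f,\Theta_{\gamma_0,\kappa})=|\alpha|^{-2(n+1)\kappa}\,C\int_{z_0}^{\gamma_0z_0}f(z)\,Q_{\gamma_0}(z)^{(n+1)\kappa}\,dt .$$ Here $z_0$ is any point on the axis of $\gamma_0$, the integration is over the axis of $\gamma_0$ in $B^n$ (from $z_0$ to $\gamma_0z_0$), $t$ is the parameter of the geodesic flow, $\alpha=-\frac{\langle X,Y\rangle}{2}$, and $$C=\frac{(2(n+1)\kappa-n-1)!}{\big(((n+1)\kappa-1)!\big)^2}\,\pi^n\,2^{2(n+1)(1-\kappa)-1}$$ is a constant.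
   Context: Hermitian form: on $\mathbb C^{n+1}$, $\langle z,w\rangle=z_1\bar w_1+\dots+z_n\bar w_n-z_{n+1}\bar w_{n+1}$; $SU(n,1)$ is the group of unimodular complex matrices preserving it. $B^n$ is the unit ball in $\mathbb C^n$; points $z$ of the closed ball are identified with $(z_1,\dots,z_n,1)^T$, so $\langle z,w\rangle=z_1\bar w_1+\dots+z_n\bar w_n-1$ for them. A matrix $g=\begin{pmatrix}A&b\\c&d\end{pmatrix}$ ($A$ of size $n\times n$) acts on $B^n$ by $g(z)=(Az+b)/(c\cdot z+d)$, and $j(g,z)=(c\cdot z+d)^{-1}$. The invariant volume form is $dV=4^n(-\langle z,z\rangle)^{-(n+1)}dV_E$, with $dV_E$ the Euclidean volume form on $\mathbb C^n$. Put $(f|\gamma)(z)=f(\gamma(z))\,j(\gamma,z)^{2(n+1)\kappa}$. $S_{2(n+1)\kappa}(\Gamma)$ is the space of cusp forms of weight $2(n+1)\kappa$: holomorphic $f:B^n\to\mathbb C$ with $f|\gamma=f$ for all $\gamma\in\Gamma$ and $|f(z)|(-\langle z,z\rangle)^{(n+1)\kappa}$ bounded on $B^n$. The inner product is $(f_1,f_2)=\int_{\Gamma\backslash B^n}f_1\overline{f_2}\,(-\langle z,z\rangle)^{2(n+1)\kappa}\,dV$. Let $a_t=\begin{pmatrix}1_{n-1}&0&0\\0&\cosh t&\sinh t\\0&\sinh t&\cosh t\end{pmatrix}$. An element of $SU(n,1)$ is loxodromic if it is conjugate to an element of the centralizer of $\{a_t\mid t\in\mathbb R\}$ (elliptic elements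 being excluded); it has two fixed points in $\partial B^n$, $X$ repelling and $Y$ attracting, and its axis is the geodesic in $B^n$ that it fixes, joining them. The geodesic flow is parametrized so that geodesics are $t\mapsto g(a_t(0))$, $g\in SU(n,1)$; on the standard geodesic $a_t(0)=(0,\dots,0,\tanh t)$. For loxodromic $\gamma_0\in\Gamma$ let $\Gamma_0=\langle\gamma_0\rangle$ and $Q_{\gamma_0}(z)=\langle z,X\rangle\langle z,Y\rangle$, which is stated to transform, for every loxodromic $\gamma_0\in\Gamma$, by $Q_{\gamma_0}(\gamma_0z)=j(\gamma_0,z)^2Q_{\gamma_0}(z)$. Let $q(z)=Q_{\gamma_0}(z)^{-(n+1)\kappa}$. The relative Poincaré series is $\Theta_{\gamma_0,\kappa}(z)=\sum_{\gamma\in\Gamma_0\backslash\Gamma}(q|\gamma)(z)$, a cusp form in $S_{2(n+1)\kappa}(\Gamma)$.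
   Formalization: It is additionally assumed that q|γ₀ = q on Bⁿ (it can fail for n ≥ 2, and then the sum over Γ₀\Γ is not well defined); the integral over Γ\Bⁿ in the inner product is weighted by 1/|Γ_z|, i.e. the plain one divided by the number of central elements of Γ. *)

theory Defs
  imports "HOL-Analysis.Analysis" "HOL-Algebra.Generated_Groups"
begin

(* C^n is complex^'n, and C^(n+1) is complex^('n option), where the coordinates z_1, ..., z_n are
   those with index Some i and z_(n+1) is the one with index None. *)

definition herm :: "complex^('n::finite option) \<Rightarrow> complex^('n option) \<Rightarrow> complex" where
  "herm z w = (\<Sum>i\<in>UNIV. z $ Some i * cnj (w $ Some i)) - z $ None * cnj (w $ None)"

definition SU :: "(complex^('n::finite option)^('n option)) monoid" where
  "SU = \<lparr>carrier = {g. det g = 1 \<and> (\<forall>z w. herm (g *v z) (g *v w) = herm z w)},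
         mult = (\<lambda>g h. g ** h), one = mat 1\<rparr>"

definition lift_pt :: "complex^'n::finite \<Rightarrow> complex^('n option)" where
  "lift_pt z = (\<chi> i. case i of Some j \<Rightarrow> z $ j | None \<Rightarrow> 1)"

(* For g = (A b; c d), the vector g *v lift_pt z has the components Az + b and c z + d. *)

definition act :: "complex^('n::finite option)^('n option) \<Rightarrow> complex^'n \<Rightarrow> complex^'n" where
  "act g z = (\<chi> i. (g *v lift_pt z) $ Some i / (g *v lift_pt z) $ None)"

definition autj :: "complex^('n::finite option)^('n option) \<Rightarrow> complex^'n \<Rightarrow> complex" where
  "autj g z = inverse ((g *v lift_pt z) $ None)"

(* The real number - <z,z>. *)
definition height :: "complex^'n::finite \<Rightarrow> real" where
  "height z = - Re (herm (lift_pt z) (lift_pt z))"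

definition inv_vol :: "(complex^'n::finite) measure" where
  "inv_vol = density lborel
     (\<lambda>z. ennreal (indicator (ball 0 1) z * 4 ^ CARD('n) / height z ^ (CARD('n) + 1)))"

(* A discrete subgroup Gamma such that the quotient space Gamma \ SU(n,1), with the Borel sets of
   the quotient topology, carries a nonzero finite measure invariant under right translations. *)
definition lattice_in_SU :: "(complex^('n::finite option)^('n option)) set \<Rightarrow> bool" where
  "lattice_in_SU \<Gamma> \<longleftrightarrow> subgroup \<Gamma> SU \<and> discrete \<Gamma> \<and>
     (\<exists>M. space M = rcosets\<^bsub>SU\<^esub> \<Gamma> \<and>
          sets M = sigma_sets (rcosets\<^bsub>SU\<^esub> \<Gamma>)
            {U. U \<subseteq> rcosets\<^bsub>SU\<^esub> \<Gamma> \<and> openin (top_of_set (carrier SU)) (\<Union>U)} \<and>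
          0 < emeasure M (space M) \<and> emeasure M (space M) < \<infinity> \<and>
          (\<forall>h\<in>carrier SU. \<forall>S\<in>sets M. emeasure M ((\<lambda>C. C #>\<^bsub>SU\<^esub> h) ` S) = emeasure M S))"

definition slash :: "nat \<Rightarrow> (complex^'n::finite \<Rightarrow> complex) \<Rightarrow>
    complex^('n option)^('n option) \<Rightarrow> complex^'n \<Rightarrow> complex" where
  "slash k f g z = f (act g z) * autj g z ^ (2 * k)"

(* Holomorphy in several variables on an open set: the real Frechet derivative exists at every
   point and is complex linear. *)
definition holomorphic_vec_on :: "(complex^'n::finite \<Rightarrow> complex) \<Rightarrow> (complex^'n) set \<Rightarrow> bool" where
  "holomorphic_vec_on f S \<longleftrightarrow>
     (\<forall>z\<in>S. \<exists>f'. (f has_derivative f') (at z) \<and> (\<forall>c v. f' (c *s v) = c * f' v))"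

(* Cusp forms of weight 2 k; below k = (n+1) kappa. *)
definition cusp_forms :: "nat \<Rightarrow> (complex^('n::finite option)^('n option)) set \<Rightarrow>
    (complex^'n \<Rightarrow> complex) set" where
  "cusp_forms k \<Gamma> = {f. holomorphic_vec_on f (ball 0 1) \<and>
     (\<forall>\<gamma>\<in>\<Gamma>. \<forall>z\<in>ball 0 1. slash k f \<gamma> z = f z) \<and>
     bounded ((\<lambda>z. cmod (f z) * height z ^ k) ` ball 0 1)}"

definition fundamental_domain :: "(complex^('n::finite option)^('n option)) set \<Rightarrow>
    (complex^'n) set \<Rightarrow> bool" where
  "fundamental_domain \<Gamma> D \<longleftrightarrow> D \<in> sets borel \<and> D \<subseteq> ball 0 1 \<and>
     (\<forall>z\<in>ball 0 1. \<exists>!w. w \<in> D \<and> (\<exists>\<gamma>\<in>\<Gamma>. w = act \<gamma> z))"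

(* The integral over Gamma \ B^n of a Gamma-invariant function, for the quotient measure that is
   normalized by (integral of phi over B^n) = (integral over Gamma \ B^n of the sum of phi(gamma z)
   over gamma in Gamma).  Outside a null set the stabilizer of z in Gamma is the intersection of
   Gamma with the centre of SU(n,1); if that is trivial, the weight 1 / card is 1 almost everywhere
   and this is the plain integral over a fundamental domain. The value does not depend on the
   choice of D. *)
definition quotient_integral :: "(complex^('n::finite option)^('n option)) set \<Rightarrow>
    (complex^'n \<Rightarrow> complex) \<Rightarrow> complex" where
  "quotient_integral \<Gamma> \<phi> =
     set_lebesgue_integral inv_vol (SOME D. fundamental_domain \<Gamma> D)
       (\<lambda>z. \<phi> z / of_nat (card {\<gamma>\<in>\<Gamma>. act \<gamma> z = z}))"

definition petersson :: "nat \<Rightarrow> (complex^('n::finite option)^('n option)) set \<Rightarrow>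
    (complex^'n \<Rightarrow> complex) \<Rightarrow> (complex^'n \<Rightarrow> complex) \<Rightarrow> complex" where
  "petersson k \<Gamma> f\<^sub>1 f\<^sub>2 =
     quotient_integral \<Gamma> (\<lambda>z. f\<^sub>1 z * cnj (f\<^sub>2 z) * of_real (height z ^ (2 * k)))"

(* The linear order on the index type only serves to single out the n-th coordinate. *)
definition a_mat :: "real \<Rightarrow> complex^('n::{finite,linorder} option)^('n option)" where
  "a_mat t = (\<chi> i j. let P = {Some (Max UNIV), None} in
     if i = j then (if i \<in> P then of_real (cosh t) else 1)
     else if i \<in> P \<and> j \<in> P then of_real (sinh t) else 0)"

definition elliptic :: "complex^('n::finite option)^('n option) \<Rightarrow> bool" where
  "elliptic \<gamma> \<longleftrightarrow> \<gamma> \<in> carrier SU \<and> (\<exists>z\<in>ball 0 1. act \<gamma> z = z)"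

definition loxodromic :: "complex^('n::{finite,linorder} option)^('n option) \<Rightarrow> bool" where
  "loxodromic \<gamma> \<longleftrightarrow>
     (\<exists>g\<in>carrier SU. \<exists>h\<in>carrier SU. (\<forall>t. h ** a_mat t = a_mat t ** h) \<and> \<gamma> = g ** h ** inv\<^bsub>SU\<^esub> g) \<and>
     \<not> elliptic \<gamma>"

definition attracting_pt :: "complex^('n::finite option)^('n option) \<Rightarrow> complex^'n" where
  "attracting_pt \<gamma> = (THE Y. Y \<in> sphere 0 1 \<and> act \<gamma> Y = Y \<and>
     (\<forall>z\<in>ball 0 1. (\<lambda>m. (act \<gamma> ^^ m) z) \<longlonglongrightarrow> Y))"

definition repelling_pt :: "complex^('n::finite option)^('n option) \<Rightarrow> complex^'n" where
  "repelling_pt \<gamma> = attracting_pt (inv\<^bsub>SU\<^esub> \<gamma>)"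

definition geodesic :: "complex^('n::{finite,linorder} option)^('n option) \<Rightarrow> real \<Rightarrow>
    complex^('n::{finite,linorder})" where
  "geodesic g t = act g (act (a_mat t) 0)"

(* geodesic g runs along the axis of gamma, from the repelling to the attracting fixed point. *)
definition axis_geodesic :: "complex^('n::{finite,linorder} option)^('n option) \<Rightarrow>
    complex^('n option)^('n option) \<Rightarrow> bool" where
  "axis_geodesic \<gamma> g \<longleftrightarrow> g \<in> carrier SU \<and>
     (geodesic g \<longlongrightarrow> repelling_pt \<gamma>) at_bot \<and> (geodesic g \<longlongrightarrow> attracting_pt \<gamma>) at_top"

definition Qform :: "complex^('n::finite option)^('n option) \<Rightarrow> complex^'n \<Rightarrow> complex" where
  "Qform \<gamma> z = herm (lift_pt z) (lift_pt (repelling_pt \<gamma>)) *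
               herm (lift_pt z) (lift_pt (attracting_pt \<gamma>))"

definition alpha :: "complex^('n::finite option)^('n option) \<Rightarrow> complex" where
  "alpha \<gamma> = - herm (lift_pt (repelling_pt \<gamma>)) (lift_pt (attracting_pt \<gamma>)) / 2"

definition qfun :: "nat \<Rightarrow> complex^('n::finite option)^('n option) \<Rightarrow> complex^'n \<Rightarrow> complex" where
  "qfun k \<gamma> z = inverse (Qform \<gamma> z ^ k)"

(* The summand at a coset is q|gamma for a representative gamma; it does not depend on the
   representative when q|gamma_0 = q. *)
definition rel_poincare :: "nat \<Rightarrow> (complex^('n::finite option)^('n option)) set \<Rightarrow>
    complex^('n option)^('n option) \<Rightarrow> complex^'n \<Rightarrow> complex" where
  "rel_poincare k \<Gamma> \<gamma>\<^sub>0 z =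
     infsum (\<lambda>C. slash k (qfun k \<gamma>\<^sub>0) (SOME \<gamma>. \<gamma> \<in> C) z)
       (rcosets\<^bsub>SU\<lparr>carrier := \<Gamma>\<rparr>\<^esub> (generate SU {\<gamma>\<^sub>0}))"

end

theory Submission
  imports Defs "HOL-Complex_Analysis.Complex_Analysis" "HOL-Real_Asymp.Real_Asymp"
begin

text \<open>
The relative Poincare series is unfolded twice, because its seed \<open>q = Q\<^sup>-\<^sup>k\<close> is itself an average of
reproducing kernels along the axis.

Let \<open>\<omega>(t) = g a\<^sub>t e\<close>, with \<open>e\<close> the last basis vector: a negative vector of \<open>C^(n+1)\<close> lying over the point
\<open>g(a\<^sub>t(0))\<close> of the axis, and put \<open>K\<^sub>t(z) = \<langle>z, \<omega>(t)\<rangle>^(-2k)\<close>. As \<open>\<omega>(t)\<close> is half of \<open>e\<^sup>t p + e\<^sup>-\<^sup>t q\<close> for null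
vectors \<open>p\<close>, \<open>q\<close> over the two fixed points, the function \<open>\<langle>z, \<omega>(t)\<rangle>\<close> is half of \<open>a e\<^sup>t + b e\<^sup>-\<^sup>t\<close>, and the
variable \<open>y = a e\<^sup>t / (a e\<^sup>t + b e\<^sup>-\<^sup>t)\<close>, which runs from 0 to 1, turns the integral of \<open>K\<^sub>t(z)\<close> over all real
\<open>t\<close> into the Euler integral of \<open>(y (1 - y))^(k-1)\<close> times \<open>(a b)^(-k)\<close>, that is, into a multiple of \<open>q(z)\<close>
(\<open>kernel_line_integral\<close>, \<open>reproducing_line_integral\<close>).

The element \<open>\<gamma>\<^sub>0\<close> moves \<open>\<omega>(t)\<close> to \<open>c \<omega>(t + T)\<close>, where \<open>T\<close> is the translation length and \<open>c\<close> is a phase; the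
transformation rule of \<open>q\<close> says exactly that \<open>c^(2k) = 1\<close> (\<open>axis_translation\<close>, \<open>translation_phase\<close>). Hence the
integral over the whole line is the sum, over the powers of \<open>\<gamma>\<^sub>0\<close>, of translates of the integral over one period
\<open>[t\<^sub>0, t\<^sub>1]\<close>, and the sum over the cosets of \<open>\<Gamma>\<^sub>0\<close> in \<open>\<Gamma>\<close> becomes a sum over all of \<open>\<Gamma>\<close> of translates of
the period integral (\<open>axis_average_orbit_sum\<close>, \<open>infsum_cyclic_cosets\<close>). Integrated against \<open>f\<close> over
\<open>\<Gamma> \ B\<close>, this sum unfolds to an integral over the ball (\<open>orbit_unfolding\<close>).

On the ball the order of the two integrations may be exchanged, and \<open>K\<^sub>t\<close> reproduces: the integral of
\<open>f\<close> against \<open>K\<^sub>t\<close> is a constant times \<open>(f|g a\<^sub>t)(0)\<close> (\<open>reproducing_formula\<close>). This is the mean value property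
at the origin (\<open>ball_mean_value\<close>), transported by \<open>g a\<^sub>t\<close>. What remains is the integral of \<open>(f|g a\<^sub>t)(0)\<close>
over one period, and \<open>(f|g a\<^sub>t)(0)\<close> is \<open>f Q\<^sup>k\<close> on the axis up to a constant. The factor \<open>C\<close> is the total mass of
\<open>(-\<langle>z,z\<rangle>)^(2k) dV\<close> divided by the Beta constant.

Two facts about the geometry are needed on the way. The invariance of \<open>dV\<close> is obtained without Jacobians: up
to a constant, \<open>dV\<close> is the image of Lebesgue measure on \<open>{0 < -\<langle>v,v\<rangle> < 1}\<close> under projection to the ball, and
\<open>SU(n,1)\<close> preserves Lebesgue measure on \<open>C^(n+1)\<close> because each of its elements is an isometry followed by a
reflection. A Borel fundamental domain is obtained by choosing in each orbit the point of least norm and breaking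
ties by comparing real coordinates.
\<close>

no_notation fps_nth (infixl \<open>$\<close> 75)

section \<open>The Hermitian form and the action on the ball\<close>

lemma herm_add_left: "herm (x + y) z = herm x z + herm y z"
  by (simp add: herm_def algebra_simps sum.distrib)

lemma herm_add_right: "herm z (x + y) = herm z x + herm z y"
  by (simp add: herm_def algebra_simps sum.distrib)

lemma herm_scale_left: "herm (c *s x) y = c * herm x y"
  by (simp add: herm_def algebra_simps sum_distrib_left)

lemma herm_scale_right: "herm x (c *s y) = cnj c * herm x y"
  by (simp add: herm_def algebra_simps sum_distrib_left)

lemma herm_commute: "herm y x = cnj (herm x y)"
  by (simp add: herm_def mult.commute)

lemma herm_lift: "herm (lift_pt z) (lift_pt w) = (\<Sum>i\<in>UNIV. z $ i * cnj (w $ i)) - 1"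
  by (simp add: herm_def lift_pt_def)

lemma norm_vec_power2: "(norm (z :: complex^'n))\<^sup>2 = (\<Sum>i\<in>UNIV. (cmod (z $ i))\<^sup>2)"
  by (simp add: norm_vec_def L2_set_def sum_nonneg)

lemma herm_self: "herm v v = of_real ((\<Sum>i\<in>UNIV. (cmod (v $ Some i))\<^sup>2) - (cmod (v $ None))\<^sup>2)"
  by (simp add: herm_def complex_norm_square del: of_real_power)

lemma height_eq: "height z = 1 - (norm z)\<^sup>2"
  by (simp add: height_def herm_self norm_vec_power2) (simp add: lift_pt_def)

lemma height_pos_iff: "0 < height z \<longleftrightarrow> z \<in> ball 0 1"
  by (simp add: height_eq abs_square_less_1)

lemma cauchy_schwarz_vec: "cmod (\<Sum>i\<in>UNIV. z $ i * cnj (w $ i)) \<le> norm z * norm (w :: complex^'n)"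
proof -
  have "cmod (\<Sum>i\<in>UNIV. z $ i * cnj (w $ i)) \<le> (\<Sum>i\<in>UNIV. \<bar>cmod (z $ i)\<bar> * \<bar>cmod (w $ i)\<bar>)"
    by (rule order.trans[OF norm_sum]) (simp add: norm_mult)
  also have "\<dots> \<le> norm z * norm w"
    unfolding norm_vec_def by (rule L2_set_mult_ineq)
  finally show ?thesis .
qed

lemma herm_lift_neq_0:
  assumes "z \<in> ball 0 1" "w \<in> cball 0 1"
  shows "herm (lift_pt z) (lift_pt w) \<noteq> 0"
proof
  assume "herm (lift_pt z) (lift_pt w) = 0"
  then have "(\<Sum>i\<in>UNIV. z $ i * cnj (w $ i)) = 1"
    by (simp add: herm_lift)
  then have "1 \<le> norm z * norm w"
    using cauchy_schwarz_vec[of z w] by simp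
  moreover have "norm z * norm w \<le> norm z * 1"
    using assms by (intro mult_left_mono) auto
  ultimately show False
    using assms by simp
qed

text \<open>The point of affine space under a homogeneous vector. The action of a matrix is linear on homogeneous vectors, so
statements about \<open>act\<close> are proved by lifting.\<close>
definition proj_pt :: "complex^('n::finite option) \<Rightarrow> complex^'n" where
  "proj_pt v = (\<chi> i. v $ Some i / v $ None)"

lemma act_eq_proj_pt: "act g z = proj_pt (g *v lift_pt z)"
  by (simp add: act_def proj_pt_def)

lemma lift_proj_pt: "v $ None \<noteq> 0 \<Longrightarrow> lift_pt (proj_pt v) = inverse (v $ None) *s v"
  by (auto simp: vec_eq_iff lift_pt_def proj_pt_def field_simps split: option.splits)

lemma proj_pt_scale: "c \<noteq> 0 \<Longrightarrow> proj_pt (c *s v) = proj_pt v"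
  by (simp add: proj_pt_def)

lemma proj_lift_pt [simp]: "proj_pt (lift_pt z) = z"
  by (simp add: proj_pt_def lift_pt_def vec_eq_iff)

lemma lift_pt_None [simp]: "lift_pt z $ None = 1"
  and lift_pt_Some [simp]: "lift_pt z $ Some i = z $ i"
  by (simp_all add: lift_pt_def)

lemma lift_pt_neq_0: "lift_pt z \<noteq> 0"
  by (metis lift_pt_None zero_index zero_neq_one)

text \<open>A nonzero vector that is negative or null projects to a finite point: with vanishing last coordinate the form
would be positive definite on it. This is why all denominators of the action on the closed ball are nonzero.\<close>
lemma None_coord_neq_0:
  assumes "v \<noteq> 0" "Re (herm v v) \<le> 0"
  shows "v $ None \<noteq> 0"
proof
  assume *: "v $ None = 0"
  then have "(\<Sum>i\<in>UNIV. (cmod (v $ Some i))\<^sup>2) \<le> 0"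
    using assms(2) by (simp add: herm_self)
  then have "(\<Sum>i\<in>UNIV. (cmod (v $ Some i))\<^sup>2) = 0"
    by (simp add: order_antisym sum_nonneg)
  then have "\<And>i. v $ Some i = 0"
    by (simp add: sum_nonneg_eq_0_iff)
  with * have "v = 0"
    by (metis (mono_tags, opaque_lifting) not_None_eq vec_eq_iff zero_index)
  with assms show False by simp
qed

lemma Re_herm_lift: "Re (herm (lift_pt z) (lift_pt z)) = (norm z)\<^sup>2 - 1"
  using height_eq[of z] by (simp add: height_def)

lemma SU_det: "g \<in> carrier SU \<Longrightarrow> det g = 1"
  and SU_herm: "g \<in> carrier SU \<Longrightarrow> herm (g *v z) (g *v w) = herm z w"
  by (simp_all add: SU_def)

lemma SU_mult_closed: "g \<in> carrier SU \<Longrightarrow> h \<in> carrier SU \<Longrightarrow> g ** h \<in> carrier SU"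
  by (simp add: SU_def det_mul flip: matrix_vector_mul_assoc)

lemma SU_matrix_inv:
  assumes "g \<in> carrier SU"
  shows "matrix_inv g \<in> carrier SU" "matrix_inv g ** g = mat 1" "g ** matrix_inv g = mat 1"
proof -
  have "invertible g"
    using assms by (simp add: invertible_det_nz SU_def)
  then have "g ** matrix_inv g = mat 1 \<and> matrix_inv g ** g = mat 1"
    unfolding invertible_def matrix_inv_def by (rule someI_ex)
  then show *: "matrix_inv g ** g = mat 1" "g ** matrix_inv g = mat 1"
    by simp_all
  have "det (matrix_inv g) = 1"
    using *(1) SU_det[OF assms] by (metis det_I det_mul mult.right_neutral)
  moreover have "herm (matrix_inv g *v z) (matrix_inv g *v w) = herm z w" for z w
    using SU_herm[OF assms, of "matrix_inv g *v z" "matrix_inv g *v w"] *(2)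
    by (simp add: matrix_vector_mul_assoc)
  ultimately show "matrix_inv g \<in> carrier SU"
    by (simp add: SU_def)
qed

lemma SU_simps [simp]: "mult SU = (\<lambda>g h. g ** h)" "one SU = mat 1"
  by (simp_all add: SU_def)

lemma group_SU: "group SU"
proof (rule groupI)
  show "\<one>\<^bsub>SU\<^esub> \<in> carrier SU"
    by (simp add: SU_def)
qed (auto simp: SU_mult_closed matrix_mul_assoc intro: SU_matrix_inv)

lemma SU_inv: "g \<in> carrier SU \<Longrightarrow> inv\<^bsub>SU\<^esub> g = matrix_inv g"
  using group.inv_equality[OF group_SU, of "matrix_inv g" g] SU_matrix_inv[of g] by simp

lemma SU_inv_closed: "g \<in> carrier SU \<Longrightarrow> inv\<^bsub>SU\<^esub> g \<in> carrier SU"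
  by (simp add: SU_inv SU_matrix_inv)

lemma SU_inv_mul:
  assumes "g \<in> carrier SU"
  shows "inv\<^bsub>SU\<^esub> g ** g = mat 1" "g ** inv\<^bsub>SU\<^esub> g = mat 1"
  using assms by (simp_all add: SU_inv SU_matrix_inv)

lemma SU_mult_vec_neq_0: "g \<in> carrier SU \<Longrightarrow> v \<noteq> 0 \<Longrightarrow> g *v v \<noteq> 0"
  by (metis SU_inv_mul(1) matrix_vector_mul_assoc matrix_vector_mul_lid matrix_vector_mult_0_right)

lemma SU_denominator_neq_0:
  assumes "g \<in> carrier SU" "z \<in> cball 0 1"
  shows "(g *v lift_pt z) $ None \<noteq> 0"
proof (rule None_coord_neq_0)
  show "g *v lift_pt z \<noteq> 0"
    by (intro SU_mult_vec_neq_0 assms lift_pt_neq_0)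
  show "Re (herm (g *v lift_pt z) (g *v lift_pt z)) \<le> 0"
    using assms by (simp add: SU_herm Re_herm_lift abs_square_le_1)
qed

lemma autj_neq_0: "g \<in> carrier SU \<Longrightarrow> z \<in> cball 0 1 \<Longrightarrow> autj g z \<noteq> 0"
  using SU_denominator_neq_0 by (simp add: autj_def)

lemma lift_act:
  assumes "g \<in> carrier SU" "z \<in> cball 0 1"
  shows "lift_pt (act g z) = autj g z *s (g *v lift_pt z)"
  using SU_denominator_neq_0[OF assms] by (simp add: act_eq_proj_pt lift_proj_pt autj_def)

text \<open>The lift of \<open>act g z\<close> is \<open>autj g z\<close> times the image of the lift of \<open>z\<close>, and the form is invariant.\<close>
lemma height_act:
  assumes "g \<in> carrier SU" "z \<in> cball 0 1"
  shows "height (act g z) = (cmod (autj g z))\<^sup>2 * height z"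
proof -
  have "herm (lift_pt (act g z)) (lift_pt (act g z))
      = of_real ((cmod (autj g z))\<^sup>2) * herm (lift_pt z) (lift_pt z)"
    by (simp add: lift_act[OF assms] herm_scale_left herm_scale_right SU_herm assms
          complex_norm_square del: of_real_power)
  then show ?thesis
    by (simp add: height_def del: of_real_power)
qed

lemma act_in_ball_iff:
  assumes "g \<in> carrier SU" "z \<in> cball 0 1"
  shows "act g z \<in> ball 0 1 \<longleftrightarrow> z \<in> ball 0 1"
  using autj_neq_0[OF assms]
  unfolding height_pos_iff[symmetric] by (simp add: height_act[OF assms] zero_less_mult_iff)

lemma act_in_ball: "g \<in> carrier SU \<Longrightarrow> z \<in> ball 0 1 \<Longrightarrow> act g z \<in> ball 0 1"
  using act_in_ball_iff[of g z] by auto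

lemma act_in_cball:
  assumes "g \<in> carrier SU" "z \<in> cball 0 1"
  shows "act g z \<in> cball 0 1"
proof -
  have "0 \<le> height (act g z)"
    unfolding height_act[OF assms] using assms(2) by (simp add: height_eq abs_square_le_1)
  then show ?thesis
    by (simp add: height_eq abs_square_le_1)
qed

lemma act_in_sphere: "g \<in> carrier SU \<Longrightarrow> z \<in> sphere 0 1 \<Longrightarrow> act g z \<in> sphere 0 1"
  using act_in_cball[of g z] act_in_ball_iff[of g z] by auto

lemma act_one [simp]: "act (mat 1) z = z"
  by (simp add: act_eq_proj_pt)

lemma act_mult:
  assumes "h \<in> carrier SU" "z \<in> cball 0 1"
  shows "act (g ** h) z = act g (act h z)"
proof -
  have "act g (act h z) = proj_pt (autj h z *s (g *v (h *v lift_pt z)))"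
    by (simp add: act_eq_proj_pt[of g] lift_act[OF assms] vector_scalar_commute)
  then show ?thesis
    by (simp add: proj_pt_scale autj_neq_0[OF assms] act_eq_proj_pt matrix_vector_mul_assoc)
qed

lemma autj_mult:
  assumes "h \<in> carrier SU" "z \<in> cball 0 1"
  shows "autj (g ** h) z = autj g (act h z) * autj h z"
  using autj_neq_0[OF assms]
  by (simp add: autj_def[of g] lift_act[OF assms] vector_scalar_commute matrix_vector_mul_assoc)
     (simp add: autj_def)

lemma act_inv_act:
  assumes "g \<in> carrier SU" "z \<in> cball 0 1"
  shows "act (inv\<^bsub>SU\<^esub> g) (act g z) = z" "act g (act (inv\<^bsub>SU\<^esub> g) z) = z"
  using act_mult[OF assms, of "inv\<^bsub>SU\<^esub> g"] act_mult[OF SU_inv_closed[OF assms(1)] assms(2), of g]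
  by (simp_all add: SU_inv_mul assms(1))

section \<open>Linear maps that preserve Lebesgue measure\<close>

lemma sigma_finite_locally_finite:
  fixes \<mu> :: "'a::euclidean_space measure"
  assumes sets: "sets \<mu> = sets borel" and fin: "\<And>r. emeasure \<mu> (ball 0 r) < \<infinity>"
  shows "sigma_finite_measure \<mu>"
proof
  have "(\<Union>n. ball (0::'a) (real n)) = UNIV"
    by (auto intro: reals_Archimedean2)
  then show "\<exists>A. countable A \<and> A \<subseteq> sets \<mu> \<and> \<Union>A = space \<mu> \<and> (\<forall>a\<in>A. emeasure \<mu> a \<noteq> \<infinity>)"
    using fin sets_eq_imp_space_eq[OF sets]
    by (intro exI[of _ "range (\<lambda>n::nat. ball 0 (real n))"]) (auto simp: sets less_top[symmetric])
qed

lemma lborel_translate: "distr lborel borel ((+) a) = (lborel :: 'a::euclidean_space measure)"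
  using lborel_affine[of 1 a] by (simp add: density_1)

lemma nn_integral_lborel_translate:
  fixes F :: "'a::euclidean_space \<Rightarrow> ennreal"
  assumes [measurable]: "F \<in> borel_measurable borel"
  shows "(\<integral>\<^sup>+y. F (x + y) \<partial>lborel) = (\<integral>\<^sup>+y. F y \<partial>lborel)"
    and "(\<integral>\<^sup>+y. F (x - y) \<partial>lborel) = (\<integral>\<^sup>+y. F y \<partial>lborel)"
proof -
  from arg_cong[where f = "\<lambda>M. integral\<^sup>N M F", OF lborel_translate[of x]]
  show "(\<integral>\<^sup>+y. F (x + y) \<partial>lborel) = (\<integral>\<^sup>+y. F y \<partial>lborel)"
    by (simp add: nn_integral_distr)
  have "lborel = distr lborel borel (\<lambda>y. x - y)"
    using lborel_affine[of "-1" x] by (simp add: density_1)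
  from arg_cong[where f = "\<lambda>M. integral\<^sup>N M F", OF this]
  show "(\<integral>\<^sup>+y. F (x - y) \<partial>lborel) = (\<integral>\<^sup>+y. F y \<partial>lborel)"
    by (simp add: nn_integral_distr)
qed

text \<open>Uniqueness of Haar measure in cross-multiplied form. Integrate \<open>1\<^sub>A(x) 1\<^sub>B(x + y)\<close> over both variables: integrating
over \<open>y\<close> first gives the left-hand side, and shifting \<open>x\<close> by \<open>-y\<close> before integrating gives the right-hand side.\<close>
lemma translation_invariant_proportional:
  fixes \<mu> :: "'a::euclidean_space measure"
  assumes sets [measurable_cong]: "sets \<mu> = sets borel" and fin: "\<And>r. emeasure \<mu> (ball 0 r) < \<infinity>"
    and inv: "\<And>a. distr \<mu> borel ((+) a) = \<mu>"
    and [measurable]: "A \<in> sets borel" "B \<in> sets borel"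
  shows "emeasure \<mu> A * emeasure lborel B = emeasure \<mu> B * emeasure lborel A"
proof -
  interpret \<mu>: sigma_finite_measure \<mu>
    by (rule sigma_finite_locally_finite) fact+
  interpret pair_sigma_finite lborel \<mu> ..
  have "emeasure \<mu> A * emeasure lborel B = (\<integral>\<^sup>+x. indicator A x * (\<integral>\<^sup>+y. indicator B (x + y) \<partial>lborel) \<partial>\<mu>)"
    by (simp add: nn_integral_lborel_translate nn_integral_multc sets)
  also have "\<dots> = (\<integral>\<^sup>+x. (\<integral>\<^sup>+y. indicator A x * indicator B (x + y) \<partial>lborel) \<partial>\<mu>)"
    by (simp add: nn_integral_cmult)
  also have "\<dots> = (\<integral>\<^sup>+y. (\<integral>\<^sup>+x. indicator A x * indicator B (x + y) \<partial>\<mu>) \<partial>lborel)"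
    by (rule Fubini') measurable
  also have "\<dots> = (\<integral>\<^sup>+y. (\<integral>\<^sup>+x. indicator A (x - y) * indicator B x \<partial>\<mu>) \<partial>lborel)"
  proof (rule nn_integral_cong)
    fix y
    have "(\<integral>\<^sup>+x. indicator A (x - y) * indicator B x \<partial>\<mu>)
        = (\<integral>\<^sup>+x. indicator A (x - y) * indicator B x \<partial>distr \<mu> borel ((+) y))"
      by (simp add: inv)
    also have "\<dots> = (\<integral>\<^sup>+x. indicator A x * indicator B (x + y) \<partial>\<mu>)"
      by (subst nn_integral_distr) (auto simp: add.commute)
    finally show "(\<integral>\<^sup>+x. indicator A x * indicator B (x + y) \<partial>\<mu>)
        = (\<integral>\<^sup>+x. indicator A (x - y) * indicator B x \<partial>\<mu>)" ..
  qed
  also have "\<dots> = (\<integral>\<^sup>+x. (\<integral>\<^sup>+y. indicator A (x - y) * indicator B x \<partial>lborel) \<partial>\<mu>)"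
    by (rule Fubini'[symmetric]) measurable
  also have "\<dots> = (\<integral>\<^sup>+x. (\<integral>\<^sup>+y. indicator A (x - y) \<partial>lborel) * indicator B x \<partial>\<mu>)"
    by (simp add: nn_integral_multc)
  also have "\<dots> = (\<integral>\<^sup>+x. emeasure lborel A * indicator B x \<partial>\<mu>)"
    by (simp add: nn_integral_lborel_translate)
  also have "\<dots> = emeasure \<mu> B * emeasure lborel A"
    by (subst nn_integral_cmult) (auto simp: sets mult.commute)
  finally show ?thesis .
qed

lemma ball_lborel_finite_pos:
  "emeasure lborel (ball (0::'a::euclidean_space) 1) \<noteq> 0"
  "emeasure lborel (ball (0::'a::euclidean_space) 1) \<noteq> \<infinity>"
  by (simp_all add: emeasure_ball ennreal_eq_0_iff not_le unit_ball_vol_pos)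

lemma borel_measurable_linear:
  fixes f :: "'a::euclidean_space \<Rightarrow> 'b::euclidean_space"
  shows "linear f \<Longrightarrow> f \<in> borel_measurable borel"
  by (simp add: borel_measurable_continuous_onI linear_continuous_on linear_conv_bounded_linear)

text \<open>The image of Lebesgue measure under a linear bijection is translation invariant, so it is a multiple of Lebesgue
measure. The multiple is found by measuring the preimage of the unit ball; this replaces determinants below.\<close>
lemma distr_lborel_linear:
  fixes f :: "'a::euclidean_space \<Rightarrow> 'b::euclidean_space" and g :: "'b \<Rightarrow> 'a"
  assumes lin: "linear f" "linear g" and inv: "\<And>x. g (f x) = x" "\<And>y. f (g y) = y"
    and [measurable]: "A \<in> sets borel"
  shows "emeasure (distr lborel borel f) A * emeasure lborel (ball (0::'b) 1)
       = emeasure lborel (f -` ball 0 1) * emeasure lborel A"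
proof -
  have [measurable]: "f \<in> borel_measurable borel"
    using lin by (simp add: borel_measurable_linear)
  have "emeasure (distr lborel borel f) A * emeasure lborel (ball (0::'b) 1)
      = emeasure (distr lborel borel f) (ball 0 1) * emeasure lborel A"
  proof (rule translation_invariant_proportional)
    fix r
    have "f -` ball 0 r \<subseteq> g ` ball 0 r"
      using inv by (metis image_eqI subsetI vimageE)
    then have "bounded (f -` ball 0 r)"
      using lin by (meson bounded_ball bounded_linear_image bounded_subset linear_conv_bounded_linear)
    from emeasure_bounded_finite[OF this]
    show "emeasure (distr lborel borel f) (ball 0 r) < \<infinity>"
      by (simp add: emeasure_distr)
  next
    fix a
    have "distr (distr lborel borel f) borel ((+) a) = distr lborel borel (\<lambda>x. a + f x)"
      by (subst distr_distr) (auto simp: o_def)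
    also have "(\<lambda>x. a + f x) = f \<circ> (\<lambda>x. g a + x)"
      using lin inv by (simp add: fun_eq_iff linear_add)
    also have "distr lborel borel (f \<circ> (\<lambda>x. g a + x)) = distr (distr lborel borel (\<lambda>x. g a + x)) borel f"
      by (subst distr_distr) auto
    also have "distr lborel borel (\<lambda>x. g a + x) = lborel"
      by (rule lborel_translate)
    finally show "distr (distr lborel borel f) borel ((+) a) = distr lborel borel f" .
  qed auto
  then show ?thesis
    by (simp add: emeasure_distr)
qed

text \<open>An isometry pulls the unit ball back to the unit ball, so the factor in \<open>distr_lborel_linear\<close> is 1.\<close>
lemma lborel_linear_isometry:
  fixes f :: "'a::euclidean_space \<Rightarrow> 'b::euclidean_space" and g :: "'b \<Rightarrow> 'a"
  assumes lin: "linear f" "linear g" and inv: "\<And>x. g (f x) = x" "\<And>y. f (g y) = y"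
    and norm: "\<And>x. norm (f x) = norm x"
  shows "distr lborel borel f = lborel"
proof (rule measure_eqI)
  fix A assume "A \<in> sets (distr lborel borel f)"
  then have A: "A \<in> sets borel" by simp
  have "dim (f ` UNIV) = dim (UNIV :: 'a set)"
    using lin(1) inv(1) by (intro dim_image_eq) (auto simp: inj_on_def, metis)
  moreover have "f ` UNIV = UNIV"
    by (metis inv(2) surjI)
  ultimately have "DIM('a) = DIM('b)" by simp
  then have "emeasure lborel (ball (0::'a) 1) = emeasure lborel (ball (0::'b) 1)"
    by (simp add: emeasure_ball)
  moreover have "f -` ball 0 1 = ball 0 1"
    by (auto simp: norm)
  ultimately show "emeasure (distr lborel borel f) A = emeasure lborel A"
    using distr_lborel_linear[OF lin inv A] ball_lborel_finite_pos[where 'a='b]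
    by (simp add: mult.commute[of _ "emeasure lborel (ball (0::'b) 1)"] ennreal_mult_cancel_left)
qed simp

text \<open>The scaling factor is multiplicative, so the square of the factor of an involution is 1.\<close>
lemma lborel_linear_involution:
  fixes f :: "'a::euclidean_space \<Rightarrow> 'a"
  assumes lin: "linear f" and inv: "\<And>x. f (f x) = x"
  shows "distr lborel borel f = lborel"
proof (rule measure_eqI)
  have [measurable]: "f \<in> borel_measurable borel"
    using lin by (simp add: borel_measurable_linear)
  define v where "v = emeasure lborel (ball (0::'a) 1)"
  define c where "c = emeasure lborel (f -` ball 0 1)"
  have v: "v \<noteq> 0" "v \<noteq> \<infinity>"
    using ball_lborel_finite_pos by (simp_all add: v_def)
  have *: "emeasure lborel (f -` A) * v = c * emeasure lborel A" if "A \<in> sets borel" for A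
    using distr_lborel_linear[OF lin lin inv inv that] that by (simp add: emeasure_distr v_def c_def)
  have vc: "v * v = c * c"
  proof -
    have "f -` f -` ball 0 1 = ball 0 1"
      by (auto simp: inv)
    moreover have "f -` ball 0 1 \<in> sets borel"
      using measurable_sets[of f borel borel "ball 0 1"] by simp
    ultimately show ?thesis
      using *[of "f -` ball 0 1"] by (simp add: v_def c_def)
  qed
  define a where "a = enn2real v"
  have a: "v = ennreal a" "a \<ge> 0"
    using v by (simp_all add: a_def ennreal_enn2real_if)
  have "c \<noteq> \<infinity>"
  proof
    assume "c = \<infinity>"
    then have "v * v = \<infinity>"
      using vc by (simp only: ennreal_top_mult infinity_ennreal_def ennreal_top_neq_zero if_False)
    then show False
      using v by (simp only: infinity_ennreal_def ennreal_mult_eq_top_iff simp_thms)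
  qed
  define b where "b = enn2real c"
  have b: "c = ennreal b" "b \<ge> 0"
    using \<open>c \<noteq> \<infinity>\<close> by (simp_all add: b_def ennreal_enn2real_if)
  have "ennreal (a * a) = ennreal (b * b)"
    using vc a(2) b(2) unfolding a(1) b(1) by (simp only: ennreal_mult)
  then have "a * a = b * b"
    using a(2) b(2) by (simp only: ennreal_inj zero_le_mult_iff simp_thms)
  then have "a = b"
    using a(2) b(2) by (metis power2_eq_imp_eq power2_eq_square)
  then have cv: "c = v"
    using a(1) b(1) by simp
  fix A assume "A \<in> sets (distr lborel borel f)"
  then have A: "A \<in> sets borel" by simp
  have "v * emeasure lborel (f -` A) = v * emeasure lborel A"
    using *[OF A] unfolding cv by (simp only: mult.commute)
  then have "emeasure lborel (f -` A) = emeasure lborel A"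
    using v by (metis ennreal_mult_cancel_left infinity_ennreal_def)
  then show "emeasure (distr lborel borel f) A = emeasure lborel A"
    using A by (simp add: emeasure_distr)
qed simp

lemma linear_matrix_vector_complex: "linear ((*v) (G :: complex^'k^'m))"
proof (rule linearI)
  show "G *v (r *\<^sub>R x) = r *\<^sub>R (G *v x)" for r x
    by (simp add: matrix_vector_mult_def vec_eq_iff scaleR_sum_right)
qed (simp add: matrix_vector_right_distrib)

lemma linear_scale_vec: "linear (\<lambda>z :: complex^'k. c *s z)"
  by (rule linearI) (simp_all add: vec_eq_iff algebra_simps)

lemma borel_measurable_scale_vec [measurable]: "(\<lambda>z :: complex^'k. c *s z) \<in> borel_measurable borel"
  by (rule borel_measurable_linear[OF linear_scale_vec])

lemma borel_measurable_matrix_vec [measurable]: "(*v) (G :: complex^'k^'m) \<in> borel_measurable borel"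
  by (rule borel_measurable_linear[OF linear_matrix_vector_complex])

lemma norm_scale_vec: "norm (c *s z) = cmod c * norm (z :: complex^'k)"
  by (simp add: norm_vec_def norm_mult L2_set_right_distrib)

lemma UNIV_option_sum: "(\<Sum>i\<in>UNIV. f i) = (\<Sum>j\<in>UNIV. f (Some j)) + f (None :: 'n::finite option)"
  by (simp add: UNIV_option_conv sum.reindex add.commute)

text \<open>The Euclidean norm is determined by the Hermitian form and the last coordinate; a map that preserves both is an
isometry.\<close>
lemma norm_herm: "(norm x)\<^sup>2 = Re (herm x x) + 2 * (cmod (x $ None))\<^sup>2"
  by (simp add: norm_vec_power2 UNIV_option_sum herm_self)

lemma herm_lift_0: "herm x (lift_pt 0) = - (x $ None)"
  by (simp add: herm_def)

lemma herm_diff_left: "herm (x - y) z = herm x z - herm y z"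
  and herm_diff_right: "herm z (x - y) = herm z x - herm z y"
  by (simp_all add: herm_def algebra_simps sum_subtractf)

lemma scaleR_vec_eq: "r *\<^sub>R x = complex_of_real r *s x" for x :: "complex^'k"
  by (simp add: vec_eq_iff) (simp add: scaleR_conv_of_real)

text \<open>Let \<open>v\<close> be the image of the last basis vector \<open>e\<close>. Both are vectors of norm -1, and a suitable phase \<open>e'\<close> of \<open>e\<close> has
\<open>\<langle>v, e'\<rangle>\<close> real and nonnegative, so that \<open>v - e'\<close> is not null and the reflection in it exchanges \<open>v\<close> and \<open>e'\<close>.
Composing \<open>g\<close> with this reflection yields a map that fixes the line of \<open>e\<close>; it preserves the modulus of the last
coordinate and hence the Euclidean norm. Thus \<open>g\<close> is an isometry followed by a reflection, which is an involution.\<close>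
lemma lborel_SU:
  assumes g: "g \<in> carrier SU"
  shows "distr lborel borel ((*v) g) = (lborel :: (complex^('n::finite option)) measure)"
proof -
  define e :: "complex^('n option)" where "e = lift_pt 0"
  define v where "v = g *v e"
  have ee: "herm e e = -1"
    by (simp add: e_def herm_lift)
  have vv: "herm v v = -1"
    using SU_herm[OF g] ee by (simp add: v_def)
  have "v $ None \<noteq> 0"
    using vv by (intro None_coord_neq_0) (auto simp: herm_def)
  \<comment> \<open>This phase makes \<open>\<langle>v, c e\<rangle>\<close> equal to the modulus of the last coordinate of \<open>v\<close>.\<close>
  define c where "c = - (v $ None) / cmod (v $ None)"
  have c: "c * cnj c = 1" "cmod c = 1"
    using \<open>v $ None \<noteq> 0\<close> by (simp_all add: c_def complex_norm_square[symmetric] norm_divide power2_eq_square field_simps)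
  define e' where "e' = c *s e"
  have ve': "herm v e' = cmod (v $ None)"
  proof -
    have "herm v e' = cnj c * (- (v $ None))"
      by (simp add: e'_def e_def herm_scale_right herm_lift_0)
    also have "\<dots> = cnj (v $ None) * v $ None / cmod (v $ None)"
      by (simp add: c_def)
    finally have "herm v e' = cnj (v $ None) * v $ None / cmod (v $ None)" .
    then show ?thesis
      using \<open>v $ None \<noteq> 0\<close> by (simp add: complex_norm_square[symmetric] mult.commute power2_eq_square)
  qed
  have e'v: "herm e' v = cmod (v $ None)"
    using herm_commute[of e' v] ve' by simp
  have e'e': "herm e' e' = -1"
    using c by (simp add: e'_def herm_scale_left herm_scale_right ee mult.commute)
  define u where "u = v - e'"
  \<comment> \<open>The norm of the reflecting vector: both vectors have norm -1, so \<open>d\<close> is at most -2 and in particular nonzero.\<close>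
  define d where "d = -2 - 2 * cmod (v $ None)"
  have "d < 0"
    using norm_ge_zero[of "v $ None"] unfolding d_def by linarith
  then have d: "d \<noteq> 0" by simp
  have uu: "herm u u = d"
    by (simp add: u_def d_def herm_diff_left herm_diff_right vv ve' e'v e'e')
  have vu: "herm v u = d / 2"
    by (simp add: u_def d_def herm_diff_right vv ve')
  define R where "R x = x - (2 * herm x u / d) *s u" for x
  have Ru: "herm (R x) u = - herm x u" for x
    using d by (simp add: R_def herm_diff_left herm_scale_left uu)
  have RR: "R (R x) = x" for x
    using Ru[of x] unfolding R_def[of "R x"] by (simp add: R_def vec_eq_iff)
  have linR: "linear R"
  proof (rule linearI)
    show "R (x + y) = R x + R y" for x y
      by (simp add: R_def herm_add_left vec_eq_iff add_divide_distrib ring_distribs)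
    show "R (r *\<^sub>R x) = r *\<^sub>R R x" for r x
    proof -
      have "herm (r *\<^sub>R x) u = r *\<^sub>R herm x u"
        using herm_scale_left[of "of_real r" x u]
        unfolding scaleR_vec_eq by (simp only: scaleR_conv_of_real)
      then have "R (r *\<^sub>R x) = complex_of_real r *s x - (2 * (complex_of_real r * herm x u) / d) *s u"
        unfolding R_def scaleR_conv_of_real[where 'a = complex] by (simp only: scaleR_vec_eq)
      also have "\<dots> = complex_of_real r *s R x"
        by (simp add: R_def vec_eq_iff right_diff_distrib)
      finally show ?thesis
        by (simp only: scaleR_vec_eq)
    qed
  qed
  have Rherm: "herm (R x) (R y) = herm x y" for x y
  proof -
    have "herm (R x) (R y) = herm (R x) y - cnj (2 * herm y u / d) * herm (R x) u"
      by (simp add: R_def[of y] herm_diff_right herm_scale_right)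
    also have "\<dots> = herm (R x) y + 2 * herm u y / d * herm x u"
      by (simp add: Ru herm_commute[of u y])
    also have "\<dots> = herm x y"
      by (simp add: R_def herm_diff_left herm_scale_left)
    finally show ?thesis .
  qed
  have Rv: "R v = e'"
  proof -
    have "R v = v - u"
      using d by (simp add: R_def vu)
    then show ?thesis by (simp add: u_def)
  qed
  define h where "h = R \<circ> (*v) g"
  have linh: "linear h"
    unfolding h_def by (intro linear_compose linear_matrix_vector_complex linR)
  have hherm: "herm (h x) (h y) = herm x y" for x y
    by (simp add: h_def Rherm SU_herm[OF g])
  have he: "h e = c *s e"
    using Rv by (simp add: h_def v_def e'_def)
  have hnorm: "norm (h x) = norm x" for x
  proof -
    have "herm x e = cnj c * herm (h x) e"
      using hherm[of x e] by (simp add: he herm_scale_right)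
    then have "cmod (x $ None) = cmod (h x $ None)"
      using c by (simp add: e_def herm_lift_0 norm_mult)
    then have "(norm (h x))\<^sup>2 = (norm x)\<^sup>2"
      by (simp add: norm_herm hherm)
    then show ?thesis by simp
  qed
  define h' where "h' = (*v) (inv\<^bsub>SU\<^esub> g) \<circ> R"
  have "linear h'"
    unfolding h'_def by (intro linear_compose linear_matrix_vector_complex linR)
  then have h: "distr lborel borel h = lborel"
    by (rule lborel_linear_isometry[OF linh])
       (simp_all add: h_def h'_def RR SU_inv_mul g matrix_vector_mul_assoc hnorm[unfolded h_def o_def])
  have R: "distr lborel borel R = lborel"
    by (rule lborel_linear_involution[OF linR RR])
  have [measurable]: "R \<in> borel_measurable borel" "h \<in> borel_measurable borel"
    by (rule borel_measurable_linear[OF linR], rule borel_measurable_linear[OF linh])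
  have "(*v) g = R \<circ> h"
    by (simp add: h_def fun_eq_iff RR)
  then have "distr lborel borel ((*v) g) = distr (distr lborel borel h) borel R"
    by (simp add: distr_distr)
  then show ?thesis
    by (simp add: h R)
qed

lemma lborel_unit_scale:
  fixes c :: complex
  assumes "cmod c = 1"
  shows "distr lborel borel (\<lambda>z :: complex^'k. c *s z) = lborel"
proof -
  have "c \<noteq> 0" using assms by auto
  then show ?thesis
    by (intro lborel_linear_isometry[where g = "\<lambda>z. inverse c *s z"] linear_scale_vec)
       (auto simp: assms norm_scale_vec)
qed

lemma nn_integral_lborel_scaleR:
  fixes F :: "'a::euclidean_space \<Rightarrow> ennreal"
  assumes [measurable]: "F \<in> borel_measurable borel" and r: "r > 0"
  shows "(\<integral>\<^sup>+x. F x \<partial>lborel) = ennreal (r ^ DIM('a)) * (\<integral>\<^sup>+x. F (r *\<^sub>R x) \<partial>lborel)"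
proof -
  have "(\<integral>\<^sup>+x. F x \<partial>lborel)
      = (\<integral>\<^sup>+x. F x \<partial>density (distr lborel borel (\<lambda>x::'a. 0 + r *\<^sub>R x)) (\<lambda>_. \<bar>r\<bar>^DIM('a)))"
    using lborel_affine[of r "0 :: 'a"] r by simp
  also have "\<dots> = ennreal (r ^ DIM('a)) * (\<integral>\<^sup>+x. F (r *\<^sub>R x) \<partial>lborel)"
    using r by (subst nn_integral_density) (auto simp: nn_integral_distr nn_integral_cmult)
  finally show ?thesis .
qed

lemma nn_integral_lborel_scale:
  fixes c :: complex and F :: "complex^'k \<Rightarrow> ennreal"
  assumes [measurable]: "F \<in> borel_measurable borel" and "c \<noteq> 0"
  shows "(\<integral>\<^sup>+z. F z \<partial>lborel) = ennreal (cmod c ^ (2 * CARD('k))) * (\<integral>\<^sup>+z. F (c *s z) \<partial>lborel)"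
proof -
  define r where "r = cmod c"
  have r: "r > 0" using assms by (simp add: r_def)
  have u: "cmod (c / r) = 1" using assms by (simp add: r_def norm_divide)
  have eq: "r *\<^sub>R ((c / r) *s z) = c *s z" for z :: "complex^'k"
    using r by (simp add: vec_eq_iff) (simp add: scaleR_conv_of_real)
  have "(\<integral>\<^sup>+z. F z \<partial>lborel) = ennreal (r ^ (2 * CARD('k))) * (\<integral>\<^sup>+z. F (r *\<^sub>R z) \<partial>lborel)"
    using nn_integral_lborel_scaleR[OF assms(1) r] by (simp add: mult.commute)
  also have "(\<integral>\<^sup>+z. F (r *\<^sub>R z) \<partial>lborel) = (\<integral>\<^sup>+z. F (r *\<^sub>R z) \<partial>distr lborel borel (\<lambda>z. (c / r) *s z))"
    by (simp add: lborel_unit_scale[OF u])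
  also have "\<dots> = (\<integral>\<^sup>+z. F (r *\<^sub>R ((c / r) *s z)) \<partial>lborel)"
    by (subst nn_integral_distr) auto
  finally show ?thesis
    unfolding eq unfolding r_def .
qed

section \<open>Invariance of the volume\<close>

lemma borel_measurable_vec_lambda:
  fixes f :: "'i::finite \<Rightarrow> 'a \<Rightarrow> complex"
  assumes [measurable]: "\<And>i. f i \<in> borel_measurable M"
  shows "(\<lambda>x. \<chi> i. f i x) \<in> borel_measurable M"
  by (subst borel_measurable_euclidean_space) (auto simp: Basis_vec_def inner_axis)

lemma borel_measurable_vec_nth [measurable]: "(\<lambda>v :: complex^'i. v $ i) \<in> borel_measurable borel"
  by (intro borel_measurable_continuous_onI continuous_intros)

lemma unit_ball_borel [measurable]: "ball (0 :: complex^'n) 1 \<in> sets borel"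
  by simp

lemma borel_measurable_proj_pt [measurable]: "proj_pt \<in> borel_measurable borel"
  unfolding proj_pt_def by (intro borel_measurable_vec_lambda) measurable

lemma continuous_on_lift_pt: "continuous_on A lift_pt"
  unfolding lift_pt_def
proof (intro continuous_on_vec_lambda)
  fix i :: "'a option"
  show "continuous_on A (\<lambda>z. case i of None \<Rightarrow> 1 | Some j \<Rightarrow> z $ j)"
    by (cases i) (auto intro!: continuous_intros)
qed

lemma borel_measurable_lift_pt [measurable]: "lift_pt \<in> borel_measurable borel"
  by (intro borel_measurable_continuous_onI continuous_on_lift_pt)

lemma borel_measurable_act [measurable]: "act g \<in> borel_measurable borel"
proof -
  have "act g = (\<lambda>z. proj_pt (g *v lift_pt z))"
    by (simp add: act_eq_proj_pt fun_eq_iff)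
  also have "\<dots> \<in> borel_measurable borel" by measurable
  finally show ?thesis .
qed

lemma borel_measurable_herm [measurable]: "(\<lambda>v. herm v w) \<in> borel_measurable borel"
  unfolding herm_def by measurable

lemma borel_measurable_herm_self [measurable]: "(\<lambda>v. herm v v) \<in> borel_measurable borel"
  unfolding herm_self by measurable

lemma borel_measurable_height [measurable]: "height \<in> borel_measurable borel"
  unfolding height_def by measurable

lemma borel_measurable_autj [measurable]: "autj g \<in> borel_measurable borel"
proof -
  have "(\<lambda>z. inverse ((g *v lift_pt z) $ None)) \<in> borel_measurable borel"
    by measurable
  then show ?thesis by (simp add: autj_def[abs_def])
qed

definition glue_vec :: "complex \<times> (complex^'n::finite) \<Rightarrow> complex^('n option)" where
  "glue_vec p = (\<chi> i. case i of None \<Rightarrow> fst p | Some j \<Rightarrow> snd p $ j)"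

lemma glue_vec_nth [simp]: "glue_vec p $ None = fst p" "glue_vec p $ Some j = snd p $ j"
  by (simp_all add: glue_vec_def)

lemma vec_option_eqI: "x $ None = y $ None \<Longrightarrow> (\<And>j. x $ Some j = y $ Some j) \<Longrightarrow> x = y"
  unfolding vec_eq_iff by (metis not_None_eq)

lemma linear_glue_vec: "linear glue_vec"
  by (rule linearI) (auto intro!: vec_option_eqI)

lemma borel_measurable_glue_vec [measurable]: "glue_vec \<in> borel_measurable borel"
  by (rule borel_measurable_linear[OF linear_glue_vec])

lemma lborel_glue_vec: "distr lborel borel glue_vec = (lborel :: (complex^('n::finite option)) measure)"
proof (rule lborel_linear_isometry[where g = "\<lambda>v. (v $ None, \<chi> j. v $ Some j)"])
  show "norm (glue_vec p) = norm p" for p :: "complex \<times> (complex^'n)"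
  proof -
    have "(norm (glue_vec p))\<^sup>2 = (norm p)\<^sup>2"
      by (cases p)
         (simp add: norm_vec_power2 UNIV_option_sum norm_Pair add.commute add_nonneg_nonneg sum_nonneg)
    then show ?thesis by simp
  qed
  show "linear (\<lambda>v :: complex^('n option). (v $ None, \<chi> j. v $ Some j))"
    by (rule linearI) (simp_all add: vec_eq_iff)
  show "(glue_vec p $ None, \<chi> j. glue_vec p $ Some j) = p" for p :: "complex \<times> (complex^'n)"
    by (cases p) (simp add: vec_eq_iff)
  show "glue_vec (v $ None, \<chi> j. v $ Some j) = v" for v :: "complex^('n option)"
    by (rule vec_option_eqI) simp_all
qed (rule linear_glue_vec)

lemma nn_integral_glue_vec:
  assumes [measurable]: "F \<in> borel_measurable borel"
  shows "(\<integral>\<^sup>+v. F v \<partial>lborel) = (\<integral>\<^sup>+c. \<integral>\<^sup>+z. F (glue_vec (c, z)) \<partial>lborel \<partial>lborel)"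
proof -
  have [measurable]: "(\<lambda>p. F (glue_vec p)) \<in> borel_measurable (lborel \<Otimes>\<^sub>M lborel)"
    unfolding lborel_prod by measurable
  have "(\<integral>\<^sup>+v. F v \<partial>lborel) = (\<integral>\<^sup>+p. F (glue_vec p) \<partial>(lborel \<Otimes>\<^sub>M lborel))"
    by (subst lborel_glue_vec[symmetric]) (simp add: nn_integral_distr lborel_prod)
  also have "\<dots> = (\<integral>\<^sup>+c. \<integral>\<^sup>+z. F (glue_vec (c, z)) \<partial>lborel \<partial>lborel)"
    by (rule lborel.nn_integral_fst[symmetric]) measurable
  finally show ?thesis .
qed

text \<open>The negative vectors of norm above -1. The set is invariant under \<open>SU(n,1)\<close> although it is unbounded, and its
fibre over a point \<open>z\<close> of the ball is a punctured disc of radius \<open>(height z)^(-1/2)\<close>.\<close>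
definition slab :: "(complex^('n::finite option)) set" where
  "slab = {v. 0 < - Re (herm v v) \<and> - Re (herm v v) < 1}"

lemma slab_borel [measurable]: "slab \<in> sets borel"
  unfolding slab_def by measurable

text \<open>Rescaling by \<open>h^(-1/2)\<close> turns the disc into the unit disc and produces \<open>h^(-(n+1))\<close>, the density of the invariant
volume. The integral over the unit disc stays symbolic: it cancels later as a finite positive factor.\<close>
lemma slab_fibre_integral:
  assumes "0 < h"
  shows "(\<integral>\<^sup>+c. ennreal (cmod c ^ (2 * n)) * indicator {c. 0 < (cmod c)\<^sup>2 * h \<and> (cmod c)\<^sup>2 * h < 1} c \<partial>lborel)
       = (\<integral>\<^sup>+c. ennreal (cmod c ^ (2 * n)) * indicator {c. 0 < cmod c \<and> cmod c < 1} c \<partial>lborel)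
         * ennreal (1 / h ^ (n + 1))" (is "?L = ?I * _")
proof -
  define r where "r = 1 / sqrt h"
  have r: "r > 0" "r\<^sup>2 = 1 / h"
    using assms by (simp_all add: r_def power_divide)
  have "?L = ennreal (r\<^sup>2) * (\<integral>\<^sup>+c. ennreal (cmod (r *\<^sub>R c) ^ (2 * n)) *
      indicator {c. 0 < (cmod c)\<^sup>2 * h \<and> (cmod c)\<^sup>2 * h < 1} (r *\<^sub>R c) \<partial>lborel)"
    unfolding DIM_complex[symmetric] by (rule nn_integral_lborel_scaleR[OF _ r(1)]) measurable
  also have "(\<lambda>c. ennreal (cmod (r *\<^sub>R c) ^ (2 * n)) *
      indicator {c. 0 < (cmod c)\<^sup>2 * h \<and> (cmod c)\<^sup>2 * h < 1} (r *\<^sub>R c) :: ennreal)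
    = (\<lambda>c. ennreal ((1 / h) ^ n) * (ennreal (cmod c ^ (2 * n)) * indicator {c. 0 < cmod c \<and> cmod c < 1} c))"
  proof
    fix c
    have 1: "cmod (r *\<^sub>R c) ^ (2 * n) = (1 / h) ^ n * cmod c ^ (2 * n)"
      using r by (simp add: power_mult_distrib power_mult[of r 2 n])
    have "(cmod (r *\<^sub>R c))\<^sup>2 * h = (cmod c)\<^sup>2"
      using r assms by (simp add: power_mult_distrib)
    then have 2: "r *\<^sub>R c \<in> {c. 0 < (cmod c)\<^sup>2 * h \<and> (cmod c)\<^sup>2 * h < 1} \<longleftrightarrow> c \<in> {c. 0 < cmod c \<and> cmod c < 1}"
      by (simp add: abs_square_less_1 del: norm_scaleR)
    show "ennreal (cmod (r *\<^sub>R c) ^ (2 * n)) *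
      indicator {c. 0 < (cmod c)\<^sup>2 * h \<and> (cmod c)\<^sup>2 * h < 1} (r *\<^sub>R c) =
      ennreal ((1 / h) ^ n) * (ennreal (cmod c ^ (2 * n)) * indicator {c. 0 < cmod c \<and> cmod c < 1} c)"
      unfolding 1 indicator_def[abs_def] 2[simplified mem_Collect_eq] mem_Collect_eq
      using 2 assms by (simp add: ennreal_mult del: norm_scaleR)
  qed
  also have "ennreal (r\<^sup>2) * (\<integral>\<^sup>+c. ennreal ((1 / h) ^ n) * (ennreal (cmod c ^ (2 * n)) * indicator {c. 0 < cmod c \<and> cmod c < 1} c) \<partial>lborel)
     = (ennreal (1 / h) * ennreal ((1 / h) ^ n)) * ?I"
    by (subst nn_integral_cmult) (auto simp: r mult_ac)
  also have "ennreal (1 / h) * ennreal ((1 / h) ^ n) = ennreal (1 / h ^ (n + 1))"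
    using assms by (simp add: ennreal_mult[symmetric] power_one_over)
  finally show ?thesis by (simp add: mult.commute)
qed

definition fibre_mass :: "nat \<Rightarrow> ennreal" where
  "fibre_mass n = (\<integral>\<^sup>+c. ennreal (cmod c ^ (2 * n)) * indicator {c. 0 < cmod c \<and> cmod c < 1} c \<partial>lborel)"

lemma fibre_mass: "fibre_mass n \<noteq> 0" "fibre_mass n \<noteq> \<infinity>"
proof -
  have "fibre_mass n \<le> (\<integral>\<^sup>+c. indicator (ball (0::complex) 1) c \<partial>lborel)"
    unfolding fibre_mass_def
    by (intro nn_integral_mono) (auto simp: indicator_def ennreal_le_1 power_le_one)
  also have "\<dots> < \<infinity>"
    using ball_lborel_finite_pos(2)[where 'a = complex] by (simp add: less_top)
  finally show "fibre_mass n \<noteq> \<infinity>" by simp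
  show "fibre_mass n \<noteq> 0"
  proof
    assume "fibre_mass n = 0"
    then have "AE c::complex in lborel. ennreal (cmod c ^ (2 * n)) * indicator {c. 0 < cmod c \<and> cmod c < 1} c = 0"
      unfolding fibre_mass_def by (subst (asm) nn_integral_0_iff_AE) auto
    moreover have "AE c::complex in lborel. c \<noteq> 0"
      by (rule AE_lborel_singleton)
    ultimately have "AE c::complex in lborel. c \<notin> ball 0 1"
    proof eventually_elim
      fix c :: complex
      assume c: "ennreal (cmod c ^ (2 * n)) * indicator {c. 0 < cmod c \<and> cmod c < 1} c = 0" "c \<noteq> 0"
      have "ennreal (cmod c ^ (2 * n)) \<noteq> 0"
        using c(2) by (metis ennreal_eq_0_iff linorder_not_less zero_less_norm_iff zero_less_power)
      then show "c \<notin> ball 0 1"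
        using c by (auto simp: indicator_def simp del: ennreal_eq_0_iff split: if_splits)
    qed
    then have "emeasure lborel (ball (0::complex) 1) = 0"
      by (subst (asm) AE_iff_measurable[of "ball 0 1"]) auto
    then show False
      using ball_lborel_finite_pos by blast
  qed
qed

lemma nn_integral_inv_vol:
  assumes [measurable]: "F \<in> borel_measurable borel"
  shows "(\<integral>\<^sup>+z. F z \<partial>inv_vol) =
    (\<integral>\<^sup>+z. ennreal (indicator (ball 0 1) z * 4 ^ CARD('n) / height z ^ (CARD('n) + 1)) * F (z :: complex^'n::finite) \<partial>lborel)"
proof -
  show ?thesis
    unfolding inv_vol_def by (rule nn_integral_density) measurable
qed

text \<open>In the coordinates \<open>v = (c z, c)\<close>, Lebesgue measure is \<open>|c|^(2n) dc dz\<close>, and the integral over \<open>c\<close> yields the invariant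
density.\<close>
lemma inv_vol_from_slab:
  fixes F :: "complex^'n::finite \<Rightarrow> ennreal"
  assumes [measurable]: "F \<in> borel_measurable borel"
  shows "ennreal (4 ^ CARD('n)) * (\<integral>\<^sup>+v. indicator slab v * F (proj_pt v) \<partial>lborel)
       = fibre_mass CARD('n) * (\<integral>\<^sup>+z. F z \<partial>inv_vol)"
proof -
  let ?n = "CARD('n)"
  have "(\<integral>\<^sup>+v. indicator slab v * F (proj_pt v) \<partial>lborel) =
      (\<integral>\<^sup>+c. \<integral>\<^sup>+z. indicator slab (glue_vec (c, z)) * F (proj_pt (glue_vec (c, z))) \<partial>lborel \<partial>lborel)"
    by (rule nn_integral_glue_vec) measurable
  also have "\<dots> = (\<integral>\<^sup>+c. \<integral>\<^sup>+z. ennreal (cmod c ^ (2 * ?n)) *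
      indicator {c. 0 < (cmod c)\<^sup>2 * height z \<and> (cmod c)\<^sup>2 * height z < 1} c * F z \<partial>lborel \<partial>lborel)"
  proof (rule nn_integral_cong_AE)
    have "AE c::complex in lborel. c \<noteq> 0"
      by (rule AE_lborel_singleton)
    then show "AE c in lborel. (\<integral>\<^sup>+z. indicator slab (glue_vec (c, z)) * F (proj_pt (glue_vec (c, z))) \<partial>lborel) =
      (\<integral>\<^sup>+z. ennreal (cmod c ^ (2 * ?n)) * indicator {c. 0 < (cmod c)\<^sup>2 * height z \<and> (cmod c)\<^sup>2 * height z < 1} c * F z \<partial>lborel)"
    proof eventually_elim
      fix c :: complex assume c: "c \<noteq> 0"
      have [measurable]: "(\<lambda>z :: complex^'n. glue_vec (c, z)) \<in> borel_measurable borel"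
        by (rule measurable_compose[OF _ borel_measurable_glue_vec]) (simp add: borel_prod[symmetric])
      have glue: "glue_vec (c, c *s z) = c *s lift_pt z" for z :: "complex^'n"
        by (rule vec_option_eqI) auto
      have herm: "- Re (herm (c *s lift_pt z) (c *s lift_pt z)) = (cmod c)\<^sup>2 * height z" for z :: "complex^'n"
      proof -
        have "herm (c *s lift_pt z) (c *s lift_pt z) = of_real ((cmod c)\<^sup>2) * herm (lift_pt z) (lift_pt z)"
          by (simp add: herm_scale_left herm_scale_right complex_norm_square del: of_real_power)
        then show ?thesis by (simp add: height_def del: of_real_power)
      qed
      have "(\<integral>\<^sup>+z. indicator slab (glue_vec (c, z)) * F (proj_pt (glue_vec (c, z))) \<partial>lborel) =
        ennreal (cmod c ^ (2 * ?n)) *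
        (\<integral>\<^sup>+z. indicator slab (glue_vec (c, c *s z)) * F (proj_pt (glue_vec (c, c *s z))) \<partial>lborel)"
        by (rule nn_integral_lborel_scale[OF _ c]) measurable
      also have "\<dots> = (\<integral>\<^sup>+z. ennreal (cmod c ^ (2 * ?n)) *
          (indicator slab (glue_vec (c, c *s z)) * F (proj_pt (glue_vec (c, c *s z)))) \<partial>lborel)"
        unfolding glue by (rule nn_integral_cmult[symmetric]) measurable
      also have "\<dots> = (\<integral>\<^sup>+z. ennreal (cmod c ^ (2 * ?n)) *
          indicator {c. 0 < (cmod c)\<^sup>2 * height z \<and> (cmod c)\<^sup>2 * height z < 1} c * F z \<partial>lborel)"
      proof -
        have "c *s lift_pt z \<in> slab \<longleftrightarrow> c \<in> {c. 0 < (cmod c)\<^sup>2 * height z \<and> (cmod c)\<^sup>2 * height z < 1}" for z :: "complex^'n"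
          unfolding slab_def mem_Collect_eq herm ..
        then show ?thesis
          unfolding glue by (simp add: proj_pt_scale c indicator_def mult.assoc)
      qed
      finally show "(\<integral>\<^sup>+z. indicator slab (glue_vec (c, z)) * F (proj_pt (glue_vec (c, z))) \<partial>lborel) =
        (\<integral>\<^sup>+z. ennreal (cmod c ^ (2 * ?n)) * indicator {c. 0 < (cmod c)\<^sup>2 * height z \<and> (cmod c)\<^sup>2 * height z < 1} c * F z \<partial>lborel)" .
    qed
  qed
  also have "\<dots> = (\<integral>\<^sup>+z. \<integral>\<^sup>+c. ennreal (cmod c ^ (2 * ?n)) *
      indicator {c. 0 < (cmod c)\<^sup>2 * height z \<and> (cmod c)\<^sup>2 * height z < 1} c * F z \<partial>lborel \<partial>lborel)"
    by (rule lborel_pair.Fubini') (simp add: indicator_def, measurable)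
  also have "\<dots> = (\<integral>\<^sup>+z. fibre_mass ?n * (ennreal (indicator (ball 0 1) z / height z ^ (?n + 1)) * F z) \<partial>lborel)"
  proof (rule nn_integral_cong)
    fix z :: "complex^'n"
    have eq: "(\<integral>\<^sup>+c. ennreal (cmod c ^ (2 * ?n)) * indicator {c. 0 < (cmod c)\<^sup>2 * height z \<and> (cmod c)\<^sup>2 * height z < 1} c * F z \<partial>lborel)
       = (\<integral>\<^sup>+c. ennreal (cmod c ^ (2 * ?n)) * indicator {c. 0 < (cmod c)\<^sup>2 * height z \<and> (cmod c)\<^sup>2 * height z < 1} c \<partial>lborel) * F z"
      by (rule nn_integral_multc) measurable
    show "(\<integral>\<^sup>+c. ennreal (cmod c ^ (2 * ?n)) * indicator {c. 0 < (cmod c)\<^sup>2 * height z \<and> (cmod c)\<^sup>2 * height z < 1} c * F z \<partial>lborel)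
       = fibre_mass ?n * (ennreal (indicator (ball 0 1) z / height z ^ (?n + 1)) * F z)"
    proof (cases "height z > 0")
      case True
      then have "z \<in> ball 0 1" by (simp only: height_pos_iff)
      then show ?thesis
        unfolding eq slab_fibre_integral[OF True] by (simp add: fibre_mass_def mult.assoc)
    next
      case False
      then have z: "z \<notin> ball 0 1" by (simp only: height_pos_iff simp_thms)
      from False have "{c::complex. 0 < (cmod c)\<^sup>2 * height z \<and> (cmod c)\<^sup>2 * height z < 1} = {}"
        by (auto simp: zero_less_mult_iff)
      then show ?thesis
        using z by simp
    qed
  qed
  also have "\<dots> = fibre_mass ?n * (\<integral>\<^sup>+z. ennreal (indicator (ball 0 1) z / height z ^ (?n + 1)) * F z \<partial>lborel)"
    by (rule nn_integral_cmult) measurable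
  finally have "ennreal (4 ^ ?n) * (\<integral>\<^sup>+v. indicator slab v * F (proj_pt v) \<partial>lborel)
     = fibre_mass ?n * (ennreal (4 ^ ?n) * (\<integral>\<^sup>+z. ennreal (indicator (ball 0 1) z / height z ^ (?n + 1)) * F z \<partial>lborel))"
    by (simp add: mult_ac)
  also have "ennreal (4 ^ ?n) * (\<integral>\<^sup>+z. ennreal (indicator (ball 0 1) z / height z ^ (?n + 1)) * F z \<partial>lborel)
     = (\<integral>\<^sup>+z. ennreal (4 ^ ?n) * (ennreal (indicator (ball 0 1) z / height z ^ (?n + 1)) * F z) \<partial>lborel)"
    by (rule nn_integral_cmult[symmetric]) measurable
  also have "\<dots> = (\<integral>\<^sup>+z. F z \<partial>inv_vol)"
    unfolding nn_integral_inv_vol[OF assms]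
  proof (rule nn_integral_cong)
    fix z :: "complex^'n"
    have "0 \<le> indicator (ball 0 1) z / height z ^ (?n + 1)"
      using height_pos_iff[of z] by (auto simp: indicator_def)
    then show "ennreal (4 ^ ?n) * (ennreal (indicator (ball 0 1) z / height z ^ (?n + 1)) * F z) =
       ennreal (indicator (ball 0 1) z * 4 ^ ?n / height z ^ (?n + 1)) * F z"
      by (simp add: mult.assoc[symmetric] ennreal_mult[symmetric] mult.commute[of "4 ^ _"])
  qed
  finally show ?thesis .
qed

lemma sets_inv_vol [simp, measurable_cong]: "sets inv_vol = sets borel"
  and space_inv_vol [simp]: "space inv_vol = UNIV"
  by (simp_all add: inv_vol_def)

lemma AE_inv_vol_ball: "AE z in inv_vol. z \<in> ball 0 1"
  unfolding inv_vol_def by (subst AE_density) (auto simp: indicator_def)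

text \<open>The projection intertwines the linear map \<open>g\<close> with \<open>act g\<close>, and \<open>g\<close> preserves both Lebesgue measure and the slab.\<close>
theorem nn_integral_inv_vol_act:
  fixes F :: "complex^'n::finite \<Rightarrow> ennreal"
  assumes g: "g \<in> carrier SU" and [measurable]: "F \<in> borel_measurable borel"
  shows "(\<integral>\<^sup>+z. F (act g z) \<partial>inv_vol) = (\<integral>\<^sup>+z. F z \<partial>inv_vol)"
proof -
  have "(\<integral>\<^sup>+v. indicator slab v * F (proj_pt v) \<partial>lborel)
      = (\<integral>\<^sup>+v. indicator slab v * F (proj_pt v) \<partial>distr lborel borel ((*v) g))"
    by (simp add: lborel_SU[OF g])
  also have "\<dots> = (\<integral>\<^sup>+v. indicator slab (g *v v) * F (proj_pt (g *v v)) \<partial>lborel)"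
    by (rule nn_integral_distr) measurable
  also have "\<dots> = (\<integral>\<^sup>+v. indicator slab v * F (act g (proj_pt v)) \<partial>lborel)"
  proof (rule nn_integral_cong)
    fix v :: "complex^('n option)"
    show "indicator slab (g *v v) * F (proj_pt (g *v v)) = indicator slab v * F (act g (proj_pt v))"
    proof (cases "v \<in> slab")
      case True
      then have "v $ None \<noteq> 0"
        by (intro None_coord_neq_0) (auto simp: slab_def herm_def)
      then have "act g (proj_pt v) = proj_pt (g *v v)"
        by (simp add: act_eq_proj_pt lift_proj_pt proj_pt_scale vector_scalar_commute)
      with True show ?thesis
        by (simp add: slab_def SU_herm[OF g] indicator_def)
    next
      case False
      then have "g *v v \<notin> slab"
        by (simp add: slab_def SU_herm[OF g])
      with False show ?thesis by simp
    qed
  qed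
  finally have "fibre_mass CARD('n) * (\<integral>\<^sup>+z. F (act g z) \<partial>inv_vol) = fibre_mass CARD('n) * (\<integral>\<^sup>+z. F z \<partial>inv_vol)"
    by (simp flip: inv_vol_from_slab)
  then show ?thesis
    using fibre_mass[of "CARD('n)"] by (simp add: ennreal_mult_cancel_left)
qed

lemma distr_inv_vol_act:
  assumes "g \<in> carrier SU"
  shows "distr inv_vol borel (act g) = inv_vol"
proof (rule measure_eqI)
  fix A assume "A \<in> sets (distr inv_vol borel (act g))"
  then have [measurable]: "A \<in> sets borel" by simp
  have "emeasure (distr inv_vol borel (act g)) A = (\<integral>\<^sup>+z. indicator A z \<partial>distr inv_vol borel (act g))"
    by simp
  also have "\<dots> = (\<integral>\<^sup>+z. indicator A (act g z) \<partial>inv_vol)"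
    by (rule nn_integral_distr) measurable
  also have "\<dots> = emeasure inv_vol A"
    by (subst nn_integral_inv_vol_act[OF assms]) auto
  finally show "emeasure (distr inv_vol borel (act g)) A = emeasure inv_vol A" .
qed simp

section \<open>Discrete subgroups and fundamental domains\<close>

lemma SU_column_bound:
  assumes g: "g \<in> carrier SU"
  shows "cmod (g $ i $ None) \<le> cmod (g $ None $ None)"
proof -
  have col: "(g *v lift_pt 0) $ i = g $ i $ None" for i
    by (simp add: matrix_vector_mult_def UNIV_option_sum)
  have "Re (herm (g *v lift_pt 0) (g *v lift_pt 0)) = -1"
    by (simp add: SU_herm[OF g] Re_herm_lift)
  then have *: "(\<Sum>j\<in>UNIV. (cmod (g $ Some j $ None))\<^sup>2) = (cmod (g $ None $ None))\<^sup>2 - 1"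
    by (simp add: herm_self col)
  have "(cmod (g $ i $ None))\<^sup>2 \<le> (cmod (g $ None $ None))\<^sup>2"
  proof (cases i)
    case (Some j)
    have "(cmod (g $ Some j $ None))\<^sup>2 \<le> (\<Sum>j\<in>UNIV. (cmod (g $ Some j $ None))\<^sup>2)"
      by (rule member_le_sum) auto
    with * Some show ?thesis by (simp del: power_mono_iff)
  qed simp
  then show ?thesis
    by (rule power2_le_imp_le) simp
qed

lemma herm_column_inv:
  assumes g: "g \<in> carrier SU"
  shows "herm (g *v x) y = herm x (inv\<^bsub>SU\<^esub> g *v y)"
  using SU_herm[OF g, of x "inv\<^bsub>SU\<^esub> g *v y"] by (simp add: matrix_vector_mul_assoc SU_inv_mul[OF g])

lemma mult_vec_axis: "(g *v axis j 1) $ i = (g :: complex^'a^'b) $ i $ j"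
  by (simp add: matrix_vector_mult_def axis_def if_distrib if_distribR cong: if_cong)

lemma lift_pt_0: "lift_pt 0 = axis None 1"
  by (rule vec_option_eqI) (simp_all add: axis_def)

text \<open>The inverse of a matrix that preserves the form is its adjoint with respect to the form, so its last column has the
moduli of the last row of the matrix.\<close>
lemma SU_row_inv:
  assumes g: "g \<in> carrier SU"
  shows "cmod (g $ None $ i) = cmod ((inv\<^bsub>SU\<^esub> g) $ i $ None)"
proof -
  have col: "(inv\<^bsub>SU\<^esub> g *v lift_pt 0) $ j = (inv\<^bsub>SU\<^esub> g) $ j $ None" for j
    by (simp add: lift_pt_0 mult_vec_axis)
  have "- (g $ None $ i) = herm (axis i 1) (inv\<^bsub>SU\<^esub> g *v lift_pt 0)"
    using herm_lift_0[of "g *v axis i 1"] herm_column_inv[OF g, of "axis i 1" "lift_pt 0"]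
    by (simp add: mult_vec_axis)
  also have "\<dots> = (if i = None then - cnj ((inv\<^bsub>SU\<^esub> g) $ i $ None) else cnj ((inv\<^bsub>SU\<^esub> g) $ i $ None))"
    by (cases i) (auto simp: herm_def col axis_def if_distrib if_distribR cong: if_cong)
  finally show ?thesis
    by (metis complex_mod_cnj norm_minus_cancel)
qed

text \<open>The columns of \<open>g\<close> have norm 1 or -1 for the form, which bounds them by the last row; the last row is bounded by its
last entry because it is, up to phases, the last column of the inverse.\<close>
lemma SU_entry_bound:
  assumes g: "g \<in> carrier SU"
  shows "cmod (g $ i $ j) \<le> 1 + cmod (g $ None $ None)"
proof (cases j)
  case None
  then show ?thesis using SU_column_bound[OF g, of i] by simp
next
  case (Some k)
  have "herm (g *v axis j 1) (g *v axis j 1) = 1"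
    unfolding SU_herm[OF g]
    by (simp add: herm_def axis_def Some if_distrib if_distribR cong: if_cong)
  then have *: "(\<Sum>i\<in>UNIV. (cmod (g $ Some i $ j))\<^sup>2) = 1 + (cmod (g $ None $ j))\<^sup>2"
    unfolding herm_self mult_vec_axis by (simp add: complex_eq_iff)
  have row: "cmod (g $ None $ j) \<le> cmod (g $ None $ None)"
    using SU_column_bound[OF SU_inv_closed[OF g], of j] SU_row_inv[OF g] by metis
  have "(cmod (g $ i $ j))\<^sup>2 \<le> 1 + (cmod (g $ None $ j))\<^sup>2"
  proof (cases i)
    case (Some l)
    have "(cmod (g $ Some l $ j))\<^sup>2 \<le> (\<Sum>i\<in>UNIV. (cmod (g $ Some i $ j))\<^sup>2)"
      by (rule member_le_sum) auto
    with * Some show ?thesis by simp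
  qed simp
  also have "\<dots> \<le> 1 + (cmod (g $ None $ None))\<^sup>2"
    using row by (simp add: power_mono)
  also have "\<dots> \<le> (1 + cmod (g $ None $ None))\<^sup>2"
    by (simp add: power2_sum)
  finally show ?thesis
    by (rule power2_le_imp_le) simp
qed

text \<open>Evaluate \<open>\<langle>g z, g 0\<rangle>\<close>: invariance makes it a product of two factors of automorphy, while it is at least \<open>1 - r\<close> in
modulus. The factor at \<open>z\<close> is bounded by the height, which leaves a bound for the one at 0.\<close>
lemma denominator_bound:
  assumes g: "g \<in> carrier SU" and z: "z \<in> ball 0 1" and r: "norm (act g z) \<le> r" "r < 1"
  shows "cmod (g $ None $ None) \<le> 1 / ((1 - r) * sqrt (height z))"
proof -
  have z': "z \<in> cball 0 1" and 0: "(0 :: complex^'a) \<in> cball 0 1" using z by auto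
  let ?w = "act g z" and ?v = "act g 0"
  have hz: "height z > 0" using z by (simp only: height_pos_iff)
  have "(cmod (autj g z))\<^sup>2 * height z \<le> 1"
    unfolding height_act[OF g z', symmetric] by (simp add: height_eq)
  then have "(cmod (autj g z) * sqrt (height z))\<^sup>2 \<le> 1\<^sup>2"
    using hz by (simp add: power_mult_distrib)
  then have j: "cmod (autj g z) * sqrt (height z) \<le> 1"
    by (rule power2_le_imp_le) simp
  have "herm (lift_pt ?w) (lift_pt ?v) = autj g z * cnj (autj g 0) * herm (lift_pt z) (lift_pt 0)"
    by (simp add: lift_act[OF g z'] lift_act[OF g 0] herm_scale_left herm_scale_right SU_herm[OF g])
  then have "herm (lift_pt ?w) (lift_pt ?v) = - (autj g z * cnj (autj g 0))"
    by (simp add: herm_lift)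
  then have 1: "cmod (herm (lift_pt ?w) (lift_pt ?v)) = cmod (autj g z) * cmod (autj g 0)"
    by (simp add: norm_mult)
  have "norm ?v \<le> 1"
    using act_in_cball[OF g 0] by simp
  then have "norm ?w * norm ?v \<le> r * 1"
    using r by (intro mult_mono) (auto intro: order_trans[OF norm_ge_zero])
  then have "1 - r \<le> 1 - cmod (\<Sum>i\<in>UNIV. ?w $ i * cnj (?v $ i))"
    using cauchy_schwarz_vec[of ?w ?v] by linarith
  also have "\<dots> \<le> cmod (herm (lift_pt ?w) (lift_pt ?v))"
    unfolding herm_lift using norm_triangle_ineq2[of 1 "\<Sum>i\<in>UNIV. ?w $ i * cnj (?v $ i)"]
    by (simp add: norm_minus_commute)
  finally have 2: "1 - r \<le> cmod (autj g z) * cmod (autj g 0)"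
    using 1 by simp
  have d: "cmod (autj g 0) = 1 / cmod (g $ None $ None)" "g $ None $ None \<noteq> 0"
    using autj_neq_0[OF g 0] by (simp_all add: autj_def lift_pt_0 mult_vec_axis norm_inverse inverse_eq_divide norm_divide)
  then have "(1 - r) * cmod (g $ None $ None) \<le> cmod (autj g z)"
    using 2 unfolding d(1) by (simp add: field_simps)
  then have "(1 - r) * cmod (g $ None $ None) * sqrt (height z) \<le> cmod (autj g z) * sqrt (height z)"
    using hz by (intro mult_right_mono) auto
  also note j
  finally show ?thesis
    using hz r by (simp add: field_simps)
qed

lemma norm_matrix_le: "norm (A :: complex^'a^'b) \<le> (\<Sum>i\<in>UNIV. \<Sum>j\<in>UNIV. cmod (A $ i $ j))"
proof -
  have "norm A \<le> (\<Sum>i\<in>UNIV. norm (A $ i))"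
    unfolding norm_vec_def[of A] by (rule L2_set_le_sum) simp
  also have "\<dots> \<le> (\<Sum>i\<in>UNIV. \<Sum>j\<in>UNIV. cmod (A $ i $ j))"
    by (intro sum_mono) (simp add: norm_vec_def[of "A $ _"] L2_set_le_sum)
  finally show ?thesis .
qed

lemma SU_subgroup_facts:
  assumes "subgroup \<Gamma> SU"
  shows subgroup_in_SU: "\<gamma> \<in> \<Gamma> \<Longrightarrow> \<gamma> \<in> carrier SU"
    and subgroup_one: "mat 1 \<in> \<Gamma>"
    and subgroup_mult: "\<gamma> \<in> \<Gamma> \<Longrightarrow> \<delta> \<in> \<Gamma> \<Longrightarrow> \<gamma> ** \<delta> \<in> \<Gamma>"
    and subgroup_inv: "\<gamma> \<in> \<Gamma> \<Longrightarrow> inv\<^bsub>SU\<^esub> \<gamma> \<in> \<Gamma>"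
  using assms subgroup.m_closed[OF assms] subgroup.one_closed[OF assms] subgroup.m_inv_closed[OF assms]
  by (auto dest: subgroup.subset)

text \<open>By the two preceding bounds these elements and their inverses have bounded entries. If two of them are close, then
the quotient of one by the other is close to 1, hence equal to 1 by discreteness. A bounded and uniformly discrete set of
matrices is finite.\<close>
lemma finite_near_orbit:
  assumes \<Gamma>: "subgroup \<Gamma> SU" and disc: "discrete \<Gamma>" and z: "z \<in> ball 0 1" and r: "r < 1"
  shows "finite {\<gamma>\<in>\<Gamma>. norm (act \<gamma> z) \<le> r}" (is "finite ?F")
proof -
  let ?N = "CARD('a option)"
  define C where "C = 1 + 1 / ((1 - r) * sqrt (height z))"
  have "0 < height z" using z by (simp only: height_pos_iff)
  then have C: "C \<ge> 1"
    using r by (simp add: C_def)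
  have g: "\<gamma> \<in> carrier SU" if "\<gamma> \<in> ?F" for \<gamma>
    using that subgroup_in_SU[OF \<Gamma>] by auto
  have entry: "cmod (\<gamma> $ i $ j) \<le> C" if "\<gamma> \<in> ?F" for \<gamma> i j
    using SU_entry_bound[OF g[OF that], of i j] denominator_bound[OF g[OF that] z _ r] that
    by (simp add: C_def)
  have entry_inv: "cmod ((inv\<^bsub>SU\<^esub> \<gamma>) $ i $ j) \<le> C" if "\<gamma> \<in> ?F" for \<gamma> i j
  proof -
    have "cmod ((inv\<^bsub>SU\<^esub> \<gamma>) $ i $ j) \<le> 1 + cmod ((inv\<^bsub>SU\<^esub> \<gamma>) $ None $ None)"
      by (intro SU_entry_bound SU_inv_closed g that)
    also have "cmod ((inv\<^bsub>SU\<^esub> \<gamma>) $ None $ None) = cmod (\<gamma> $ None $ None)"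
      by (rule SU_row_inv[OF g[OF that], symmetric])
    finally show ?thesis
      using denominator_bound[OF g[OF that] z _ r] that by (simp add: C_def)
  qed
  obtain d where d: "d > 0" "\<And>\<gamma>. \<gamma> \<in> \<Gamma> \<Longrightarrow> dist (mat 1) \<gamma> < d \<Longrightarrow> \<gamma> = mat 1"
    using isolated_inE_dist[OF discreteD[OF disc subgroup_one[OF \<Gamma>]]] by metis
  define K where "K = real ?N * (real ?N * (real ?N * C))"
  have K: "K > 0" using C by (simp add: K_def)
  have "uniform_discrete ?F"
  proof (rule uniformI1)
    show "d / K > 0" using d K by simp
    fix \<gamma> \<delta> assume \<gamma>: "\<gamma> \<in> ?F" and \<delta>: "\<delta> \<in> ?F" and dist: "dist \<gamma> \<delta> < d / K"
    let ?i = "inv\<^bsub>SU\<^esub> \<gamma>"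
    have "?i ** \<delta> - mat 1 = ?i ** (\<delta> - \<gamma>)"
      using SU_inv_mul(1)[OF g[OF \<gamma>]]
      by (simp add: matrix_matrix_mult_def vec_eq_iff right_diff_distrib sum_subtractf mat_def)
    then have "dist (mat 1) (?i ** \<delta>) = norm (?i ** (\<delta> - \<gamma>))"
      by (simp add: dist_norm norm_minus_commute[of "mat 1"])
    also have "\<dots> \<le> (\<Sum>i\<in>UNIV. \<Sum>j\<in>UNIV. cmod ((?i ** (\<delta> - \<gamma>)) $ i $ j))"
      by (rule norm_matrix_le)
    also have "\<dots> \<le> (\<Sum>i\<in>(UNIV :: 'a option set). \<Sum>j\<in>(UNIV :: 'a option set). real ?N * (C * dist \<gamma> \<delta>))"
    proof (intro sum_mono)
      fix i j
      have "cmod ((?i ** (\<delta> - \<gamma>)) $ i $ j) \<le> (\<Sum>k\<in>UNIV. cmod (?i $ i $ k) * cmod ((\<delta> - \<gamma>) $ k $ j))"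
        unfolding matrix_matrix_mult_def by (simp add: norm_mult[symmetric] norm_sum)
      also have "\<dots> \<le> (\<Sum>k\<in>(UNIV :: 'a option set). C * dist \<gamma> \<delta>)"
      proof (intro sum_mono mult_mono entry_inv[OF \<gamma>])
        fix k
        show "cmod ((\<delta> - \<gamma>) $ k $ j) \<le> dist \<gamma> \<delta>"
          using Finite_Cartesian_Product.norm_nth_le[of "(\<delta> - \<gamma>) $ k" j] Finite_Cartesian_Product.norm_nth_le[of "\<delta> - \<gamma>" k]
          by (simp add: dist_norm norm_minus_commute)
      qed (use C in auto)
      finally show "cmod ((?i ** (\<delta> - \<gamma>)) $ i $ j) \<le> real ?N * (C * dist \<gamma> \<delta>)"
        by simp
    qed
    also have "\<dots> = K * dist \<gamma> \<delta>"
      by (simp add: K_def mult_ac)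
    also have "\<dots> < d"
      using dist K by (simp add: field_simps)
    finally have "?i ** \<delta> = mat 1"
      using \<gamma> \<delta> by (intro d subgroup_mult[OF \<Gamma>] subgroup_inv[OF \<Gamma>]) auto
    then have "\<gamma> ** (?i ** \<delta>) = \<gamma>"
      by simp
    then show "\<gamma> = \<delta>"
      by (simp add: matrix_mul_assoc SU_inv_mul[OF g[OF \<gamma>]])
  qed
  moreover have "bounded ?F"
  proof (rule boundedI)
    fix \<gamma> assume *: "\<gamma> \<in> ?F"
    have "norm \<gamma> \<le> (\<Sum>i\<in>UNIV. \<Sum>j\<in>UNIV. cmod (\<gamma> $ i $ j))"
      by (rule norm_matrix_le)
    also have "\<dots> \<le> (\<Sum>i\<in>(UNIV :: 'a option set). \<Sum>j\<in>(UNIV :: 'a option set). C)"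
      by (intro sum_mono entry[OF *])
    finally show "norm \<gamma> \<le> (\<Sum>i\<in>(UNIV :: 'a option set). \<Sum>j\<in>(UNIV :: 'a option set). C)" .
  qed
  ultimately show ?thesis
    using uniform_discrete_finite_iff by blast
qed

lemma countable_discrete_subgroup:
  assumes \<Gamma>: "subgroup \<Gamma> SU" and disc: "discrete \<Gamma>"
  shows "countable \<Gamma>"
proof -
  have "\<exists>n. norm (act \<gamma> 0) \<le> 1 - 1 / real (Suc n)" if "\<gamma> \<in> \<Gamma>" for \<gamma>
  proof -
    have "norm (act \<gamma> 0) < 1"
      using act_in_ball[OF subgroup_in_SU[OF \<Gamma> that], of 0] by simp
    then obtain n where "inverse (real (Suc n)) < 1 - norm (act \<gamma> 0)"
      using reals_Archimedean[of "1 - norm (act \<gamma> 0)"] by auto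
    then show ?thesis
      by (intro exI[of _ n]) (simp add: inverse_eq_divide)
  qed
  then have "\<Gamma> \<subseteq> (\<Union>n. {\<gamma>\<in>\<Gamma>. norm (act \<gamma> 0) \<le> 1 - 1 / real (Suc n)})"
    by blast
  moreover have "countable (\<Union>n. {\<gamma>\<in>\<Gamma>. norm (act \<gamma> 0) \<le> 1 - 1 / real (Suc n)})"
    by (intro countable_UN countableI_type countable_finite finite_near_orbit[OF \<Gamma> disc]) auto
  ultimately show ?thesis
    by (rule countable_subset)
qed

lemma finite_stabilizer:
  assumes "subgroup \<Gamma> SU" "discrete \<Gamma>" "z \<in> ball 0 1"
  shows "finite {\<gamma>\<in>\<Gamma>. act \<gamma> z = z}"
  by (rule finite_subset[OF _ finite_near_orbit[OF assms, of "norm z"]]) (use assms in auto)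

text \<open>Among the finitely many points in which \<open>E\<close> meets an orbit, keep those with the least value of \<open>\<phi>\<close>. Only countably
many group elements have to be compared, so the set remains Borel. The induction starts from the points of least
norm in their orbits, and ends with a set on which all \<open>\<phi> \<in> \<Phi>\<close> are constant along orbits.\<close>
lemma refine_cross_section:
  fixes \<Phi> :: "(complex^'n::finite \<Rightarrow> real) set"
  assumes \<Gamma>: "subgroup \<Gamma> SU" and disc: "discrete \<Gamma>"
    and "finite \<Phi>" and "\<forall>\<phi>\<in>\<Phi>. \<phi> \<in> borel_measurable borel"
  shows "\<exists>E. E \<in> sets borel \<and> E \<subseteq> ball 0 1 \<and>
    (\<forall>z\<in>ball 0 1. finite {w\<in>E. \<exists>\<gamma>\<in>\<Gamma>. w = act \<gamma> z} \<and> {w\<in>E. \<exists>\<gamma>\<in>\<Gamma>. w = act \<gamma> z} \<noteq> {}) \<and>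
    (\<forall>\<phi>\<in>\<Phi>. \<forall>z\<in>E. \<forall>\<gamma>\<in>\<Gamma>. act \<gamma> z \<in> E \<longrightarrow> \<phi> (act \<gamma> z) = \<phi> z)"
  using assms(3,4)
proof (induction \<Phi>)
  case empty
  have cnt: "countable \<Gamma>" by (rule countable_discrete_subgroup[OF \<Gamma> disc])
  have SU: "\<gamma> \<in> carrier SU" if "\<gamma> \<in> \<Gamma>" for \<gamma> using subgroup_in_SU[OF \<Gamma> that] .
  define E :: "(complex^'n) set" where "E = {z\<in>ball 0 1. \<forall>\<gamma>\<in>\<Gamma>. norm z \<le> norm (act \<gamma> z)}"
  have "E = ball 0 1 \<inter> (\<Inter>\<gamma>\<in>\<Gamma>. {z. norm z \<le> norm (act \<gamma> z)})"
    by (auto simp: E_def)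
  also have "\<dots> \<in> sets borel"
    using cnt subgroup_one[OF \<Gamma>] by (intro sets.Int sets.countable_INT'') (auto, measurable)
  finally have "E \<in> sets borel" .
  moreover have "finite {w\<in>E. \<exists>\<gamma>\<in>\<Gamma>. w = act \<gamma> z} \<and> {w\<in>E. \<exists>\<gamma>\<in>\<Gamma>. w = act \<gamma> z} \<noteq> {}"
    if z: "z \<in> ball 0 1" for z
  proof
    let ?F = "{\<gamma>\<in>\<Gamma>. norm (act \<gamma> z) \<le> norm z}"
    have fin: "finite ?F"
      by (rule finite_near_orbit[OF \<Gamma> disc z]) (use z in simp)
    have z': "z \<in> cball 0 1" using z by auto
    have "w \<in> (\<lambda>\<gamma>. act \<gamma> z) ` ?F" if w: "w \<in> E" "w = act \<gamma> z" "\<gamma> \<in> \<Gamma>" for w \<gamma>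
    proof -
      have "norm w \<le> norm (act (inv\<^bsub>SU\<^esub> \<gamma>) w)"
        using w(1) subgroup_inv[OF \<Gamma> w(3)] by (simp add: E_def)
      also have "act (inv\<^bsub>SU\<^esub> \<gamma>) w = z"
        using act_inv_act(1)[OF SU[OF w(3)] z'] w(2) by simp
      finally show ?thesis using w by blast
    qed
    then show "finite {w\<in>E. \<exists>\<gamma>\<in>\<Gamma>. w = act \<gamma> z}"
      by (intro finite_subset[OF _ finite_imageI[OF fin, of "\<lambda>\<gamma>. act \<gamma> z"]]) blast
    have ne: "?F \<noteq> {}" using subgroup_one[OF \<Gamma>] by force
    obtain \<gamma> where \<gamma>: "\<gamma> \<in> ?F" "\<And>\<delta>. \<delta> \<in> ?F \<Longrightarrow> norm (act \<gamma> z) \<le> norm (act \<delta> z)"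
      using ex_is_arg_min_if_finite[OF fin ne, of "\<lambda>\<gamma>. norm (act \<gamma> z)"]
      by (auto simp: is_arg_min_linorder)
    have "norm (act \<gamma> z) \<le> norm (act \<delta> (act \<gamma> z))" if "\<delta> \<in> \<Gamma>" for \<delta>
    proof (cases "norm (act (\<delta> ** \<gamma>) z) \<le> norm z")
      case True
      then show ?thesis
        using \<gamma>(2)[of "\<delta> ** \<gamma>"] subgroup_mult[OF \<Gamma> that] \<gamma>(1) act_mult[OF SU z', of \<gamma> \<delta>] by auto
    next
      case False
      then show ?thesis
        using \<gamma>(1) act_mult[OF SU z', of \<gamma> \<delta>] by auto
    qed
    then have "act \<gamma> z \<in> E"
      using \<gamma>(1) act_in_ball[OF SU z, of \<gamma>] by (auto simp: E_def)
    then show "{w\<in>E. \<exists>\<gamma>\<in>\<Gamma>. w = act \<gamma> z} \<noteq> {}"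
      using \<gamma>(1) by blast
  qed
  ultimately show ?case
    by (intro exI[of _ E]) (auto simp: E_def)
next
  case (insert \<phi> \<Phi>)
  have cnt: "countable \<Gamma>" by (rule countable_discrete_subgroup[OF \<Gamma> disc])
  have SU: "\<gamma> \<in> carrier SU" if "\<gamma> \<in> \<Gamma>" for \<gamma> using subgroup_in_SU[OF \<Gamma> that] .
  have [measurable]: "\<phi> \<in> borel_measurable borel" using insert.prems by simp
  obtain E where [measurable]: "E \<in> sets borel" and E: "E \<subseteq> ball 0 1"
    and fin: "\<And>z. z \<in> ball 0 1 \<Longrightarrow> finite {w\<in>E. \<exists>\<gamma>\<in>\<Gamma>. w = act \<gamma> z}"
    and ne: "\<And>z. z \<in> ball 0 1 \<Longrightarrow> {w\<in>E. \<exists>\<gamma>\<in>\<Gamma>. w = act \<gamma> z} \<noteq> {}"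
    and eq: "\<And>\<psi> z \<gamma>. \<psi> \<in> \<Phi> \<Longrightarrow> z \<in> E \<Longrightarrow> \<gamma> \<in> \<Gamma> \<Longrightarrow> act \<gamma> z \<in> E \<Longrightarrow> \<psi> (act \<gamma> z) = \<psi> z"
  proof -
    have "\<forall>\<psi>\<in>\<Phi>. \<psi> \<in> borel_measurable borel"
      using insert.prems by simp
    from insert.IH[OF this] show ?thesis
      by (elim exE conjE, intro that) blast+
  qed
  define E' where "E' = {z\<in>E. \<forall>\<gamma>\<in>\<Gamma>. act \<gamma> z \<in> E \<longrightarrow> \<phi> z \<le> \<phi> (act \<gamma> z)}"
  have E'E: "E' \<subseteq> E" by (auto simp: E'_def)
  have "E' = E \<inter> (\<Inter>\<gamma>\<in>\<Gamma>. {z. act \<gamma> z \<in> E \<longrightarrow> \<phi> z \<le> \<phi> (act \<gamma> z)})"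
    by (auto simp: E'_def)
  also have "\<dots> \<in> sets borel"
    using cnt subgroup_one[OF \<Gamma>] by (intro sets.Int sets.countable_INT'') (auto, measurable)
  finally have "E' \<in> sets borel" .
  moreover have "E' \<subseteq> ball 0 1" using E E'E by blast
  moreover have "finite {w\<in>E'. \<exists>\<gamma>\<in>\<Gamma>. w = act \<gamma> z} \<and> {w\<in>E'. \<exists>\<gamma>\<in>\<Gamma>. w = act \<gamma> z} \<noteq> {}"
    if z: "z \<in> ball 0 1" for z
  proof
    have z': "z \<in> cball 0 1" using z by auto
    let ?O = "{w\<in>E. \<exists>\<gamma>\<in>\<Gamma>. w = act \<gamma> z}"
    show "finite {w\<in>E'. \<exists>\<gamma>\<in>\<Gamma>. w = act \<gamma> z}"
      by (rule finite_subset[OF _ fin[OF z]]) (use E'E in blast)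
    obtain w where w: "w \<in> ?O" "\<And>v. v \<in> ?O \<Longrightarrow> \<phi> w \<le> \<phi> v"
      using ex_is_arg_min_if_finite[OF fin[OF z] ne[OF z], of \<phi>]
      by (auto simp: is_arg_min_linorder)
    then obtain \<gamma> where \<gamma>: "\<gamma> \<in> \<Gamma>" "w = act \<gamma> z" by blast
    have "\<phi> w \<le> \<phi> (act \<delta> w)" if "\<delta> \<in> \<Gamma>" "act \<delta> w \<in> E" for \<delta>
    proof (rule w(2))
      have "act \<delta> w = act (\<delta> ** \<gamma>) z"
        using act_mult[OF SU[OF \<gamma>(1)] z', of \<delta>] \<gamma>(2) by simp
      with that(2) subgroup_mult[OF \<Gamma> that(1) \<gamma>(1)] show "act \<delta> w \<in> ?O" by blast
    qed
    then have "w \<in> E'" using w(1) by (auto simp: E'_def)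
    with \<gamma> show "{w\<in>E'. \<exists>\<gamma>\<in>\<Gamma>. w = act \<gamma> z} \<noteq> {}" by blast
  qed
  moreover have "\<phi> (act \<gamma> z) = \<phi> z" if "z \<in> E'" "\<gamma> \<in> \<Gamma>" "act \<gamma> z \<in> E'" for z \<gamma>
  proof (rule order.antisym)
    show "\<phi> z \<le> \<phi> (act \<gamma> z)" using that by (auto simp: E'_def)
    have z: "z \<in> cball 0 1" using that(1) E'E E by auto
    have bk: "act (inv\<^bsub>SU\<^esub> \<gamma>) (act \<gamma> z) = z" by (rule act_inv_act(1)[OF SU[OF that(2)] z])
    have "z \<in> E" using that(1) E'E by blast
    then show "\<phi> (act \<gamma> z) \<le> \<phi> z"
      using that(3) subgroup_inv[OF \<Gamma> that(2)] bk unfolding E'_def by force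
  qed
  ultimately show ?case
    using E'E eq by (intro exI[of _ E']) (auto simp: subset_iff)
qed

text \<open>Refining by all real coordinates leaves exactly one point of each orbit.\<close>
theorem fundamental_domain_exists:
  fixes \<Gamma> :: "(complex^('n::finite option)^('n option)) set"
  assumes \<Gamma>: "subgroup \<Gamma> SU" and disc: "discrete \<Gamma>"
  shows "\<exists>D. fundamental_domain \<Gamma> D"
proof -
  have SU: "\<gamma> \<in> carrier SU" if "\<gamma> \<in> \<Gamma>" for \<gamma> using subgroup_in_SU[OF \<Gamma> that] .
  obtain E :: "(complex^'n) set" where "E \<in> sets borel" and E: "E \<subseteq> ball 0 1"
    and ne: "\<And>z. z \<in> ball 0 1 \<Longrightarrow> {w\<in>E. \<exists>\<gamma>\<in>\<Gamma>. w = act \<gamma> z} \<noteq> {}"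
    and eq: "\<And>b z \<gamma>. b \<in> Basis \<Longrightarrow> z \<in> E \<Longrightarrow> \<gamma> \<in> \<Gamma> \<Longrightarrow> act \<gamma> z \<in> E \<Longrightarrow> act \<gamma> z \<bullet> b = z \<bullet> b"
  proof -
    have "\<forall>\<phi>\<in>(\<lambda>b z. z \<bullet> b) ` (Basis :: (complex^'n) set). \<phi> \<in> borel_measurable borel"
      by auto
    from refine_cross_section[OF \<Gamma> disc finite_imageI[OF finite_Basis] this]
    show ?thesis
      by (elim exE conjE, intro that) auto
  qed
  have "\<exists>!w. w \<in> E \<and> (\<exists>\<gamma>\<in>\<Gamma>. w = act \<gamma> z)" if z: "z \<in> ball 0 1" for z
  proof -
    have z': "z \<in> cball 0 1" using z by auto
    have "v = w" if v: "v \<in> E" "v = act \<gamma> z" "\<gamma> \<in> \<Gamma>" and w: "w \<in> E" "w = act \<delta> z" "\<delta> \<in> \<Gamma>" for v w \<gamma> \<delta>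
    proof -
      let ?\<epsilon> = "\<gamma> ** inv\<^bsub>SU\<^esub> \<delta>"
      have "act ?\<epsilon> w = act \<gamma> (act (inv\<^bsub>SU\<^esub> \<delta>) w)"
        using w(1) E by (intro act_mult SU_inv_closed SU w(3)) auto
      also have "act (inv\<^bsub>SU\<^esub> \<delta>) w = z"
        unfolding w(2) by (rule act_inv_act(1)[OF SU[OF w(3)] z'])
      finally have v': "act ?\<epsilon> w = v" using v(2) by simp
      have "?\<epsilon> \<in> \<Gamma>" by (intro subgroup_mult[OF \<Gamma>] subgroup_inv[OF \<Gamma>] v w)
      then have "v \<bullet> b = w \<bullet> b" if "b \<in> Basis" for b
        using eq[OF that w(1), of ?\<epsilon>] v' v(1) by simp
      then show ?thesis by (rule euclidean_eqI)
    qed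
    then have uniq: "v = w" if "v \<in> E \<and> (\<exists>\<gamma>\<in>\<Gamma>. v = act \<gamma> z)" "w \<in> E \<and> (\<exists>\<gamma>\<in>\<Gamma>. w = act \<gamma> z)" for v w
      using that by blast
    obtain w where w: "w \<in> E \<and> (\<exists>\<gamma>\<in>\<Gamma>. w = act \<gamma> z)"
      using ne[OF z] by blast
    show ?thesis
    proof (rule ex1I)
      show "w \<in> E \<and> (\<exists>\<gamma>\<in>\<Gamma>. w = act \<gamma> z)" by (rule w)
      show "v = w" if "v \<in> E \<and> (\<exists>\<gamma>\<in>\<Gamma>. v = act \<gamma> z)" for v
        by (rule uniq[OF that w])
    qed
  qed
  with \<open>E \<in> sets borel\<close> E have "fundamental_domain \<Gamma> E"
    unfolding fundamental_domain_def by simp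
  then show ?thesis ..
qed

lemma sigma_finite_inv_vol: "sigma_finite_measure (inv_vol :: (complex^'n::finite) measure)"
proof -
  show ?thesis
    unfolding inv_vol_def
    by (subst sigma_finite_measure.sigma_finite_iff_density_finite[OF sigma_finite_lborel]) auto
qed

lemma stabilizer_card_act:
  assumes \<Gamma>: "subgroup \<Gamma> SU" and \<delta>: "\<delta> \<in> \<Gamma>" and z: "z \<in> ball 0 1"
  shows "card {\<gamma>\<in>\<Gamma>. act \<gamma> (act \<delta> z) = act \<delta> z} = card {\<gamma>\<in>\<Gamma>. act \<gamma> z = z}"
proof -
  have SU: "\<gamma> \<in> carrier SU" if "\<gamma> \<in> \<Gamma>" for \<gamma> using subgroup_in_SU[OF \<Gamma> that] .
  have z': "z \<in> cball 0 1" using z by auto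
  let ?i = "inv\<^bsub>SU\<^esub> \<delta>"
  note inv = SU_inv_mul[OF SU[OF \<delta>]]
  have i\<delta>: "?i ** (\<delta> ** x) = x" "\<delta> ** (?i ** x) = x" "(x ** \<delta>) ** ?i = x" "(x ** ?i) ** \<delta> = x" for x
    by (simp_all add: matrix_mul_assoc inv) (simp_all add: inv flip: matrix_mul_assoc)
  have "bij_betw (\<lambda>\<gamma>. \<delta> ** \<gamma> ** ?i) {\<gamma>\<in>\<Gamma>. act \<gamma> z = z} {\<gamma>\<in>\<Gamma>. act \<gamma> (act \<delta> z) = act \<delta> z}"
  proof (rule bij_betwI[where g = "\<lambda>\<gamma>. ?i ** \<gamma> ** \<delta>"])
    show "(\<lambda>\<gamma>. \<delta> ** \<gamma> ** ?i) \<in> {\<gamma>\<in>\<Gamma>. act \<gamma> z = z} \<rightarrow> {\<gamma>\<in>\<Gamma>. act \<gamma> (act \<delta> z) = act \<delta> z}"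
    proof safe
      fix \<gamma> assume \<gamma>: "\<gamma> \<in> \<Gamma>" "act \<gamma> z = z"
      then show "\<delta> ** \<gamma> ** ?i \<in> \<Gamma>"
        by (intro subgroup_mult[OF \<Gamma>] subgroup_inv[OF \<Gamma>] \<delta>)
      have "act (\<delta> ** \<gamma> ** ?i) (act \<delta> z) = act (\<delta> ** \<gamma> ** ?i ** \<delta>) z"
        by (rule act_mult[symmetric, OF SU[OF \<delta>] z'])
      also have "\<delta> ** \<gamma> ** ?i ** \<delta> = \<delta> ** \<gamma>" by (rule i\<delta>)
      finally show "act (\<delta> ** \<gamma> ** ?i) (act \<delta> z) = act \<delta> z"
        using act_mult[OF SU[OF \<gamma>(1)] z', of \<delta>] \<gamma>(2) by simp
    qed
    show "(\<lambda>\<gamma>. ?i ** \<gamma> ** \<delta>) \<in> {\<gamma>\<in>\<Gamma>. act \<gamma> (act \<delta> z) = act \<delta> z} \<rightarrow> {\<gamma>\<in>\<Gamma>. act \<gamma> z = z}"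
    proof safe
      fix \<gamma> assume \<gamma>: "\<gamma> \<in> \<Gamma>" "act \<gamma> (act \<delta> z) = act \<delta> z"
      then show "?i ** \<gamma> ** \<delta> \<in> \<Gamma>"
        by (intro subgroup_mult[OF \<Gamma>] subgroup_inv[OF \<Gamma>] \<delta>)
      have "act (?i ** \<gamma> ** \<delta>) z = act (?i ** \<gamma>) (act \<delta> z)"
        by (rule act_mult[OF SU[OF \<delta>] z'])
      also have "\<dots> = act ?i (act \<gamma> (act \<delta> z))"
        by (rule act_mult[OF SU[OF \<gamma>(1)] act_in_cball[OF SU[OF \<delta>] z']])
      finally show "act (?i ** \<gamma> ** \<delta>) z = z"
        using \<gamma>(2) act_inv_act(1)[OF SU[OF \<delta>] z'] by simp
    qed
  qed (simp_all only: matrix_mul_assoc inv i\<delta>(3,4) matrix_mul_lid)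
  then show ?thesis
    by (rule bij_betw_same_card[symmetric])
qed

lemma ex1_unique: "\<exists>!x. P x \<Longrightarrow> P x \<Longrightarrow> P y \<Longrightarrow> x = y"
  by blast

text \<open>If \<open>\<delta> z\<close> is the representative of the orbit, then the elements that move \<open>z\<close> into \<open>D\<close> form the coset \<open>\<delta> Stab(z)\<close>.\<close>
lemma transporter_card:
  assumes \<Gamma>: "subgroup \<Gamma> SU" and z: "z \<in> ball 0 1" and D: "fundamental_domain \<Gamma> D"
  shows "card {\<gamma>\<in>\<Gamma>. act \<gamma> z \<in> D} = card {\<gamma>\<in>\<Gamma>. act \<gamma> z = z}"
proof -
  have SU: "\<gamma> \<in> carrier SU" if "\<gamma> \<in> \<Gamma>" for \<gamma> using subgroup_in_SU[OF \<Gamma> that] .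
  have z': "z \<in> cball 0 1" using z by auto
  have ex1: "\<exists>!w. w \<in> D \<and> (\<exists>\<gamma>\<in>\<Gamma>. w = act \<gamma> z)"
    using D[unfolded fundamental_domain_def, THEN conjunct2, THEN conjunct2, THEN bspec, OF z] .
  from ex1_implies_ex[OF this] obtain \<delta> where \<delta>: "\<delta> \<in> \<Gamma>" "act \<delta> z \<in> D" by blast
  let ?i = "inv\<^bsub>SU\<^esub> \<delta>"
  note inv = SU_inv_mul[OF SU[OF \<delta>(1)]]
  have i\<delta>: "?i ** (\<delta> ** x) = x" "\<delta> ** (?i ** x) = x" for x
    by (simp_all add: matrix_mul_assoc inv)
  have "bij_betw (\<lambda>\<gamma>. \<delta> ** \<gamma>) {\<gamma>\<in>\<Gamma>. act \<gamma> z = z} {\<gamma>\<in>\<Gamma>. act \<gamma> z \<in> D}"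
  proof (rule bij_betwI[where g = "\<lambda>\<gamma>. ?i ** \<gamma>"])
    show "(\<lambda>\<gamma>. \<delta> ** \<gamma>) \<in> {\<gamma>\<in>\<Gamma>. act \<gamma> z = z} \<rightarrow> {\<gamma>\<in>\<Gamma>. act \<gamma> z \<in> D}"
    proof safe
      fix \<gamma> assume \<gamma>: "\<gamma> \<in> \<Gamma>" "act \<gamma> z = z"
      show "\<delta> ** \<gamma> \<in> \<Gamma>"
        by (intro subgroup_mult[OF \<Gamma>] \<gamma> \<delta>)
      show "act (\<delta> ** \<gamma>) z \<in> D"
        using act_mult[OF SU[OF \<gamma>(1)] z', of \<delta>] \<gamma>(2) \<delta>(2) by simp
    qed
    show "(\<lambda>\<gamma>. ?i ** \<gamma>) \<in> {\<gamma>\<in>\<Gamma>. act \<gamma> z \<in> D} \<rightarrow> {\<gamma>\<in>\<Gamma>. act \<gamma> z = z}"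
    proof safe
      fix \<gamma> assume \<gamma>: "\<gamma> \<in> \<Gamma>" "act \<gamma> z \<in> D"
      then show "?i ** \<gamma> \<in> \<Gamma>"
        by (intro subgroup_mult[OF \<Gamma>] subgroup_inv[OF \<Gamma>] \<delta>)
      have "act \<gamma> z = act \<delta> z"
        by (rule ex1_unique[OF ex1]) (use \<gamma> \<delta> in blast)+
      then show "act (?i ** \<gamma>) z = z"
        using act_mult[OF SU[OF \<gamma>(1)] z', of ?i] act_inv_act(1)[OF SU[OF \<delta>(1)] z'] by simp
    qed
  qed (simp_all only: i\<delta>)
  then show ?thesis
    by (rule bij_betw_same_card[symmetric])
qed

section \<open>Unfolding\<close>

lemma summable_on_iff_integrable_count_space:
  fixes f :: "'a \<Rightarrow> complex"
  shows "f summable_on A \<longleftrightarrow> integrable (count_space A) f"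
  using abs_summable_equivalent[of f A] summable_on_iff_abs_summable_on_complex[of f A]
  by (simp add: Infinite_Set_Sum.abs_summable_on_def)

lemma infsum_eq_integral_count_space:
  fixes f :: "'a \<Rightarrow> complex"
  shows "infsum f A = integral\<^sup>L (count_space A) f"
proof (cases "f summable_on A")
  case True
  then have "Infinite_Set_Sum.abs_summable_on f A"
    by (simp add: summable_on_iff_integrable_count_space Infinite_Set_Sum.abs_summable_on_def)
  from infsetsum_infsum[OF this] show ?thesis
    by (simp add: infsetsum_def)
next
  case False
  then show ?thesis
    by (simp add: infsum_not_exists not_integrable_integral_eq summable_on_iff_integrable_count_space)
qed

text \<open>The density that \<open>quotient_integral\<close> attaches to a fundamental domain.\<close>
definition domain_weight :: "(complex^('n::finite option)^('n option)) set \<Rightarrow> (complex^'n) set \<Rightarrow> complex^'n \<Rightarrow> real" where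
  "domain_weight \<Gamma> D z = indicator D z / real (card {\<gamma>\<in>\<Gamma>. act \<gamma> z = z})"

text \<open>The order of the stabilizer is a sum of indicator functions over the countable group.\<close>
lemma borel_measurable_domain_weight:
  assumes cnt: "countable \<Gamma>" and [measurable]: "D \<in> sets borel"
  shows "domain_weight \<Gamma> D \<in> borel_measurable borel"
proof -
  have "real (card {\<gamma>\<in>\<Gamma>. act \<gamma> z = z}) = enn2real (\<integral>\<^sup>+\<gamma>. indicator {w. act \<gamma> w = w} z \<partial>count_space \<Gamma>)" for z
  proof -
    have "(\<integral>\<^sup>+\<gamma>. indicator {w. act \<gamma> w = w} z \<partial>count_space \<Gamma>) = (\<integral>\<^sup>+\<gamma>. indicator {\<gamma>\<in>\<Gamma>. act \<gamma> z = z} \<gamma> \<partial>count_space \<Gamma>)"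
      by (intro nn_integral_cong) (auto simp: indicator_def)
    also have "\<dots> = emeasure (count_space \<Gamma>) {\<gamma>\<in>\<Gamma>. act \<gamma> z = z}"
      by (rule nn_integral_indicator) simp
    finally show ?thesis
      by (cases "finite {\<gamma>\<in>\<Gamma>. act \<gamma> z = z}")
         (auto simp: emeasure_count_space_finite emeasure_count_space_infinite)
  qed
  moreover have "(\<lambda>z. \<integral>\<^sup>+\<gamma>. indicator {w. act \<gamma> w = w} z \<partial>count_space \<Gamma>) \<in> borel_measurable borel"
  proof -
    interpret sigma_finite_measure "count_space \<Gamma>"
      by (rule sigma_finite_measure_count_space_countable[OF cnt])
    have "(\<lambda>(z, \<gamma>). indicator {w. act \<gamma> w = w} z :: ennreal) \<in> borel_measurable (borel \<Otimes>\<^sub>M count_space \<Gamma>)"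
      using measurable_pair_swap[OF measurable_pair_measure_countable1[OF cnt,
          where f = "\<lambda>(\<gamma>, z). indicator {w. act \<gamma> w = w} z :: ennreal" and N = borel and K = borel]]
      by (simp add: case_prod_unfold)
    then show ?thesis by (rule borel_measurable_nn_integral)
  qed
  ultimately show ?thesis
    unfolding domain_weight_def[abs_def] by simp
qed

lemma stabilizer_card_pos:
  assumes "subgroup \<Gamma> SU" "discrete \<Gamma>" "z \<in> ball 0 1"
  shows "0 < card {\<gamma>\<in>\<Gamma>. act \<gamma> z = z}"
proof -
  have "mat 1 \<in> {\<gamma>\<in>\<Gamma>. act \<gamma> z = z}"
    using subgroup_one[OF assms(1)] by simp
  then show ?thesis
    unfolding card_gt_0_iff using finite_stabilizer[OF assms] by blast
qed

text \<open>As many elements move \<open>u\<close> into \<open>D\<close> as there are elements in the stabilizer, and the weight is the inverse of that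
number.\<close>
lemma domain_weight_sum:
  assumes \<Gamma>: "subgroup \<Gamma> SU" and disc: "discrete \<Gamma>" and D: "fundamental_domain \<Gamma> D" and u: "u \<in> ball 0 1"
  shows "(\<integral>\<^sup>+\<gamma>. ennreal (domain_weight \<Gamma> D (act \<gamma> u)) \<partial>count_space \<Gamma>) = 1"
proof -
  define N where "N = card {\<gamma>\<in>\<Gamma>. act \<gamma> u = u}"
  have N: "N > 0"
    unfolding N_def by (rule stabilizer_card_pos[OF \<Gamma> disc u])
  have card: "card {\<gamma>\<in>\<Gamma>. act \<gamma> u \<in> D} = N"
    using transporter_card[OF \<Gamma> u D] by (simp add: N_def)
  then have fin: "finite {\<gamma>\<in>\<Gamma>. act \<gamma> u \<in> D}"
    using N by (simp only: card_gt_0_iff[THEN iffD1, THEN conjunct2] flip: card)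
  have "(\<integral>\<^sup>+\<gamma>. ennreal (domain_weight \<Gamma> D (act \<gamma> u)) \<partial>count_space \<Gamma>)
      = (\<integral>\<^sup>+\<gamma>. ennreal (1 / real N) * indicator {\<gamma>\<in>\<Gamma>. act \<gamma> u \<in> D} \<gamma> \<partial>count_space \<Gamma>)"
    by (intro nn_integral_cong) (auto simp: domain_weight_def stabilizer_card_act[OF \<Gamma> _ u] N_def indicator_def)
  also have "\<dots> = ennreal (1 / real N) * emeasure (count_space \<Gamma>) {\<gamma>\<in>\<Gamma>. act \<gamma> u \<in> D}"
    by (rule nn_integral_cmult_indicator) simp
  also have "\<dots> = 1"
    using N fin by (simp add: emeasure_count_space_finite card ennreal_of_nat_eq_real_of_nat ennreal_mult[symmetric])
  finally show ?thesis .
qed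

text \<open>Unfolding as an identity of measures: spreading the weighted fundamental domain over the ball by all \<open>\<gamma> \<in> \<Gamma>\<close> covers
the invariant volume exactly once. Integrability, almost everywhere convergence and the value of the integral for
complex functions then come out of a single change of variables.\<close>
lemma unfolding_measure:
  assumes \<Gamma>: "subgroup \<Gamma> SU" and disc: "discrete \<Gamma>" and D: "fundamental_domain \<Gamma> D"
  shows "distr (density (count_space \<Gamma> \<Otimes>\<^sub>M inv_vol) (\<lambda>(\<gamma>, z). ennreal (domain_weight \<Gamma> D z))) borel
           (\<lambda>(\<gamma>, z). act \<gamma> z) = inv_vol" (is "distr (density ?P ?W) borel ?T = _")
proof (rule measure_eqI)
  have cnt: "countable \<Gamma>" by (rule countable_discrete_subgroup[OF \<Gamma> disc])
  have SU: "\<gamma> \<in> carrier SU" if "\<gamma> \<in> \<Gamma>" for \<gamma> using subgroup_in_SU[OF \<Gamma> that] .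
  have [measurable]: "D \<in> sets borel" using D by (simp add: fundamental_domain_def)
  note [measurable] = borel_measurable_domain_weight[OF cnt]
  interpret G: sigma_finite_measure "count_space \<Gamma>"
    by (rule sigma_finite_measure_count_space_countable[OF cnt])
  interpret V: sigma_finite_measure inv_vol
    by (rule sigma_finite_inv_vol)
  interpret pair_sigma_finite "count_space \<Gamma>" inv_vol ..
  have T [measurable]: "?T \<in> borel_measurable ?P"
    by (rule measurable_pair_measure_countable1[OF cnt]) simp
  have W [measurable]: "?W \<in> borel_measurable ?P"
    by measurable
  fix A assume "A \<in> sets (distr (density ?P ?W) borel ?T)"
  then have [measurable]: "A \<in> sets borel" by simp
  have "emeasure (distr (density ?P ?W) borel ?T) A = (\<integral>\<^sup>+p. indicator A p \<partial>distr (density ?P ?W) borel ?T)"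
    by simp
  also have "\<dots> = (\<integral>\<^sup>+p. indicator A (?T p) \<partial>density ?P ?W)"
    by (rule nn_integral_distr) measurable
  also have "\<dots> = (\<integral>\<^sup>+p. ?W p * indicator A (?T p) \<partial>?P)"
    by (rule nn_integral_density) measurable
  also have "\<dots> = (\<integral>\<^sup>+\<gamma>. \<integral>\<^sup>+z. ?W (\<gamma>, z) * indicator A (?T (\<gamma>, z)) \<partial>inv_vol \<partial>count_space \<Gamma>)"
    by (rule V.nn_integral_fst[symmetric]) measurable
  also have "\<dots> = (\<integral>\<^sup>+\<gamma>. \<integral>\<^sup>+u. ennreal (domain_weight \<Gamma> D (act (inv\<^bsub>SU\<^esub> \<gamma>) u)) * indicator A u \<partial>inv_vol \<partial>count_space \<Gamma>)"
  proof (rule nn_integral_cong)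
    fix \<gamma> assume "\<gamma> \<in> space (count_space \<Gamma>)"
    then have \<gamma>: "\<gamma> \<in> carrier SU" using SU by simp
    have "(\<integral>\<^sup>+z. ?W (\<gamma>, z) * indicator A (?T (\<gamma>, z)) \<partial>inv_vol)
        = (\<integral>\<^sup>+z. ennreal (domain_weight \<Gamma> D z) * indicator A (act \<gamma> z) \<partial>inv_vol)"
      by simp
    also have "\<dots> = (\<integral>\<^sup>+u. ennreal (domain_weight \<Gamma> D (act (inv\<^bsub>SU\<^esub> \<gamma>) u)) * indicator A (act \<gamma> (act (inv\<^bsub>SU\<^esub> \<gamma>) u)) \<partial>inv_vol)"
      by (rule nn_integral_inv_vol_act[OF SU_inv_closed[OF \<gamma>], symmetric]) measurable
    also have "\<dots> = (\<integral>\<^sup>+u. ennreal (domain_weight \<Gamma> D (act (inv\<^bsub>SU\<^esub> \<gamma>) u)) * indicator A u \<partial>inv_vol)"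
    proof (rule nn_integral_cong_AE)
      show "AE u in inv_vol. ennreal (domain_weight \<Gamma> D (act (inv\<^bsub>SU\<^esub> \<gamma>) u)) * indicator A (act \<gamma> (act (inv\<^bsub>SU\<^esub> \<gamma>) u))
        = ennreal (domain_weight \<Gamma> D (act (inv\<^bsub>SU\<^esub> \<gamma>) u)) * indicator A u"
        using AE_inv_vol_ball
      proof eventually_elim
        case (elim u)
        then have "u \<in> cball 0 1" by auto
        from act_inv_act(2)[OF \<gamma> this] show ?case by simp
      qed
    qed
    finally show "(\<integral>\<^sup>+z. ?W (\<gamma>, z) * indicator A (?T (\<gamma>, z)) \<partial>inv_vol)
      = (\<integral>\<^sup>+u. ennreal (domain_weight \<Gamma> D (act (inv\<^bsub>SU\<^esub> \<gamma>) u)) * indicator A u \<partial>inv_vol)" .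
  qed
  also have "\<dots> = (\<integral>\<^sup>+u. \<integral>\<^sup>+\<gamma>. ennreal (domain_weight \<Gamma> D (act (inv\<^bsub>SU\<^esub> \<gamma>) u)) * indicator A u \<partial>count_space \<Gamma> \<partial>inv_vol)"
  proof (rule Fubini'[symmetric])
    show "(\<lambda>(\<gamma>, u). ennreal (domain_weight \<Gamma> D (act (inv\<^bsub>SU\<^esub> \<gamma>) u)) * indicator A u) \<in> borel_measurable ?P"
      by (rule measurable_pair_measure_countable1[OF cnt]) simp
  qed
  also have "\<dots> = (\<integral>\<^sup>+u. indicator A u \<partial>inv_vol)"
  proof (rule nn_integral_cong_AE)
    show "AE u in inv_vol. (\<integral>\<^sup>+\<gamma>. ennreal (domain_weight \<Gamma> D (act (inv\<^bsub>SU\<^esub> \<gamma>) u)) * indicator A u \<partial>count_space \<Gamma>) = indicator A u"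
      using AE_inv_vol_ball
    proof eventually_elim
      case (elim u)
      have "bij_betw (\<lambda>\<gamma>. inv\<^bsub>SU\<^esub> \<gamma>) \<Gamma> \<Gamma>"
        by (rule bij_betwI[where g = "\<lambda>\<gamma>. inv\<^bsub>SU\<^esub> \<gamma>"])
           (simp_all add: subgroup_inv[OF \<Gamma>] group.inv_inv[OF group_SU] SU)
      then have "(\<integral>\<^sup>+\<gamma>. ennreal (domain_weight \<Gamma> D (act (inv\<^bsub>SU\<^esub> \<gamma>) u)) \<partial>count_space \<Gamma>)
          = (\<integral>\<^sup>+\<gamma>. ennreal (domain_weight \<Gamma> D (act \<gamma> u)) \<partial>count_space \<Gamma>)"
        by (rule nn_integral_bij_count_space)
      also have "\<dots> = 1" by (rule domain_weight_sum[OF \<Gamma> disc D elim])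
      finally show ?case
        by (subst nn_integral_multc) auto
    qed
  qed
  also have "\<dots> = emeasure inv_vol A" by simp
  finally show "emeasure (distr (density ?P ?W) borel ?T) A = emeasure inv_vol A" .
qed simp

theorem orbit_unfolding:
  fixes \<phi> :: "complex^'n::finite \<Rightarrow> complex"
  assumes \<Gamma>: "subgroup \<Gamma> SU" and disc: "discrete \<Gamma>" and D: "fundamental_domain \<Gamma> D"
    and int: "integrable inv_vol \<phi>"
  shows "AE z in inv_vol. z \<in> D \<longrightarrow> (\<lambda>\<gamma>. \<phi> (act \<gamma> z)) summable_on \<Gamma>"
    and "(\<integral>z. \<phi> z \<partial>inv_vol) =
      (\<integral>z. indicator D z *\<^sub>R (infsum (\<lambda>\<gamma>. \<phi> (act \<gamma> z)) \<Gamma> / of_nat (card {\<gamma>\<in>\<Gamma>. act \<gamma> z = z})) \<partial>inv_vol)"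
proof -
  have cnt: "countable \<Gamma>" by (rule countable_discrete_subgroup[OF \<Gamma> disc])
  have [measurable]: "D \<in> sets borel" and DB: "D \<subseteq> ball 0 1" using D by (simp_all add: fundamental_domain_def)
  note [measurable] = borel_measurable_domain_weight[OF cnt]
  have [measurable]: "\<phi> \<in> borel_measurable borel"
    using borel_measurable_integrable[OF int] by simp
  interpret G: sigma_finite_measure "count_space \<Gamma>"
    by (rule sigma_finite_measure_count_space_countable[OF cnt])
  interpret V: sigma_finite_measure "inv_vol :: (complex^'n) measure"
    by (rule sigma_finite_inv_vol)
  interpret pair_sigma_finite "count_space \<Gamma>" "inv_vol :: (complex^'n) measure" ..
  let ?P = "count_space \<Gamma> \<Otimes>\<^sub>M (inv_vol :: (complex^'n) measure)"
  let ?w = "domain_weight \<Gamma> D"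
  have wpos: "0 \<le> ?w z" for z by (simp add: domain_weight_def)
  have T [measurable]: "(\<lambda>(\<gamma>, z). act \<gamma> z) \<in> borel_measurable ?P"
    by (rule measurable_pair_measure_countable1[OF cnt]) simp
  have "integrable (distr (density ?P (\<lambda>(\<gamma>, z). ennreal (?w z))) borel (\<lambda>(\<gamma>, z). act \<gamma> z)) \<phi>"
    using int by (simp add: unfolding_measure[OF \<Gamma> disc D])
  then have "integrable (density ?P (\<lambda>p. ennreal (?w (snd p)))) (\<lambda>p. \<phi> (case p of (\<gamma>, z) \<Rightarrow> act \<gamma> z))"
    by (subst (asm) integrable_distr_eq) (auto simp: case_prod_unfold)
  then have *: "integrable ?P (\<lambda>(\<gamma>, z). ?w z *\<^sub>R \<phi> (act \<gamma> z))"
    by (subst (asm) integrable_density) (auto simp: case_prod_unfold wpos)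
  have card: "?w z *\<^sub>R c = indicator D z *\<^sub>R (c / of_nat (card {\<gamma>\<in>\<Gamma>. act \<gamma> z = z}))" for z and c :: complex
    by (simp add: domain_weight_def indicator_def scaleR_conv_of_real)
  show "AE z in inv_vol. z \<in> D \<longrightarrow> (\<lambda>\<gamma>. \<phi> (act \<gamma> z)) summable_on \<Gamma>"
    using AE_integrable_snd[OF *]
  proof eventually_elim
    case (elim z)
    show ?case
    proof
      assume z: "z \<in> D"
      then have "z \<in> ball 0 1" using DB by blast
      then have "card {\<gamma>\<in>\<Gamma>. act \<gamma> z = z} > 0"
        by (rule stabilizer_card_pos[OF \<Gamma> disc])
      then have "?w z \<noteq> 0"
        using z unfolding domain_weight_def by simp
      then show "(\<lambda>\<gamma>. \<phi> (act \<gamma> z)) summable_on \<Gamma>"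
        using integrable_scaleR_right[where c = "inverse (?w z)" and M = "count_space \<Gamma>"] elim
        unfolding summable_on_iff_integrable_count_space by fastforce
    qed
  qed
  have "(\<integral>z. \<phi> z \<partial>inv_vol) = (\<integral>z. \<phi> z \<partial>distr (density ?P (\<lambda>(\<gamma>, z). ennreal (?w z))) borel (\<lambda>(\<gamma>, z). act \<gamma> z))"
    by (simp add: unfolding_measure[OF \<Gamma> disc D])
  also have "\<dots> = (\<integral>p. \<phi> (case p of (\<gamma>, z) \<Rightarrow> act \<gamma> z) \<partial>density ?P (\<lambda>p. ennreal (?w (snd p))))"
    by (subst integral_distr) (auto simp: case_prod_unfold)
  also have "\<dots> = (\<integral>p. ?w (snd p) *\<^sub>R \<phi> (case p of (\<gamma>, z) \<Rightarrow> act \<gamma> z) \<partial>?P)"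
    by (rule integral_density) (auto simp: wpos)
  also have "\<dots> = (\<integral>(\<gamma>, z). ?w z *\<^sub>R \<phi> (act \<gamma> z) \<partial>?P)"
    by (simp add: case_prod_unfold)
  also have "\<dots> = (\<integral>z. (\<integral>\<gamma>. ?w z *\<^sub>R \<phi> (act \<gamma> z) \<partial>count_space \<Gamma>) \<partial>inv_vol)"
    by (rule integral_snd[OF *, symmetric])
  also have "\<dots> = (\<integral>z. ?w z *\<^sub>R infsum (\<lambda>\<gamma>. \<phi> (act \<gamma> z)) \<Gamma> \<partial>inv_vol)"
    unfolding infsum_eq_integral_count_space by (simp only: integral_scaleR_right)
  also have "\<dots> = (\<integral>z. indicator D z *\<^sub>R (infsum (\<lambda>\<gamma>. \<phi> (act \<gamma> z)) \<Gamma> / of_nat (card {\<gamma>\<in>\<Gamma>. act \<gamma> z = z})) \<partial>inv_vol)"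
    unfolding card ..
  finally show "(\<integral>z. \<phi> z \<partial>inv_vol) =
      (\<integral>z. indicator D z *\<^sub>R (infsum (\<lambda>\<gamma>. \<phi> (act \<gamma> z)) \<Gamma> / of_nat (card {\<gamma>\<in>\<Gamma>. act \<gamma> z = z})) \<partial>inv_vol)" .
qed

section \<open>Beta integrals and the mass of the ball\<close>

lemma has_integral_beta_nat:
  "((\<lambda>t::real. t ^ a * (1 - t) ^ b) has_integral fact a * fact b / fact (a + b + 1)) {0..1}"
proof -
  have "((\<lambda>t. t powr (real (Suc a) - 1) * (1 - t) powr (real (Suc b) - 1)) has_integral Beta (real (Suc a)) (real (Suc b))) {0..1}"
    by (rule has_integral_Beta_real) auto
  moreover have "Beta (real (Suc a)) (real (Suc b)) = fact a * fact b / fact (a + b + 1)"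
  proof -
    have "Gamma (real (Suc a) + real (Suc b)) = fact (a + b + 1)"
      using Gamma_fact[of "a + b + 1", where 'a = real] by (simp add: algebra_simps)
    moreover have "Gamma (real (Suc a)) = fact a" "Gamma (real (Suc b)) = fact b"
      using Gamma_fact[of a, where 'a = real] Gamma_fact[of b, where 'a = real] by (simp_all add: add.commute)
    ultimately show ?thesis by (simp add: Beta_def)
  qed
  ultimately have "((\<lambda>t. t powr (real (Suc a) - 1) * (1 - t) powr (real (Suc b) - 1)) has_integral fact a * fact b / fact (a + b + 1)) {0..1}"
    by simp
  then show ?thesis
    by (rule has_integral_spike_finite[where S = "{0, 1}", rotated 2]) (auto simp: powr_realpow)
qed

lemma nn_integral_beta_nat:
  "(\<integral>\<^sup>+t. ennreal (t ^ a * (1 - t) ^ b) * indicator {0..1} t \<partial>lborel) = ennreal (fact a * fact b / fact (a + b + 1))"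
proof -
  have "((\<lambda>t::real. if t \<in> {0..1} then t ^ a * (1 - t) ^ b else 0) has_integral fact a * fact b / fact (a + b + 1)) UNIV"
    using has_integral_beta_nat by (simp only: has_integral_restrict_UNIV)
  then have "(\<integral>\<^sup>+t. ennreal (if t \<in> {0..1} then t ^ a * (1 - t) ^ b else 0) \<partial>lborel) = ennreal (fact a * fact b / fact (a + b + 1))"
    by (intro nn_integral_has_integral_lborel) auto
  moreover have "ennreal (if t \<in> {0..1} then t ^ a * (1 - t) ^ b else 0)
      = ennreal (t ^ a * (1 - t) ^ b) * indicator {0..1} t" for t :: real
    by simp
  ultimately show ?thesis by (simp only:)
qed

text \<open>Write \<open>(1 - |z|\<^sup>2)^p\<close> as the integral of \<open>p s^(p-1)\<close> over \<open>0 \<le> s \<le> 1 - |z|\<^sup>2\<close> and exchange the integrations: the inner one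
is the volume of a ball of radius \<open>(1 - s)^(1/2)\<close>, and the outer one is a Beta integral.\<close>
lemma nn_integral_ball_power:
  assumes p: "p > 0"
  shows "(\<integral>\<^sup>+z. ennreal (indicator (ball 0 1) z * (1 - (norm z)\<^sup>2) ^ p) \<partial>(lborel :: (complex^'n::finite) measure))
     = ennreal (pi ^ CARD('n) * fact p / fact (p + CARD('n)))"
proof -
  let ?n = "CARD('n)"
  let ?F = "\<lambda>(z :: complex^'n) (s :: real). ennreal (real p * s ^ (p - 1)) * indicator {0..1 - (norm z)\<^sup>2} s"
  have meas: "(\<lambda>(z, s). ?F z s) \<in> borel_measurable (lborel \<Otimes>\<^sub>M lborel)"
  proof -
    have set: "{x :: (complex^'n) \<times> real. snd x \<in> {0..1 - (norm (fst x))\<^sup>2}} \<in> sets borel"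
    proof -
      have "closed {x :: (complex^'n) \<times> real. 0 \<le> snd x \<and> snd x \<le> 1 - (norm (fst x))\<^sup>2}"
        by (intro closed_Collect_conj closed_Collect_le continuous_intros)
      then show ?thesis by (simp add: borel_closed)
    qed
    have "(\<lambda>x :: (complex^'n) \<times> real. ennreal (real p * snd x ^ (p - 1)) *
        indicator {x. snd x \<in> {0..1 - (norm (fst x))\<^sup>2}} x) \<in> borel_measurable (lborel \<Otimes>\<^sub>M lborel)"
      unfolding lborel_prod measurable_lborel1 measurable_lborel2 sets_lborel
      by (intro borel_measurable_times_ennreal measurable_compose[OF _ measurable_ennreal]
          borel_measurable_indicator set borel_measurable_continuous_onI continuous_intros)
    then show ?thesis
      by (simp add: case_prod_unfold indicator_def)
  qed
  have "(\<integral>\<^sup>+z. ennreal (indicator (ball 0 1) z * (1 - (norm z)\<^sup>2) ^ p) \<partial>(lborel :: (complex^'n) measure))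
      = (\<integral>\<^sup>+z. (\<integral>\<^sup>+s. ?F z s \<partial>lborel) \<partial>lborel)"
  proof (rule nn_integral_cong_AE, rule AE_I2)
    fix z :: "complex^'n"
    show "ennreal (indicator (ball 0 1) z * (1 - (norm z)\<^sup>2) ^ p) = (\<integral>\<^sup>+s. ?F z s \<partial>lborel)"
    proof (cases "z \<in> ball 0 1")
      case True
      have "(\<integral>\<^sup>+s. ?F z s \<partial>lborel) = ennreal ((1 - (norm z)\<^sup>2) ^ p - 0 ^ p)"
        using True
        by (intro nn_integral_FTC_Icc[where F = "\<lambda>s. s ^ p"]) (auto intro!: derivative_eq_intros simp: abs_square_le_1)
      then show ?thesis
        using True p by (simp add: zero_power)
    next
      case False
      then have "1 \<le> (norm z)\<^sup>2" by (simp add: one_le_power)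
      then have "?F z s = 0" if "s \<noteq> 0" for s
        using that by (auto simp: indicator_def)
      then have "AE s in lborel. ?F z s = 0"
        using AE_lborel_singleton[of "0::real"] by (auto elim!: eventually_mono)
      from nn_integral_cong_AE[OF this] False show ?thesis by simp
    qed
  qed
  also have "\<dots> = (\<integral>\<^sup>+s. (\<integral>\<^sup>+z. ?F z s \<partial>lborel) \<partial>lborel)"
    by (rule lborel_pair.Fubini'[OF meas, symmetric])
  also have "\<dots> = (\<integral>\<^sup>+s. ennreal (unit_ball_vol (2 * real ?n) * real p) * (ennreal (s ^ (p - 1) * (1 - s) ^ ?n) * indicator {0..1} s) \<partial>lborel)"
  proof (rule nn_integral_cong)
    fix s :: real
    show "(\<integral>\<^sup>+z. ?F z s \<partial>lborel) = ennreal (unit_ball_vol (2 * real ?n) * real p) * (ennreal (s ^ (p - 1) * (1 - s) ^ ?n) * indicator {0..1} s)"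
    proof (cases "s \<in> {0..1}")
      case True
      define r where "r = sqrt (1 - s)"
      have r: "r \<ge> 0" "r\<^sup>2 = 1 - s" using True by (simp_all add: r_def)
      have iff: "s \<in> {0..1 - (norm z)\<^sup>2} \<longleftrightarrow> z \<in> cball 0 r" for z :: "complex^'n"
      proof -
        have "(norm z)\<^sup>2 \<le> r\<^sup>2 \<longleftrightarrow> norm z \<le> r"
          using r(1) by (simp add: power_mono_iff)
        then show ?thesis using True r(2) by auto
      qed
      have "(\<integral>\<^sup>+z. ?F z s \<partial>lborel) = (\<integral>\<^sup>+z. ennreal (real p * s ^ (p - 1)) * indicator (cball 0 r) (z :: complex^'n) \<partial>lborel)"
        by (simp only: indicator_def iff)
      also have "\<dots> = ennreal (real p * s ^ (p - 1)) * emeasure lborel (cball (0 :: complex^'n) r)"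
        by (rule nn_integral_cmult_indicator) simp
      also have "emeasure lborel (cball (0 :: complex^'n) r) = ennreal (unit_ball_vol (2 * real ?n) * (1 - s) ^ ?n)"
        using r by (simp add: emeasure_cball power_mult[of r 2] mult.commute[of _ 2])
      finally show ?thesis
        using True by (simp add: ennreal_mult[symmetric] mult_ac)
    next
      case False
      then have "s \<notin> {0..1 - (norm z)\<^sup>2}" for z :: "complex^'n"
        by (auto intro: order_trans)
      then show ?thesis using False by simp
    qed
  qed
  also have "\<dots> = ennreal (unit_ball_vol (2 * real ?n) * real p) * ennreal (fact (p - 1) * fact ?n / fact (p - 1 + ?n + 1))"
    by (subst nn_integral_cmult) (auto simp: nn_integral_beta_nat)
  also have "\<dots> = ennreal (unit_ball_vol (2 * real ?n) * real p * (fact (p - 1) * fact ?n / fact (p - 1 + ?n + 1)))"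
    by (rule ennreal_mult[symmetric]) auto
  also have "unit_ball_vol (2 * real ?n) * real p * (fact (p - 1) * fact ?n / fact (p - 1 + ?n + 1)) = pi ^ ?n * fact p / fact (p + ?n)"
    using p unit_ball_vol_even[of ?n] fact_reduce[of p, where 'a = real] by (simp add: field_simps)
  finally show ?thesis .
qed

lemma integral_height_power:
  assumes k: "CARD('n) + 1 < k"
  shows "integrable (inv_vol :: (complex^'n::finite) measure) (\<lambda>z. indicator (ball 0 1) z * height z ^ k)"
    and "(\<integral>z. indicator (ball 0 1) z * height z ^ k \<partial>(inv_vol :: (complex^'n) measure))
      = 4 ^ CARD('n) * pi ^ CARD('n) * fact (k - CARD('n) - 1) / fact (k - 1)"
proof -
  let ?n = "CARD('n)"
  define p where "p = k - ?n - 1"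
  have p: "p > 0" "k = p + (?n + 1)" using k by (simp_all add: p_def)
  have nonneg: "0 \<le> indicator (ball 0 1) z * height z ^ k" for z :: "complex^'n"
    using height_pos_iff[of z] by (auto simp: indicator_def)
  have "(\<integral>\<^sup>+z. ennreal (indicator (ball 0 1) z * height z ^ k) \<partial>(inv_vol :: (complex^'n) measure))
     = (\<integral>\<^sup>+z. ennreal (4 ^ ?n) * ennreal (indicator (ball 0 1) z * (1 - (norm (z :: complex^'n))\<^sup>2) ^ p) \<partial>lborel)"
  proof (subst nn_integral_inv_vol, measurable, rule nn_integral_cong)
    fix z :: "complex^'n"
    show "ennreal (indicator (ball 0 1) z * 4 ^ ?n / height z ^ (?n + 1)) * ennreal (indicator (ball 0 1) z * height z ^ k)
       = ennreal (4 ^ ?n) * ennreal (indicator (ball 0 1) z * (1 - (norm z)\<^sup>2) ^ p)"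
    proof (cases "z \<in> ball 0 1")
      case True
      then have h: "height z > 0" by (simp only: height_pos_iff)
      have "4 ^ ?n / height z ^ (?n + 1) * height z ^ k = 4 ^ ?n * height z ^ p"
        using h unfolding p(2) power_add by (simp add: field_simps)
      then have "ennreal (4 ^ ?n / height z ^ (?n + 1)) * ennreal (height z ^ k) = ennreal (4 ^ ?n) * ennreal (height z ^ p)"
        using h by (subst (1 2) ennreal_mult[symmetric]) auto
      then show ?thesis
        using True by (simp add: height_eq)
    qed simp
  qed
  also have "\<dots> = ennreal (4 ^ ?n) * ennreal (pi ^ ?n * fact p / fact (p + ?n))"
    by (subst nn_integral_cmult) (auto simp: nn_integral_ball_power[OF p(1)])
  also have "\<dots> = ennreal (4 ^ ?n * (pi ^ ?n * fact p / fact (p + ?n)))"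
    by (rule ennreal_mult[symmetric]) auto
  finally have *: "(\<integral>\<^sup>+z. ennreal (indicator (ball 0 1) z * height z ^ k) \<partial>(inv_vol :: (complex^'n) measure))
     = ennreal (4 ^ ?n * (pi ^ ?n * fact p / fact (p + ?n)))" .
  have "has_bochner_integral inv_vol (\<lambda>z :: complex^'n. indicator (ball 0 1) z * height z ^ k)
       (4 ^ ?n * (pi ^ ?n * fact p / fact (p + ?n)))"
    by (rule has_bochner_integral_nn_integral) (auto simp: * nonneg, measurable)
  moreover have "k - ?n - 1 = p" "k - 1 = p + ?n" using p by auto
  ultimately show "integrable (inv_vol :: (complex^'n::finite) measure) (\<lambda>z. indicator (ball 0 1) z * height z ^ k)"
    "(\<integral>z. indicator (ball 0 1) z * height z ^ k \<partial>(inv_vol :: (complex^'n) measure))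
      = 4 ^ CARD('n) * pi ^ CARD('n) * fact (k - CARD('n) - 1) / fact (k - 1)"
    by (simp_all add: has_bochner_integral_iff)
qed

text \<open>For exponents of at least \<open>n + 1\<close> the height cancels the singularity of the density, so the integrand is bounded on a
set of finite Lebesgue measure.\<close>
lemma integrable_height_power:
  assumes k: "CARD('n) + 1 \<le> k"
  shows "integrable (inv_vol :: (complex^'n::finite) measure) (\<lambda>z. indicator (ball 0 1) z * height z ^ k)"
proof (rule integrableI_nonneg)
  let ?n = "CARD('n)"
  show "(\<lambda>z :: complex^'n. indicator (ball 0 1) z * height z ^ k) \<in> borel_measurable inv_vol" by measurable
  show "AE z :: complex^'n in inv_vol. 0 \<le> indicator (ball 0 1) z * height z ^ k"
    by (rule AE_I2) (metis height_pos_iff indicator_simps mult_1 mult_zero_left order_refl zero_le_power less_imp_le)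
  have "(\<integral>\<^sup>+z. ennreal (indicator (ball 0 1) z * height z ^ k) \<partial>(inv_vol :: (complex^'n) measure))
     \<le> (\<integral>\<^sup>+z. ennreal (4 ^ ?n) * indicator (ball 0 1) (z :: complex^'n) \<partial>lborel)"
  proof (subst nn_integral_inv_vol, measurable, rule nn_integral_mono)
    fix z :: "complex^'n"
    show "ennreal (indicator (ball 0 1) z * 4 ^ ?n / height z ^ (?n + 1)) * ennreal (indicator (ball 0 1) z * height z ^ k)
       \<le> ennreal (4 ^ ?n) * indicator (ball 0 1) z"
    proof (cases "z \<in> ball 0 1")
      case True
      then have h: "height z > 0" by (simp only: height_pos_iff)
      have h1: "height z \<le> 1" by (simp add: height_eq)
      have "4 ^ ?n / height z ^ (?n + 1) * height z ^ k \<le> 4 ^ ?n"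
        using h h1 k power_decreasing[OF k, of "height z"] by (simp add: field_simps)
      then have "ennreal (4 ^ ?n / height z ^ (?n + 1)) * ennreal (height z ^ k) \<le> ennreal (4 ^ ?n)"
        using h by (subst ennreal_mult[symmetric]) (auto intro: ennreal_leI)
      then show ?thesis
        using True by simp
    qed simp
  qed
  also have "\<dots> = ennreal (4 ^ ?n) * emeasure lborel (ball (0 :: complex^'n) 1)"
    by (rule nn_integral_cmult_indicator) simp
  also have "\<dots> < \<infinity>"
    using ball_lborel_finite_pos(2)[where 'a = "complex^'n"] by (simp add: ennreal_mult_less_top less_top)
  finally show "(\<integral>\<^sup>+z. ennreal (indicator (ball 0 1) z * height z ^ k) \<partial>(inv_vol :: (complex^'n) measure)) < \<infinity>" .
qed

section \<open>The mean value property\<close>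

lemma distr_inv_vol_rotation:
  assumes c: "cmod c = 1"
  shows "distr inv_vol borel (\<lambda>z. c *s z) = (inv_vol :: (complex^'n::finite) measure)"
proof (rule measure_eqI)
  fix A assume "A \<in> sets (distr inv_vol borel (\<lambda>z :: complex^'n. c *s z))"
  then have [measurable]: "A \<in> sets borel" by simp
  let ?d = "\<lambda>z :: complex^'n. ennreal (indicator (ball 0 1) z * 4 ^ CARD('n) / height z ^ (CARD('n) + 1))"
  have d: "?d (c *s z) = ?d z" for z
    by (simp add: height_eq norm_scale_vec c indicator_def)
  have "emeasure (distr inv_vol borel (\<lambda>z :: complex^'n. c *s z)) A = (\<integral>\<^sup>+z. indicator A z \<partial>distr inv_vol borel (\<lambda>z :: complex^'n. c *s z))"
    by simp
  also have "\<dots> = (\<integral>\<^sup>+z. indicator A (c *s z) \<partial>inv_vol)"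
    by (rule nn_integral_distr) measurable
  also have "\<dots> = (\<integral>\<^sup>+z. ?d z * indicator A (c *s z) \<partial>lborel)"
    by (rule nn_integral_inv_vol) measurable
  also have "\<dots> = (\<integral>\<^sup>+z. ?d (c *s z) * indicator A (c *s z) \<partial>lborel)"
    by (simp only: d)
  also have "\<dots> = (\<integral>\<^sup>+z. ?d z * indicator A z \<partial>distr lborel borel (\<lambda>z. c *s z))"
    by (rule nn_integral_distr[symmetric]) measurable
  also have "\<dots> = (\<integral>\<^sup>+z. ?d z * indicator A z \<partial>lborel)"
    by (simp only: lborel_unit_scale[OF c])
  also have "\<dots> = (\<integral>\<^sup>+z. indicator A z \<partial>inv_vol)"
    by (rule nn_integral_inv_vol[symmetric]) measurable
  also have "\<dots> = emeasure inv_vol A" by simp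
  finally show "emeasure (distr inv_vol borel (\<lambda>z :: complex^'n. c *s z)) A = emeasure inv_vol A" .
qed simp

text \<open>Cauchy's formula at the centre of the unit circle, parametrized by \<open>[0, 1]\<close>.\<close>
lemma circle_mean:
  assumes "open U" "cball 0 1 \<subseteq> U" "f holomorphic_on U"
  shows "(\<integral>x. indicator {0..1} x *\<^sub>R f (exp (2 * of_real pi * \<i> * of_real x)) \<partial>lborel) = f 0"
proof -
  let ?e = "\<lambda>x::real. exp (2 * of_real pi * \<i> * of_real x)"
  have e: "?e x = circlepath 0 1 x" for x
    by (simp add: circlepath)
  have norm_e: "?e x \<in> cball 0 1" for x
    by (simp add: norm_exp_i_times[of "2 * pi * x", simplified] mult_ac)
  have cont: "continuous_on {0..1} (\<lambda>x. f (?e x))"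
  proof (rule continuous_on_compose2[of "cball 0 1" f])
    show "continuous_on (cball 0 1) f"
      using assms holomorphic_on_imp_continuous_on continuous_on_subset by blast
    show "continuous_on {0..1} ?e"
      by (intro continuous_intros)
  qed (use norm_e in blast)
  have int: "set_integrable lborel {0..1} (\<lambda>x. f (?e x))"
    by (rule borel_integrable_atLeastAtMost') (rule cont)
  have "((\<lambda>u. f u / (u - 0)) has_contour_integral (2 * of_real pi * \<i> * f 0)) (circlepath 0 1)"
  proof (rule Cauchy_integral_circlepath)
    show "continuous_on (cball 0 1) f"
      using assms holomorphic_on_imp_continuous_on continuous_on_subset by blast
    show "f holomorphic_on ball 0 1"
      using assms by (meson ball_subset_cball holomorphic_on_subset order_trans)
  qed simp
  then have "((\<lambda>x. f (circlepath 0 1 x) / (circlepath 0 1 x - 0) * vector_derivative (circlepath 0 1) (at x within {0..1}))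
      has_integral (2 * of_real pi * \<i> * f 0)) {0..1}"
    unfolding has_contour_integral_def .
  then have "((\<lambda>x. 2 * of_real pi * \<i> * f (?e x)) has_integral (2 * of_real pi * \<i> * f 0)) {0..1}"
  proof (rule has_integral_eq[rotated])
    fix x :: real assume "x \<in> {0..1}"
    then show "f (circlepath 0 1 x) / (circlepath 0 1 x - 0) * vector_derivative (circlepath 0 1) (at x within {0..1})
        = 2 * of_real pi * \<i> * f (?e x)"
      by (simp add: vector_derivative_circlepath01 e[symmetric])
  qed
  then have "((\<lambda>x. inverse (2 * of_real pi * \<i>) * (2 * of_real pi * \<i> * f (?e x))) has_integral inverse (2 * of_real pi * \<i>) * (2 * of_real pi * \<i> * f 0)) {0..1}"
    by (rule has_integral_mult_right)
  moreover have "inverse (2 * of_real pi * \<i>) * (2 * of_real pi * \<i> * y) = y" for y :: complex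
    by (subst mult.assoc[symmetric], subst left_inverse) simp_all
  ultimately have "integral {0..1} (\<lambda>x. f (?e x)) = f 0"
    by (simp only: integral_unique)
  then show "(\<integral>x. indicator {0..1} x *\<^sub>R f (?e x) \<partial>lborel) = f 0"
    using set_borel_integral_eq_integral(2)[OF int] by (simp add: set_lebesgue_integral_def)
qed

text \<open>The measure \<open>height^m dV\<close> is invariant under multiplication by phases. Averaging over the phase replaces \<open>F w\<close> by the
mean of \<open>F\<close> over the circle through \<open>w\<close> on the complex line of \<open>w\<close>, which is \<open>F 0\<close>.\<close>
theorem ball_mean_value:
  fixes F :: "complex^'n::finite \<Rightarrow> complex"
  assumes hol: "\<And>w. w \<in> ball 0 1 \<Longrightarrow> (\<lambda>c. F (c *s w)) holomorphic_on {c. c *s w \<in> ball 0 1}"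
    and int: "integrable inv_vol (\<lambda>w. indicator (ball 0 1) w *\<^sub>R (F w * of_real (height w ^ m)))"
    and inth: "integrable (inv_vol :: (complex^'n) measure) (\<lambda>z. indicator (ball 0 1) z * height z ^ m)"
  shows "(\<integral>w. indicator (ball 0 1) w *\<^sub>R (F w * of_real (height w ^ m)) \<partial>inv_vol) =
    F 0 * of_real (\<integral>z. indicator (ball 0 1) z * height z ^ m \<partial>(inv_vol :: (complex^'n) measure))"
proof -
  let ?V = "inv_vol :: (complex^'n) measure"
  let ?e = "\<lambda>x::real. exp (2 * of_real pi * \<i> * of_real x)"
  have norm_e: "cmod (?e x) = 1" for x
    by (simp add: norm_exp_i_times[of "2 * pi * x", simplified] mult_ac)
  define G where "G w = indicator (ball 0 1) w *\<^sub>R (F w * of_real (height w ^ m))" for w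
  have intG: "integrable ?V G"
    using int by (simp add: G_def[abs_def])
  then have [measurable]: "G \<in> borel_measurable borel"
    using borel_measurable_integrable by fastforce
  have rot_int: "integrable ?V (\<lambda>w. G (c *s w))" and rot_eq: "(\<integral>w. G (c *s w) \<partial>?V) = (\<integral>w. G w \<partial>?V)"
    and rot_norm: "(\<integral>w. norm (G (c *s w)) \<partial>?V) = (\<integral>w. norm (G w) \<partial>?V)" if c: "cmod c = 1" for c
  proof -
    have "integrable (distr ?V borel (\<lambda>z. c *s z)) G"
      using intG by (simp add: distr_inv_vol_rotation[OF c])
    then show "integrable ?V (\<lambda>w. G (c *s w))"
      by (subst (asm) integrable_distr_eq) auto
    have "(\<integral>w. G w \<partial>?V) = (\<integral>w. G w \<partial>distr ?V borel (\<lambda>z. c *s z))"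
      by (simp add: distr_inv_vol_rotation[OF c])
    also have "\<dots> = (\<integral>w. G (c *s w) \<partial>?V)"
      by (rule integral_distr) measurable
    finally show "(\<integral>w. G (c *s w) \<partial>?V) = (\<integral>w. G w \<partial>?V)" ..
    have "(\<integral>w. norm (G w) \<partial>?V) = (\<integral>w. norm (G w) \<partial>distr ?V borel (\<lambda>z. c *s z))"
      by (simp add: distr_inv_vol_rotation[OF c])
    also have "\<dots> = (\<integral>w. norm (G (c *s w)) \<partial>?V)"
      by (rule integral_distr) measurable
    finally show "(\<integral>w. norm (G (c *s w)) \<partial>?V) = (\<integral>w. norm (G w) \<partial>?V)" ..
  qed
  interpret V: sigma_finite_measure ?V by (rule sigma_finite_inv_vol)
  interpret pair_sigma_finite lborel ?V ..
  let ?H = "\<lambda>(x, w). indicator {0..1::real} x *\<^sub>R G (?e x *s w)"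
  have scale_meas: "(\<lambda>(x, w). ?e x *s w) \<in> borel_measurable (lborel \<Otimes>\<^sub>M ?V)"
  proof -
    have "(\<lambda>p. \<chi> i. ?e (fst p) * (snd p $ i)) \<in> borel_measurable (lborel \<Otimes>\<^sub>M ?V)"
      by (rule borel_measurable_vec_lambda) measurable
    then show ?thesis
      by (simp add: case_prod_unfold vector_scalar_mult_def)
  qed
  have Hint: "integrable (lborel \<Otimes>\<^sub>M ?V) ?H"
  proof (rule Fubini_integrable)
    show "?H \<in> borel_measurable (lborel \<Otimes>\<^sub>M ?V)"
      using scale_meas by (simp add: case_prod_unfold)
    have "(\<integral>w. norm (?H (x, w)) \<partial>?V) = indicator {0..1} x * (\<integral>w. norm (G w) \<partial>?V)" for x
      by (simp add: rot_norm[OF norm_e])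
    moreover have "integrable lborel (\<lambda>x::real. indicator {0..1} x * (\<integral>w. norm (G w) \<partial>?V))"
      by (intro integrable_mult_left integrable_real_indicator) auto
    ultimately show "integrable lborel (\<lambda>x. \<integral>w. norm (?H (x, w)) \<partial>?V)"
      by (simp only:)
    show "AE x in lborel. integrable ?V (\<lambda>w. ?H (x, w))"
      by (rule AE_I2) (simp add: rot_int[OF norm_e])
  qed
  have "(\<integral>w. G w \<partial>?V) = (\<integral>x. indicator {0..1::real} x *\<^sub>R (\<integral>w. G w \<partial>?V) \<partial>lborel)"
    by simp
  also have "\<dots> = (\<integral>x. \<integral>w. indicator {0..1::real} x *\<^sub>R G (?e x *s w) \<partial>?V \<partial>lborel)"
    by (simp only: integral_scaleR_right rot_eq[OF norm_e])
  also have "\<dots> = (\<integral>w. \<integral>x. indicator {0..1::real} x *\<^sub>R G (?e x *s w) \<partial>lborel \<partial>?V)"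
    by (rule Fubini_integral[OF Hint, symmetric])
  also have "\<dots> = (\<integral>w. F 0 * of_real (indicator (ball 0 1) w * height w ^ m) \<partial>?V)"
  proof (rule Bochner_Integration.integral_cong[OF refl])
    fix w :: "complex^'n"
    show "(\<integral>x. indicator {0..1::real} x *\<^sub>R G (?e x *s w) \<partial>lborel) = F 0 * of_real (indicator (ball 0 1) w * height w ^ m)"
    proof (cases "w \<in> ball 0 1")
      case True
      have "G (?e x *s w) = F (?e x *s w) * of_real (height w ^ m)" for x
        using True by (simp add: G_def norm_scale_vec height_eq norm_e)
      then have "(\<integral>x. indicator {0..1::real} x *\<^sub>R G (?e x *s w) \<partial>lborel)
         = (\<integral>x. (indicator {0..1::real} x *\<^sub>R F (?e x *s w)) * of_real (height w ^ m) \<partial>lborel)"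
        by simp
      also have "\<dots> = (\<integral>x. indicator {0..1::real} x *\<^sub>R F (?e x *s w) \<partial>lborel) * of_real (height w ^ m)"
        by (rule integral_mult_left_zero)
      also have "(\<integral>x. indicator {0..1::real} x *\<^sub>R F (?e x *s w) \<partial>lborel) = F (0 *s w)"
      proof (rule circle_mean[OF _ _ hol[OF True]])
        have "continuous_on UNIV (\<lambda>c. norm (c *s w))"
          unfolding norm_scale_vec by (intro continuous_intros)
        then show "open {c. c *s w \<in> ball 0 1}"
          unfolding mem_ball_0 by (intro open_Collect_less) (auto intro: continuous_intros)
        show "cball 0 1 \<subseteq> {c. c *s w \<in> ball 0 1}"
        proof
          fix c :: complex assume "c \<in> cball 0 1"
          then have "cmod c * norm w \<le> 1 * norm w" by (intro mult_right_mono) auto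
          then show "c \<in> {c. c *s w \<in> ball 0 1}"
            using True by (simp add: norm_scale_vec)
        qed
      qed
      finally show ?thesis
        using True by simp
    next
      case False
      then have "G (?e x *s w) = 0" for x
        by (simp add: G_def norm_scale_vec norm_e)
      then show ?thesis using False by simp
    qed
  qed
  also have "\<dots> = F 0 * (\<integral>w. complex_of_real (indicator (ball 0 1) w * height w ^ m) \<partial>?V)"
    by (rule integral_mult_right_zero)
  also have "(\<integral>w. complex_of_real (indicator (ball 0 1) w * height w ^ m) \<partial>?V)
     = of_real (\<integral>w. indicator (ball 0 1) w * height w ^ m \<partial>?V)"
    by (rule integral_of_real[OF inth])
  finally show ?thesis
    by (simp add: G_def)
qed

section \<open>The integral of the kernel along a geodesic\<close>

text \<open>With \<open>y = a e\<^sup>t / E t\<close> one has \<open>y (1 - y) = a b / (E t)\<^sup>2\<close> and \<open>y' = 2 a b / (E t)\<^sup>2\<close>, so the integrand is a constant multiple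
of \<open>(y (1 - y))^(k-1) y'\<close>. A complex primitive \<open>P\<close> of this polynomial gives a primitive \<open>\<Phi>\<close> of the kernel that depends
on \<open>t\<close> through \<open>y\<close> alone. Since \<open>y\<close> tends to 0 and to 1 at the two ends, the total integral is the Beta
value \<open>P 1 - P 0\<close>, although the path of \<open>y\<close> is not the real interval. The sign condition on \<open>a\<close> and \<open>b\<close> keeps the
denominator away from 0.\<close>
lemma kernel_line_integral:
  fixes a b :: complex
  assumes pos: "Re (a * cnj b) > 0" and k: "k > 0"
  defines "E \<equiv> \<lambda>t::real. of_real (exp t) * a + of_real (exp (- t)) * b"
  shows "E t \<noteq> 0"
    and "\<exists>\<Phi>. (\<forall>s t. s \<le> t \<longrightarrow> ((\<lambda>t. inverse ((E t / 2) ^ (2 * k))) has_integral \<Phi> t - \<Phi> s) {s..t}) \<and>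
      (\<Phi> \<longlongrightarrow> 0) at_bot \<and>
      (\<Phi> \<longlongrightarrow> of_real (2 ^ (2 * k - 1) * (fact (k - 1))\<^sup>2 / fact (2 * k - 1)) * inverse ((a * b) ^ k)) at_top"
proof -
  have ab: "a \<noteq> 0" "b \<noteq> 0" using pos by auto
  show E0: "E t \<noteq> 0" for t
  proof
    assume "E t = 0"
    then have "of_real (exp t) * a = - (of_real (exp (- t)) * b)"
      by (simp add: E_def add_eq_0_iff2)
    then have "of_real (exp t) * (a * cnj b) = - (of_real (exp (- t)) * (b * cnj b))"
      by (simp add: mult.assoc[symmetric])
    moreover have "of_real (exp (- t)) * (b * cnj b) = complex_of_real (exp (- t) * (cmod b)\<^sup>2)"
      by (simp add: complex_norm_square del: of_real_power)
    ultimately have "of_real (exp t) * (a * cnj b) = complex_of_real (- (exp (- t) * (cmod b)\<^sup>2))"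
      by simp
    moreover have "Re (of_real r * w) = r * Re w" for r w by simp
    ultimately have "exp t * Re (a * cnj b) = - (exp (- t) * (cmod b)\<^sup>2)"
      by (metis Re_complex_of_real)
    moreover have "exp t * Re (a * cnj b) > 0" using pos by simp
    ultimately show False
      by (metis exp_ge_zero less_le_not_le mult_nonneg_nonneg neg_le_0_iff_le zero_le_power2)
  qed
  define p where "p y = y ^ (k - 1) * (1 - y) ^ (k - 1)" for y :: complex
  have "p holomorphic_on UNIV"
    unfolding p_def by (intro holomorphic_intros)
  then obtain P where P: "\<And>y. (P has_field_derivative p y) (at y)"
    using holomorphic_convex_primitive'[of UNIV p] by auto
  have P01: "P 1 - P 0 = of_real ((fact (k - 1))\<^sup>2 / fact (2 * k - 1))"
  proof -
    have "((\<lambda>s. p (of_real s)) has_integral P (of_real 1) - P (of_real 0)) {0..1}"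
    proof (rule fundamental_theorem_of_calculus)
      fix s :: real
      show "((\<lambda>s. P (of_real s)) has_vector_derivative p (of_real s)) (at s within {0..1})"
        by (rule has_vector_derivative_real_field[OF P])
    qed simp
    moreover have "((\<lambda>s. complex_of_real (s ^ (k - 1) * (1 - s) ^ (k - 1))) has_integral
        of_real (fact (k - 1) * fact (k - 1) / fact (k - 1 + (k - 1) + 1))) {0..1}"
      using has_integral_linear[OF has_integral_beta_nat[of "k - 1" "k - 1"] bounded_linear_of_real[where 'a = complex]]
      unfolding o_def .
    moreover have "p (of_real s) = complex_of_real (s ^ (k - 1) * (1 - s) ^ (k - 1))" for s
      by (simp add: p_def)
    moreover have "k - 1 + (k - 1) + 1 = 2 * k - 1" using k by simp
    ultimately show ?thesis
      using has_integral_unique by (simp only: power2_eq_square of_real_0 of_real_1) blast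
  qed
  define y where "y t = of_real (exp t) * a / E t" for t
  define \<Phi> where "\<Phi> t = 2 ^ (2 * k - 1) * inverse ((a * b) ^ k) * (P (y t) - P 0)" for t
  have \<Phi>': "(\<Phi> has_vector_derivative inverse ((E t / 2) ^ (2 * k))) (at t within S)" for t S
  proof -
    define Ec where "Ec z = exp z * a + exp (- z) * b" for z
    define yc where "yc z = exp z * a / Ec z" for z
    have Et: "Ec (of_real t) = E t" for t
      by (simp add: Ec_def E_def exp_of_real[symmetric])
    have yt: "yc (of_real t) = y t" for t
      by (simp add: yc_def y_def Et exp_of_real)
    let ?z = "complex_of_real t"
    have nz: "Ec ?z \<noteq> 0" using E0[of t] Et[of t] by simp
    have ee: "exp ?z * exp (- ?z) = 1" by (simp add: exp_minus_inverse)
    have dE: "(Ec has_field_derivative (exp ?z * a - exp (- ?z) * b)) (at ?z)"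
      unfolding Ec_def by (auto intro!: derivative_eq_intros)
    have num: "exp ?z * a * Ec ?z - exp ?z * a * (exp ?z * a - exp (- ?z) * b) = 2 * (a * b)"
    proof -
      have "exp ?z * a * Ec ?z - exp ?z * a * (exp ?z * a - exp (- ?z) * b) = (exp ?z * exp (- ?z)) * (2 * (a * b))"
        unfolding Ec_def by (simp add: algebra_simps)
      then show ?thesis using ee by simp
    qed
    have dy: "(yc has_field_derivative (2 * (a * b) / (Ec ?z * Ec ?z))) (at ?z)"
      unfolding yc_def num[symmetric] by (rule DERIV_divide) (use dE nz in \<open>auto intro!: derivative_eq_intros\<close>)
    have y1: "yc ?z * (1 - yc ?z) = a * b / (Ec ?z * Ec ?z)"
    proof -
      have "1 - yc ?z = exp (- ?z) * b / Ec ?z"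
        using nz by (simp add: yc_def field_simps) (simp add: Ec_def)
      then have "yc ?z * (1 - yc ?z) = (exp ?z * exp (- ?z)) * (a * b) / (Ec ?z * Ec ?z)"
        by (simp add: yc_def)
      then show ?thesis using ee by simp
    qed
    have "((\<lambda>z. 2 ^ (2 * k - 1) * inverse ((a * b) ^ k) * (P (yc z) - P 0)) has_field_derivative
        2 ^ (2 * k - 1) * inverse ((a * b) ^ k) * (p (yc ?z) * (2 * (a * b) / (Ec ?z * Ec ?z)))) (at ?z)"
      by (rule derivative_eq_intros DERIV_chain2[OF P dy] refl)+ simp
    also have "2 ^ (2 * k - 1) * inverse ((a * b) ^ k) * (p (yc ?z) * (2 * (a * b) / (Ec ?z * Ec ?z)))
        = inverse ((E t / 2) ^ (2 * k))"
    proof -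
      obtain m where m: "k = Suc m" using k by (cases k) auto
      have "p (yc ?z) = (a * b / (Ec ?z * Ec ?z)) ^ m"
        by (simp add: p_def m power_mult_distrib[symmetric] y1)
      then show ?thesis
        using ab E0[of t] by (simp add: Et m power_divide power_mult_distrib power2_eq_square power_mult field_simps)
    qed
    finally have "((\<lambda>t. 2 ^ (2 * k - 1) * inverse ((a * b) ^ k) * (P (yc (of_real t)) - P 0)) has_vector_derivative
        inverse ((E t / 2) ^ (2 * k))) (at t within S)"
      by (rule has_vector_derivative_real_field)
    then show ?thesis by (simp add: yt \<Phi>_def[abs_def])
  qed
  have contP: "isCont P z" for z
    by (rule DERIV_isCont[OF P])
  have y_top: "(y \<longlongrightarrow> 1) at_top"
  proof -
    have eq: "y t = a / (a + of_real (exp (- 2 * t)) * b)" for t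
    proof -
      have "exp (- t) = exp t * exp (- 2 * t)" by (simp add: exp_add[symmetric])
      then have "E t = of_real (exp t) * (a + of_real (exp (- 2 * t)) * b)"
        by (simp add: E_def algebra_simps)
      then show ?thesis by (simp add: y_def)
    qed
    have "((\<lambda>t::real. exp (- 2 * t)) \<longlongrightarrow> 0) at_top"
      by real_asymp
    then have "((\<lambda>t::real. a / (a + of_real (exp (- 2 * t)) * b)) \<longlongrightarrow> a / (a + of_real 0 * b)) at_top"
      using ab by (intro tendsto_intros) auto
    then show ?thesis using ab by (simp add: eq[abs_def])
  qed
  have y_bot: "(y \<longlongrightarrow> 0) at_bot"
  proof -
    have eq: "y t = of_real (exp (2 * t)) * a / (of_real (exp (2 * t)) * a + b)" for t
    proof -
      have "exp t = exp (- t) * exp (2 * t)" by (simp add: exp_add[symmetric])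
      then have "y t = of_real (exp (- t)) * (of_real (exp (2 * t)) * a) / (of_real (exp (- t)) * (of_real (exp (2 * t)) * a + b))"
        by (simp add: y_def E_def algebra_simps)
      then show ?thesis by simp
    qed
    have "((\<lambda>t::real. exp (2 * t)) \<longlongrightarrow> 0) at_bot"
      by real_asymp
    then have "((\<lambda>t::real. of_real (exp (2 * t)) * a / (of_real (exp (2 * t)) * a + b)) \<longlongrightarrow> of_real 0 * a / (of_real 0 * a + b)) at_bot"
      using ab by (intro tendsto_intros) auto
    then show ?thesis by (simp add: eq[abs_def])
  qed
  have "\<forall>s t. s \<le> t \<longrightarrow> ((\<lambda>t. inverse ((E t / 2) ^ (2 * k))) has_integral \<Phi> t - \<Phi> s) {s..t}"
    by (intro allI impI fundamental_theorem_of_calculus \<Phi>')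
  moreover have "(\<Phi> \<longlongrightarrow> 0) at_bot"
  proof -
    have "(\<Phi> \<longlongrightarrow> 2 ^ (2 * k - 1) * inverse ((a * b) ^ k) * (P 0 - P 0)) at_bot"
      unfolding \<Phi>_def by (intro tendsto_intros isCont_tendsto_compose[OF contP y_bot])
    then show ?thesis by simp
  qed
  moreover have "(\<Phi> \<longlongrightarrow> of_real (2 ^ (2 * k - 1) * (fact (k - 1))\<^sup>2 / fact (2 * k - 1)) * inverse ((a * b) ^ k)) at_top"
  proof -
    have "(\<Phi> \<longlongrightarrow> 2 ^ (2 * k - 1) * inverse ((a * b) ^ k) * (P 1 - P 0)) at_top"
      unfolding \<Phi>_def by (intro tendsto_intros isCont_tendsto_compose[OF contP y_top])
    then show ?thesis unfolding P01 by (simp add: field_simps)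
  qed
  ultimately show "\<exists>\<Phi>. (\<forall>s t. s \<le> t \<longrightarrow> ((\<lambda>t. inverse ((E t / 2) ^ (2 * k))) has_integral \<Phi> t - \<Phi> s) {s..t}) \<and>
      (\<Phi> \<longlongrightarrow> 0) at_bot \<and>
      (\<Phi> \<longlongrightarrow> of_real (2 ^ (2 * k - 1) * (fact (k - 1))\<^sup>2 / fact (2 * k - 1)) * inverse ((a * b) ^ k)) at_top"
    by blast
qed

section \<open>Hyperbolic translations and their fixed points\<close>

text \<open>The points \<open>tip 1\<close> and \<open>tip (-1)\<close> are the ends of the standard geodesic.\<close>
definition tip :: "complex \<Rightarrow> complex^'n::{finite,linorder}" where
  "tip s = axis (Max UNIV) s"

lemma a_mat_mult_vec:
  fixes x :: "complex^('n::{finite,linorder} option)"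
  shows "(a_mat t *v x) $ i =
    (if i = Some (Max UNIV) then of_real (cosh t) * x $ i + of_real (sinh t) * x $ None
     else if i = None then of_real (sinh t) * x $ Some (Max UNIV) + of_real (cosh t) * x $ i
     else x $ i)"
proof -
  let ?l = "Some (Max UNIV) :: 'n option"
  have *: "(a_mat t *v x) $ i = (\<Sum>j\<in>{i, ?l, None}. a_mat t $ i $ j * x $ j)"
    unfolding matrix_vector_mult_def vec_lambda_beta
    by (rule sum.mono_neutral_right) (auto simp: a_mat_def Let_def)
  show ?thesis
  proof (cases "i = ?l \<or> i = None")
    case True
    then show ?thesis unfolding * by (auto simp: a_mat_def Let_def insert_commute)
  next
    case False
    then obtain y where "i = Some y" "y \<noteq> Max UNIV" by (cases i) auto
    then show ?thesis
      unfolding * by (simp add: a_mat_def Let_def)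
  qed
qed

lemma a_mat_add: "a_mat (s + t) = (a_mat s ** a_mat t :: complex^('n::{finite,linorder} option)^('n option))"
proof (rule matrix_eq[THEN iffD2], rule allI)
  fix x :: "complex^('n option)"
  show "a_mat (s + t) *v x = a_mat s ** a_mat t *v x"
    by (auto simp: vec_eq_iff a_mat_mult_vec cosh_add sinh_add algebra_simps simp flip: matrix_vector_mul_assoc)
qed

lemma a_mat_0: "a_mat 0 = mat 1"
proof (rule matrix_eq[THEN iffD2], rule allI)
  show "a_mat 0 *v x = mat 1 *v x" for x :: "complex^('a option)"
    by (rule vec_option_eqI) (simp_all add: a_mat_mult_vec)
qed

text \<open>Conjugation by the sign change \<open>D\<close> of the last coordinate turns \<open>a_mat s\<close> into its inverse, so its determinant has square 1;
and \<open>a_mat t\<close> is the square of \<open>a_mat (t / 2)\<close>.\<close>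
lemma det_a_mat: "det (a_mat t :: complex^('n::{finite,linorder} option)^('n option)) = 1"
proof -
  define D :: "complex^('n option)^('n option)" where
    "D = (\<chi> i j. if i = j then (if i = None then -1 else 1) else 0)"
  have D: "(D *v x) $ i = (if i = None then - (x $ i) else x $ i)" for x i
  proof -
    have "(D *v x) $ i = (\<Sum>j\<in>UNIV. if j = i then (if i = None then -1 else 1) * x $ j else 0)"
      unfolding matrix_vector_mult_def vec_lambda_beta by (rule sum.cong) (auto simp: D_def)
    then show ?thesis by simp
  qed
  have "D ** D = mat 1"
  proof (rule matrix_eq[THEN iffD2], rule allI)
    show "D ** D *v x = mat 1 *v x" for x
      unfolding matrix_vector_mul_assoc[symmetric] by (simp add: vec_eq_iff D)
  qed
  from arg_cong[where f = det, OF this] have DD: "det D * det D = 1"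
    by (simp add: det_mul)
  have sq: "det (a_mat s :: complex^('n option)^('n option)) * det (a_mat s :: complex^('n option)^('n option)) = 1" for s
  proof -
    have "a_mat (- s) = D ** a_mat s ** D"
    proof (rule matrix_eq[THEN iffD2], rule allI)
      show "a_mat (- s) *v x = D ** a_mat s ** D *v x" for x
        unfolding matrix_vector_mul_assoc[symmetric] by (simp add: vec_eq_iff D a_mat_mult_vec)
    qed
    then have "det (a_mat (- s) :: complex^('n option)^('n option)) = det (a_mat s :: complex^('n option)^('n option)) * (det D * det D)"
      by (simp add: det_mul)
    moreover have "det (a_mat s ** a_mat (- s) :: complex^('n option)^('n option)) = 1"
      unfolding a_mat_add[symmetric] by (simp add: a_mat_0)
    ultimately show ?thesis
      by (simp add: det_mul DD)
  qed
  have "a_mat t = (a_mat (t / 2) ** a_mat (t / 2) :: complex^('n option)^('n option))"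
    using a_mat_add[of "t / 2" "t / 2", where 'n = 'n] by simp
  then show ?thesis
    by (simp add: det_mul sq)
qed

lemma herm_split:
  fixes x :: "complex^('n::{finite,linorder} option)"
  shows "herm x y = (\<Sum>i\<in>UNIV - {Max UNIV}. x $ Some i * cnj (y $ Some i))
     + x $ Some (Max UNIV) * cnj (y $ Some (Max UNIV)) - x $ None * cnj (y $ None)"
  by (simp add: herm_def sum.remove[of UNIV "Max UNIV"])

lemma a_mat_SU: "a_mat t \<in> carrier (SU :: (complex^('n::{finite,linorder} option)^('n option)) monoid)"
proof -
  have "herm (a_mat t *v x) (a_mat t *v y) = herm x y" for x y :: "complex^('n option)"
  proof -
    let ?c = "complex_of_real (cosh t)" and ?s = "complex_of_real (sinh t)"
    have cs: "?c * ?c - ?s * ?s = 1"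
      using hyperbolic_pythagoras[of t] by (simp add: power2_eq_square flip: of_real_mult of_real_diff)
    have "(?c * a + ?s * b) * cnj (?c * a' + ?s * b') - (?s * a + ?c * b) * cnj (?s * a' + ?c * b')
        = (?c * ?c - ?s * ?s) * (a * cnj a' - b * cnj b')" for a b a' b'
      by (simp add: algebra_simps)
    then have *: "(?c * a + ?s * b) * cnj (?c * a' + ?s * b') - (?s * a + ?c * b) * cnj (?s * a' + ?c * b')
        = a * cnj a' - b * cnj b'" for a b a' b'
      by (simp only: cs mult_1)
    show ?thesis
      unfolding herm_split using *[of "x $ Some (Max UNIV)" "x $ None" "y $ Some (Max UNIV)" "y $ None"]
      by (simp add: a_mat_mult_vec algebra_simps)
  qed
  then show ?thesis
    by (simp add: SU_def det_a_mat)
qed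

lemma tip_nth: "tip s $ i = (if i = Max UNIV then s else 0)"
  by (auto simp: tip_def axis_def)

lemma lift_tip_nth: "lift_pt (tip s) $ i = (if i = None then 1 else if i = Some (Max UNIV) then s else 0)"
  by (cases i) (auto simp: tip_def axis_def)

lemma a_mat_lift_tip:
  assumes "s = 1 \<or> s = -1"
  shows "a_mat t *v lift_pt (tip (of_real s)) = of_real (exp (s * t)) *s lift_pt (tip (of_real s))"
  using assms
  by (auto simp: vec_eq_iff a_mat_mult_vec lift_pt_def tip_nth cosh_def sinh_def field_simps simp flip: of_real_add of_real_diff)

lemma herm_lift_tip: "herm x (lift_pt (tip s)) = x $ Some (Max UNIV) * cnj s - x $ None"
proof -
  have "(\<Sum>i\<in>UNIV. x $ Some i * cnj (lift_pt (tip s) $ Some i)) = (\<Sum>i\<in>UNIV. if i = Max UNIV then x $ Some i * cnj s else 0)"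
    by (intro sum.cong) (auto simp: lift_tip_nth simp del: lift_pt_Some)
  then show ?thesis
    by (simp add: herm_def del: lift_pt_Some)
qed

lemma norm_tip: "norm (tip s :: complex^'n::{finite,linorder}) = cmod s"
proof -
  have "(cmod ((tip s :: (complex, 'n) vec) $ i))\<^sup>2 = (if i = Max UNIV then (cmod s)\<^sup>2 else 0)" for i
    by (simp add: tip_nth)
  then have "(norm (tip s :: (complex, 'n) vec))\<^sup>2 = (cmod s)\<^sup>2"
    unfolding norm_vec_power2 by simp
  then show ?thesis by simp
qed

lemma tip_sphere: "cmod s = 1 \<Longrightarrow> tip s \<in> sphere 0 1"
  by (simp add: norm_tip)

lemma tendsto_proj_pt:
  assumes "(f \<longlongrightarrow> v) F" "v $ None \<noteq> 0"
  shows "((\<lambda>x. proj_pt (f x)) \<longlongrightarrow> proj_pt v) F"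
  unfolding proj_pt_def using assms by (intro tendsto_vec_lambda tendsto_intros)

lemma tendsto_mult_vec:
  assumes "(f \<longlongrightarrow> v) F"
  shows "((\<lambda>x. (g :: complex^'a^'b) *v f x) \<longlongrightarrow> g *v v) F"
  using linear_matrix_vector_complex[of g] assms
  by (simp add: bounded_linear.tendsto linear_conv_bounded_linear)

lemma tendsto_scale_vec:
  assumes "(f \<longlongrightarrow> c) F" "(h \<longlongrightarrow> v) F"
  shows "((\<lambda>x. f x *s (h x :: complex^'k)) \<longlongrightarrow> c *s v) F"
  unfolding vector_scalar_mult_def using assms by (intro tendsto_vec_lambda tendsto_intros)

lemma vec_scale_add: "(a + b) *s (x :: complex^'k) = a *s x + b *s x" "a *s (x + y) = a *s x + a *s (y :: complex^'k)"
  by (simp_all add: vec_eq_iff algebra_simps)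

lemma act_proj_pt:
  assumes "v $ None \<noteq> 0"
  shows "act g (proj_pt v) = proj_pt (g *v v)"
  using assms by (simp add: act_eq_proj_pt lift_proj_pt proj_pt_scale vector_scalar_commute)

lemma negative_None_neq_0:
  assumes "Re (herm v v) < 0"
  shows "v $ None \<noteq> 0"
proof (rule None_coord_neq_0)
  show "v \<noteq> 0"
  proof
    assume "v = 0"
    then have "herm v v = 0" by (simp add: herm_def)
    with assms show False by simp
  qed
qed (use assms in simp)

text \<open>The property by which \<open>attracting_pt\<close> is selected.\<close>
definition attracts :: "complex^('n::finite option)^('n option) \<Rightarrow> complex^'n \<Rightarrow> bool" where
  "attracts \<gamma> Y \<longleftrightarrow> Y \<in> sphere 0 1 \<and> act \<gamma> Y = Y \<and> (\<forall>z\<in>ball 0 1. (\<lambda>m. (act \<gamma> ^^ m) z) \<longlonglongrightarrow> Y)"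

lemma attracting_pt_eq:
  assumes "attracts \<gamma> Y"
  shows "attracting_pt \<gamma> = Y"
  unfolding attracting_pt_def attracts_def[symmetric]
proof (rule the_equality)
  fix Y' assume "attracts \<gamma> Y'"
  then have "(\<lambda>m. (act \<gamma> ^^ m) 0) \<longlonglongrightarrow> Y'"
    by (simp add: attracts_def)
  moreover have "(\<lambda>m. (act \<gamma> ^^ m) 0) \<longlonglongrightarrow> Y"
    using assms by (simp add: attracts_def)
  ultimately show "Y' = Y" by (rule LIMSEQ_unique)
qed fact

text \<open>Decompose the lift of a point of the ball along the eigenvectors \<open>p\<close> and \<open>q\<close> and their orthogonal complement. On the
complement the form is positive definite, so the iterates stay bounded there; the eigenvalue at \<open>q\<close> has modulus below 1,
as the product of one eigenvalue with the conjugate of the other is 1. After division by the power of the dominant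
eigenvalue only the component along \<open>p\<close> survives, and it is nonzero for points of the open ball. The sign \<open>s\<close> lets
the lemma apply to an element and to its inverse.\<close>
lemma hyperbolic_attracts:
  fixes \<gamma> g :: "complex^('n::{finite,linorder} option)^('n option)" and s :: real
  assumes \<gamma>: "\<gamma> \<in> carrier SU" and g: "g \<in> carrier SU" and s: "s = 1 \<or> s = -1"
    and P: "\<gamma> *v (g *v lift_pt (tip (of_real s))) = \<nu> *s (g *v lift_pt (tip (of_real s)))"
    and Q: "\<gamma> *v (g *v lift_pt (tip (of_real (- s)))) = \<mu> *s (g *v lift_pt (tip (of_real (- s))))"
    and \<nu>: "cmod \<nu> > 1"
  shows "attracts \<gamma> (act g (tip (of_real s)))"
proof -
  let ?p = "lift_pt (tip (of_real s)) :: complex^('n option)"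
  let ?q = "lift_pt (tip (of_real (- s))) :: complex^('n option)"
  let ?l = "Max UNIV :: 'n"
  have \<nu>0: "\<nu> \<noteq> 0" using \<nu> by auto
  have ss: "complex_of_real s * of_real s = 1" using s by auto
  define h where "h = inv\<^bsub>SU\<^esub> g ** \<gamma> ** g"
  have h: "h \<in> carrier SU" unfolding h_def by (intro SU_mult_closed SU_inv_closed g \<gamma>)
  have gi: "inv\<^bsub>SU\<^esub> g *v (g *v x) = x" "g *v (inv\<^bsub>SU\<^esub> g *v x) = x" for x
    by (simp_all add: matrix_vector_mul_assoc SU_inv_mul[OF g])
  have gh: "g *v (h *v x) = \<gamma> *v (g *v x)" for x
    by (simp add: h_def gi flip: matrix_vector_mul_assoc)
  have hp: "h *v ?p = \<nu> *s ?p"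
    using gi(1)[of "h *v ?p"] by (simp add: gh P vector_scalar_commute gi)
  have hq: "h *v ?q = \<mu> *s ?q"
    using gi(1)[of "h *v ?q"] by (simp only: gh Q vector_scalar_commute gi)
  have pq: "herm ?p ?q = -2"
    using ss by (simp add: herm_lift_tip lift_tip_nth del: lift_pt_Some)
  have "\<nu> * cnj \<mu> * herm ?p ?q = herm ?p ?q"
    using SU_herm[OF h, of ?p ?q] unfolding hp hq by (simp only: herm_scale_left herm_scale_right mult_ac)
  then have \<nu>\<mu>: "\<nu> * cnj \<mu> = 1" unfolding pq by simp
  then have "cmod \<nu> * cmod \<mu> = 1" by (metis complex_mod_cnj norm_mult norm_one)
  then have "cmod \<mu> = 1 / cmod \<nu>"
    using \<nu>0 by (simp add: field_simps)
  then have \<mu>1: "cmod \<mu> < 1"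
    using \<nu> by (simp add: divide_less_eq)
  define S where "S m = ((*v) h ^^ m)" for m
  have S_Suc: "S (Suc m) x = h *v S m x" for m x by (simp add: S_def)
  have S0: "S 0 x = x" for x by (simp add: S_def)
  have Sp: "S m (c *s ?p) = (\<nu> ^ m * c) *s ?p" for m c
    by (induction m) (simp_all add: S_Suc S0 vector_scalar_commute hp vector_smult_assoc mult_ac)
  have Sq: "S m (c *s ?q) = (\<mu> ^ m * c) *s ?q" for m c
    by (induction m) (simp_all add: S_Suc S0 vector_scalar_commute hq[unfolded of_real_minus] vector_smult_assoc mult_ac)
  have S_add: "S m (x + y) = S m x + S m y" for m x y
    by (induction m) (simp_all add: S_Suc S0 matrix_vector_right_distrib)
  have S_herm: "herm (S m x) (S m y) = herm x y" for m x y
    by (induction m) (simp_all add: S_Suc S0 SU_herm[OF h])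
  have \<mu>0: "\<mu> \<noteq> 0" using \<nu>\<mu> by auto
  have coords: "x $ None = 0 \<and> x $ Some ?l = 0" if "herm x ?p = 0" "herm x ?q = 0" for x
  proof -
    have "x $ Some ?l * s - x $ None = 0" "- (x $ Some ?l * s) - x $ None = 0"
      using that by (simp_all add: herm_lift_tip)
    then have "x $ None = 0 \<and> x $ Some ?l * s = 0" by algebra
    then show ?thesis using s by auto
  qed
  have bound: "norm (S m r) = norm r" if r: "herm r ?p = 0" "herm r ?q = 0" for m r
  proof -
    have "herm (S m r) (S m (1 *s ?p)) = 0" "herm (S m r) (S m (1 *s ?q)) = 0"
      unfolding S_herm using r by simp_all
    then have "herm (S m r) ?p = 0" "herm (S m r) ?q = 0"
      unfolding Sp Sq herm_scale_right using \<nu>0 \<mu>0 by simp_all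
    then have "S m r $ None = 0" "r $ None = 0"
      using coords r by blast+
    then have "(norm (S m r))\<^sup>2 = (norm r)\<^sup>2"
      by (simp add: norm_herm S_herm)
    then show ?thesis by simp
  qed
  have lim: "(\<lambda>m. (act \<gamma> ^^ m) z) \<longlonglongrightarrow> act g (tip (of_real s))" if z: "z \<in> ball 0 1" for z
  proof -
    define w where "w = act (inv\<^bsub>SU\<^esub> g) z"
    have w: "w \<in> ball 0 1" unfolding w_def by (intro act_in_ball SU_inv_closed g z)
    have z_eq: "z = act g w"
      unfolding w_def using act_inv_act(2)[OF g] z by auto
    define a where "a = (1 + s * w $ ?l) / 2"
    define b where "b = (1 - s * w $ ?l) / 2"
    define r where "r = lift_pt w - (a *s ?p + b *s ?q)"
    have r0: "r $ None = 0" "r $ Some ?l = 0"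
      using ss by (simp_all add: r_def a_def b_def lift_tip_nth field_simps del: lift_pt_Some)
         (simp_all add: algebra_simps)
    then have r: "herm r ?p = 0" "herm r ?q = 0"
      by (simp_all add: herm_lift_tip)
    have dec: "lift_pt w = a *s ?p + b *s ?q + r" by (simp add: r_def)
    have "cmod (w $ ?l) < 1"
      using Finite_Cartesian_Product.norm_nth_le[of w ?l] w by simp
    then have "cmod (s * w $ ?l) < 1" using s by (auto simp: norm_mult)
    then have a0: "a \<noteq> 0"
      unfolding a_def by (metis add_eq_0_iff2 divide_eq_0_iff less_irrefl norm_minus_cancel norm_one zero_neq_numeral)
    have it: "(act \<gamma> ^^ m) z = proj_pt (g *v S m (lift_pt w)) \<and> (g *v S m (lift_pt w)) $ None \<noteq> 0" for m
    proof (induction m)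
      case 0
      have "w \<in> cball 0 1" using w by auto
      then show ?case
        using SU_denominator_neq_0[OF g] by (simp add: z_eq act_eq_proj_pt S0)
    next
      case (Suc m)
      have "herm (g *v S (Suc m) (lift_pt w)) (g *v S (Suc m) (lift_pt w)) = herm (lift_pt w) (lift_pt w)"
        by (simp only: SU_herm[OF g] S_herm)
      moreover have "Re (herm (lift_pt w) (lift_pt w)) < 0"
        using w by (simp add: Re_herm_lift abs_square_less_1)
      ultimately have "(g *v S (Suc m) (lift_pt w)) $ None \<noteq> 0"
        by (intro negative_None_neq_0) (simp only:)
      then show ?case
        using Suc by (simp add: act_proj_pt S_Suc gh)
    qed
    have "(\<lambda>m. a *s ?p + ((\<mu> / \<nu>) ^ m * b) *s ?q + (1 / \<nu>) ^ m *s S m r) \<longlonglongrightarrow> a *s ?p + (0 * b) *s ?q + 0"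
    proof (intro tendsto_add tendsto_const tendsto_scale_vec tendsto_mult)
      have "cmod (\<mu> / \<nu>) < 1"
        using \<mu>1 \<nu> by (simp add: norm_divide divide_less_eq)
      then show "(\<lambda>m. (\<mu> / \<nu>) ^ m) \<longlonglongrightarrow> 0" by (rule LIMSEQ_power_zero)
      show "(\<lambda>m. (1 / \<nu>) ^ m *s S m r) \<longlonglongrightarrow> 0"
      proof (rule tendsto_norm_zero_cancel)
        have "(\<lambda>m. (1 / cmod \<nu>) ^ m * norm r) \<longlonglongrightarrow> 0 * norm r"
          using \<nu> by (intro tendsto_intros LIMSEQ_realpow_zero) (auto simp: divide_less_eq)
        then show "(\<lambda>m. norm ((1 / \<nu>) ^ m *s S m r)) \<longlonglongrightarrow> 0"
          by (simp add: norm_scale_vec bound[OF r] norm_power norm_divide)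
      qed
    qed
    moreover have "a *s ?p + ((\<mu> / \<nu>) ^ m * b) *s ?q + (1 / \<nu>) ^ m *s S m r = (1 / \<nu>) ^ m *s S m (lift_pt w)" for m
      using \<nu>0 by (simp only: dec S_add Sp Sq vec_scale_add vector_smult_assoc) (simp add: power_divide)
    ultimately have "(\<lambda>m. (1 / \<nu>) ^ m *s S m (lift_pt w)) \<longlonglongrightarrow> a *s ?p"
      by simp
    then have "(\<lambda>m. g *v ((1 / \<nu>) ^ m *s S m (lift_pt w))) \<longlonglongrightarrow> g *v (a *s ?p)"
      by (rule tendsto_mult_vec)
    moreover have "(g *v (a *s ?p)) $ None \<noteq> 0"
    proof -
      have "(g *v ?p) $ None \<noteq> 0"
        using s by (intro SU_denominator_neq_0[OF g]) (auto simp: norm_tip)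
      then show ?thesis using a0 by (simp add: vector_scalar_commute)
    qed
    ultimately have "(\<lambda>m. proj_pt (g *v ((1 / \<nu>) ^ m *s S m (lift_pt w)))) \<longlonglongrightarrow> proj_pt (g *v (a *s ?p))"
      by (rule tendsto_proj_pt)
    then show ?thesis
      using a0 \<nu>0 by (simp add: vector_scalar_commute proj_pt_scale it act_eq_proj_pt[of g])
  qed
  have "act g (tip (of_real s)) \<in> sphere 0 1"
    using s by (intro act_in_sphere[OF g] tip_sphere) auto
  moreover have "act \<gamma> (act g (tip (of_real s))) = act g (tip (of_real s))"
  proof -
    have "(g *v ?p) $ None \<noteq> 0"
      using s by (intro SU_denominator_neq_0[OF g]) (auto simp: norm_tip)
    then show ?thesis
      using \<nu>0 by (simp add: act_eq_proj_pt[of g] act_proj_pt P proj_pt_scale)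
  qed
  ultimately show ?thesis
    using lim by (simp add: attracts_def)
qed

text \<open>Commuting with \<open>a_mat 1\<close> means preserving its eigenspaces, and those for \<open>e\<close> and \<open>1/e\<close> are lines.\<close>
lemma commuting_eigenvector:
  fixes h :: "complex^('n::{finite,linorder} option)^('n option)" and s :: real
  assumes s: "s = 1 \<or> s = -1" and comm: "\<And>t. h ** a_mat t = a_mat t ** h"
  shows "\<exists>\<nu>. h *v lift_pt (tip (of_real s)) = \<nu> *s lift_pt (tip (of_real s))"
proof -
  let ?p = "lift_pt (tip (of_real s)) :: complex^('n option)"
  let ?l = "Max UNIV :: 'n"
  define x where "x = h *v ?p"
  have "a_mat 1 *v x = of_real (exp (s * 1)) *s x"
    unfolding x_def matrix_vector_mul_assoc comm[symmetric]
    by (simp only: a_mat_lift_tip[OF s] vector_scalar_commute flip: matrix_vector_mul_assoc)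
  then have eq: "(a_mat 1 *v x) $ i = of_real (exp s) * x $ i" for i
    by simp
  have e1: "exp s \<noteq> 1" using s by auto
  have other: "x $ Some j = 0" if "j \<noteq> ?l" for j
  proof -
    have "x $ Some j = of_real (exp s) * x $ Some j"
      using eq[of "Some j"] that by (simp add: a_mat_mult_vec)
    then have "(1 - complex_of_real (exp s)) * x $ Some j = 0"
      by (simp add: algebra_simps)
    moreover have "1 - complex_of_real (exp s) \<noteq> 0"
      using e1 by (metis eq_iff_diff_eq_0 of_real_1 of_real_eq_iff)
    ultimately show ?thesis by simp
  qed
  have N: "of_real (sinh 1) * x $ Some ?l + of_real (cosh 1) * x $ None = of_real (exp s) * x $ None"
    using eq[of None] by (simp add: a_mat_mult_vec)
  have es: "exp s = cosh 1 + s * sinh 1"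
    using s by (auto simp: cosh_plus_sinh cosh_minus_sinh)
  have "of_real (sinh 1) * (x $ Some ?l - of_real s * x $ None) = 0"
    using N unfolding es by (simp add: algebra_simps)
  moreover have "sinh (1::real) \<noteq> 0" by simp
  ultimately have "x $ Some ?l = of_real s * x $ None"
    by simp
  then have "x = (x $ None) *s ?p"
    using other by (intro vec_option_eqI) (auto simp: tip_nth)
  then show ?thesis unfolding x_def by blast
qed

lemma herm_opposite_tips: "s = 1 \<or> s = -1 \<Longrightarrow> herm (lift_pt (tip (of_real s))) (lift_pt (tip (of_real (- s)))) = -2"
  by (auto simp: herm_lift_tip tip_nth)

lemma tip_mid: "lift_pt 0 = (1/2) *s lift_pt (tip 1) + (1/2) *s lift_pt (tip (-1))"
  by (rule vec_option_eqI) (auto simp: tip_nth)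

text \<open>The eigenvalues \<open>\<nu>\<close> and \<open>\<mu>\<close> on the two lines satisfy \<open>\<nu> cnj \<mu> = 1\<close>. If both had modulus 1 they would be equal, and the
midpoint of the geodesic would be fixed, which makes the element elliptic. Otherwise one of them has modulus above 1
and the other takes its place for the inverse.\<close>
lemma loxodromic_attracts:
  fixes \<gamma> :: "complex^('n::{finite,linorder} option)^('n option)"
  assumes \<gamma>: "\<gamma> \<in> carrier SU" and lox: "loxodromic \<gamma>"
  shows "attracts \<gamma> (attracting_pt \<gamma>)" and "attracts (inv\<^bsub>SU\<^esub> \<gamma>) (repelling_pt \<gamma>)"
proof -
  obtain g h where g: "g \<in> carrier SU" and h: "h \<in> carrier SU"
    and comm: "\<And>t. h ** a_mat t = a_mat t ** h" and \<gamma>_eq: "\<gamma> = g ** h ** inv\<^bsub>SU\<^esub> g" and nell: "\<not> elliptic \<gamma>"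
    using lox unfolding loxodromic_def by blast
  let ?p = "lift_pt (tip 1) :: complex^('n option)"
  let ?q = "lift_pt (tip (-1)) :: complex^('n option)"
  obtain \<nu> where p: "h *v ?p = \<nu> *s ?p"
    using commuting_eigenvector[of 1 h] comm by auto
  obtain \<mu> where q: "h *v ?q = \<mu> *s ?q"
    using commuting_eigenvector[of "-1" h] comm by auto
  have pq: "herm ?p ?q = -2"
    using herm_opposite_tips[of 1, where 'a = 'n] by simp
  have "\<nu> * cnj \<mu> * herm ?p ?q = herm ?p ?q"
    using SU_herm[OF h, of ?p ?q] unfolding p q by (simp only: herm_scale_left herm_scale_right mult_ac)
  then have \<nu>\<mu>: "\<nu> * cnj \<mu> = 1" unfolding pq by simp
  then have n0: "\<nu> \<noteq> 0" "\<mu> \<noteq> 0" by auto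
  have gi: "inv\<^bsub>SU\<^esub> g *v (g *v x) = x" for x
    by (simp add: matrix_vector_mul_assoc SU_inv_mul[OF g])
  have P: "\<gamma> *v (g *v ?p) = \<nu> *s (g *v ?p)" and Q: "\<gamma> *v (g *v ?q) = \<mu> *s (g *v ?q)"
    by (simp_all add: \<gamma>_eq p q gi vector_scalar_commute flip: matrix_vector_mul_assoc)
  have inv_eig: "inv\<^bsub>SU\<^esub> \<gamma> *v y = (1 / c) *s y" if "\<gamma> *v y = c *s y" "c \<noteq> 0" for y c
  proof -
    have "inv\<^bsub>SU\<^esub> \<gamma> *v (\<gamma> *v y) = y"
      by (simp add: matrix_vector_mul_assoc SU_inv_mul[OF \<gamma>])
    then have "c *s (inv\<^bsub>SU\<^esub> \<gamma> *v y) = y"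
      unfolding that(1) vector_scalar_commute .
    then have "(1 / c) *s (c *s (inv\<^bsub>SU\<^esub> \<gamma> *v y)) = (1 / c) *s y" by simp
    then show ?thesis using that(2) by (simp add: vector_smult_assoc)
  qed
  note iP = inv_eig[OF P n0(1)] and iQ = inv_eig[OF Q n0(2)]
  note \<gamma>i = SU_inv_closed[OF \<gamma>]
  have norms: "cmod \<nu> * cmod \<mu> = 1"
    using arg_cong[where f = cmod, OF \<nu>\<mu>] by (simp add: norm_mult)
  have "cmod \<nu> \<noteq> 1"
  proof
    assume 1: "cmod \<nu> = 1"
    have "\<nu> * cnj \<nu> = 1" using 1 by (simp add: complex_norm_square[symmetric])
    then have "cnj \<mu> = cnj \<nu>" using \<nu>\<mu> n0 by (metis mult_cancel_left)
    then have "\<mu> = \<nu>" by simp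
    then have "h *v lift_pt 0 = \<nu> *s lift_pt 0"
      by (simp add: tip_mid matrix_vector_right_distrib vector_scalar_commute p q vec_scale_add vector_smult_assoc mult.commute)
    then have "\<gamma> *v (g *v lift_pt 0) = \<nu> *s (g *v lift_pt 0)"
      by (simp add: \<gamma>_eq gi vector_scalar_commute flip: matrix_vector_mul_assoc)
    moreover have "(g *v lift_pt 0) $ None \<noteq> 0"
      by (rule SU_denominator_neq_0[OF g]) simp
    ultimately have "act \<gamma> (act g 0) = act g 0"
      using n0 by (simp add: act_eq_proj_pt[of g] act_proj_pt proj_pt_scale)
    moreover have "act g 0 \<in> ball 0 1"
      by (rule act_in_ball[OF g]) simp
    ultimately have "elliptic \<gamma>"
      unfolding elliptic_def using \<gamma> by blast
    with nell show False ..
  qed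
  then consider "cmod \<nu> > 1" | "cmod \<nu> < 1" by linarith
  moreover have m: "cmod \<mu> = 1 / cmod \<nu>"
    using norms n0(1) by (simp add: field_simps)
  ultimately have "\<exists>Y X. attracts \<gamma> Y \<and> attracts (inv\<^bsub>SU\<^esub> \<gamma>) X"
  proof cases
    case 1
    then have "cmod (1 / \<mu>) > 1"
      by (simp add: norm_divide m)
    then have "attracts (inv\<^bsub>SU\<^esub> \<gamma>) (act g (tip (of_real (-1))))"
      using hyperbolic_attracts[OF \<gamma>i g, of "-1" "1 / \<mu>" "1 / \<nu>"] iP iQ by simp
    moreover have "attracts \<gamma> (act g (tip (of_real 1)))"
      using hyperbolic_attracts[OF \<gamma> g, of 1 \<nu> \<mu>] P Q 1 by simp
    ultimately show ?thesis by blast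
  next
    case 2
    then have 3: "cmod \<mu> > 1" "cmod (1 / \<nu>) > 1"
      using n0 by (simp_all add: m norm_divide less_divide_eq)
    then have "attracts (inv\<^bsub>SU\<^esub> \<gamma>) (act g (tip (of_real 1)))"
      using hyperbolic_attracts[OF \<gamma>i g, of 1 "1 / \<nu>" "1 / \<mu>"] iP iQ by simp
    moreover have "attracts \<gamma> (act g (tip (of_real (-1))))"
      using hyperbolic_attracts[OF \<gamma> g, of "-1" \<mu> \<nu>] P Q 3 by simp
    ultimately show ?thesis by blast
  qed
  then obtain Y X where "attracts \<gamma> Y" "attracts (inv\<^bsub>SU\<^esub> \<gamma>) X" by blast
  then show "attracts \<gamma> (attracting_pt \<gamma>)" "attracts (inv\<^bsub>SU\<^esub> \<gamma>) (repelling_pt \<gamma>)"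
    unfolding repelling_pt_def by (simp_all add: attracting_pt_eq)
qed

text \<open>A homogeneous vector over \<open>geodesic g t\<close>, normalized to norm -1.\<close>
definition axis_vec :: "complex^('n::{finite,linorder} option)^('n option) \<Rightarrow> real \<Rightarrow> complex^('n option)" where
  "axis_vec g t = (g ** a_mat t) *v lift_pt 0"

lemma axis_vec_eq:
  fixes g :: "complex^('n::{finite,linorder} option)^('n option)"
  shows "axis_vec g t = of_real (exp t / 2) *s (g *v lift_pt (tip 1)) + of_real (exp (- t) / 2) *s (g *v lift_pt (tip (-1)))"
proof -
  have "a_mat t *v (lift_pt 0 :: complex^('n option)) = of_real (exp t / 2) *s lift_pt (tip 1) + of_real (exp (- t) / 2) *s lift_pt (tip (-1))"
    using a_mat_lift_tip[of 1 t, where 'a = 'n] a_mat_lift_tip[of "-1" t, where 'a = 'n]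
    by (simp add: tip_mid matrix_vector_right_distrib vector_scalar_commute vector_smult_assoc)
  then show ?thesis
    by (simp add: axis_vec_def matrix_vector_right_distrib vector_scalar_commute flip: matrix_vector_mul_assoc)
qed

lemma geodesic_eq:
  assumes g: "g \<in> carrier SU"
  shows "geodesic g t = act (g ** a_mat t) 0" and "geodesic g t = proj_pt (axis_vec g t)"
    and "axis_vec g t $ None \<noteq> 0"
proof -
  show 1: "geodesic g t = act (g ** a_mat t) 0"
    unfolding geodesic_def by (rule act_mult[symmetric, OF a_mat_SU]) simp
  show "geodesic g t = proj_pt (axis_vec g t)"
    unfolding 1 axis_vec_def by (rule act_eq_proj_pt)
  show "axis_vec g t $ None \<noteq> 0"
    unfolding axis_vec_def by (rule SU_denominator_neq_0[OF SU_mult_closed[OF g a_mat_SU]]) simp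
qed

lemma geodesic_limits:
  assumes g: "g \<in> carrier SU"
  shows "(geodesic g \<longlongrightarrow> act g (tip 1)) at_top" and "(geodesic g \<longlongrightarrow> act g (tip (-1))) at_bot"
proof -
  let ?p = "g *v lift_pt (tip 1)" and ?q = "g *v lift_pt (tip (-1))"
  have nz: "?p $ None \<noteq> 0" "?q $ None \<noteq> 0"
    by (rule SU_denominator_neq_0[OF g], simp add: norm_tip)+
  have eq1: "geodesic g t = proj_pt (?p + of_real (exp (- 2 * t)) *s ?q)" for t
  proof -
    have "exp (- t) = exp t * exp (- 2 * t)" by (simp add: exp_add[symmetric])
    then have "axis_vec g t = of_real (exp t / 2) *s (?p + of_real (exp (- 2 * t)) *s ?q)"
      by (simp add: axis_vec_eq vec_scale_add vector_smult_assoc)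
    then show ?thesis
      unfolding geodesic_eq(2)[OF g] by (simp only:) (rule proj_pt_scale, simp)
  qed
  have "((\<lambda>t::real. exp (- 2 * t)) \<longlongrightarrow> 0) at_top" by real_asymp
  then have "((\<lambda>t. ?p + of_real (exp (- 2 * t)) *s ?q) \<longlongrightarrow> ?p + of_real 0 *s ?q) at_top"
    by (intro tendsto_add tendsto_const tendsto_scale_vec tendsto_of_real)
  then have "((\<lambda>t. ?p + of_real (exp (- 2 * t)) *s ?q) \<longlongrightarrow> ?p) at_top" by simp
  from tendsto_proj_pt[OF this nz(1)] show "(geodesic g \<longlongrightarrow> act g (tip 1)) at_top"
    by (simp add: eq1[abs_def] act_eq_proj_pt)
  have eq2: "geodesic g t = proj_pt (of_real (exp (2 * t)) *s ?p + ?q)" for t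
  proof -
    have "exp t = exp (- t) * exp (2 * t)" by (simp add: exp_add[symmetric])
    then have "axis_vec g t = of_real (exp (- t) / 2) *s (of_real (exp (2 * t)) *s ?p + ?q)"
      by (simp add: axis_vec_eq vec_scale_add vector_smult_assoc)
    then show ?thesis
      unfolding geodesic_eq(2)[OF g] by (simp only:) (rule proj_pt_scale, simp)
  qed
  have "((\<lambda>t::real. exp (2 * t)) \<longlongrightarrow> 0) at_bot" by real_asymp
  then have "((\<lambda>t. of_real (exp (2 * t)) *s ?p + ?q) \<longlongrightarrow> of_real 0 *s ?p + ?q) at_bot"
    by (intro tendsto_add tendsto_const tendsto_scale_vec tendsto_of_real)
  then have "((\<lambda>t. of_real (exp (2 * t)) *s ?p + ?q) \<longlongrightarrow> ?q) at_bot" by simp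
  from tendsto_proj_pt[OF this nz(2)] show "(geodesic g \<longlongrightarrow> act g (tip (-1))) at_bot"
    by (simp add: eq2[abs_def] act_eq_proj_pt)
qed

section \<open>The translation along the axis\<close>

lemma fixed_point_eigenvector:
  assumes \<gamma>: "\<gamma> \<in> carrier SU" and y: "y \<in> cball 0 1" and fixp: "act \<gamma> y = y"
  shows "\<gamma> *v lift_pt y = inverse (autj \<gamma> y) *s lift_pt y"
proof -
  have "lift_pt y = autj \<gamma> y *s (\<gamma> *v lift_pt y)"
    using lift_act[OF \<gamma> y] fixp by simp
  then have "inverse (autj \<gamma> y) *s lift_pt y = inverse (autj \<gamma> y) *s (autj \<gamma> y *s (\<gamma> *v lift_pt y))"
    by simp
  then show ?thesis
    using autj_neq_0[OF \<gamma> y] by (simp add: vector_smult_assoc)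
qed

lemma axis_coords_unique:
  assumes g: "g \<in> carrier SU"
    and eq: "a *s (g *v lift_pt (tip 1)) + b *s (g *v lift_pt (tip (-1)))
           = a' *s (g *v lift_pt (tip 1)) + b' *s (g *v lift_pt (tip (-1)))"
  shows "a = a'" "b = b'"
proof -
  have h: "herm (lift_pt (tip 1)) (lift_pt (tip 1)) = 0" "herm (lift_pt (tip (-1))) (lift_pt (tip (-1))) = 0"
    "herm (lift_pt (tip 1)) (lift_pt (tip (-1))) = -2" "herm (lift_pt (tip (-1))) (lift_pt (tip 1)) = -2"
    by (simp_all add: herm_lift_tip tip_nth)
  have "herm (x *s (g *v lift_pt (tip 1)) + y *s (g *v lift_pt (tip (-1)))) (g *v lift_pt (tip (-1))) = - 2 * x" for x y
    by (simp add: herm_add_left herm_scale_left SU_herm[OF g] h)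
  then show "a = a'" using arg_cong[where f = "\<lambda>v. herm v (g *v lift_pt (tip (-1)))", OF eq] by simp
  have "herm (x *s (g *v lift_pt (tip 1)) + y *s (g *v lift_pt (tip (-1)))) (g *v lift_pt (tip 1)) = - 2 * y" for x y
    by (simp add: herm_add_left herm_scale_left SU_herm[OF g] h)
  then show "b = b'" using arg_cong[where f = "\<lambda>v. herm v (g *v lift_pt (tip 1))", OF eq] by simp
qed

lemma axis_vec_proportional:
  assumes g: "g \<in> carrier SU" and eq: "c *s axis_vec g s = d *s axis_vec g t" and c: "c \<noteq> 0"
  shows "s = t"
proof -
  have "(c * of_real (exp s / 2)) *s (g *v lift_pt (tip 1)) + (c * of_real (exp (- s) / 2)) *s (g *v lift_pt (tip (-1)))
      = (d * of_real (exp t / 2)) *s (g *v lift_pt (tip 1)) + (d * of_real (exp (- t) / 2)) *s (g *v lift_pt (tip (-1)))"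
    using eq by (simp add: axis_vec_eq vec_scale_add vector_smult_assoc)
  from axis_coords_unique[OF g this]
  have 1: "c * of_real (exp s) = d * of_real (exp t)" and 2: "c * of_real (exp (- s)) = d * of_real (exp (- t))"
    by simp_all
  have "c * of_real (exp s) * of_real (exp (- t)) = d * of_real (exp t) * of_real (exp (- t))"
    using 1 by simp
  also have "\<dots> = c * of_real (exp (- s)) * of_real (exp t)"
    using 2 by simp
  finally have "complex_of_real (exp s * exp (- t)) = of_real (exp (- s) * exp t)"
    using c by simp
  then have "exp (s - t) = exp (t - s)"
    by (simp only: of_real_eq_iff exp_add[symmetric]) simp
  then show ?thesis by simp
qed

text \<open>The limits of the geodesic are the fixed points, so the two null vectors over them are eigenvectors of \<open>\<gamma>\<close>, with
eigenvalues \<open>\<nu>\<close> and \<open>\<mu>\<close>. That one point of the axis moves by \<open>T = t1 - t0\<close> forces \<open>\<nu> = c e\<^sup>T\<close> and \<open>\<mu> = c e\<^sup>-\<^sup>T\<close>; then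
\<open>\<nu> cnj \<mu> = 1\<close> makes \<open>c\<close> a phase. The translation is positive, for otherwise the iterates of a point of the axis would not
converge to the attracting point.\<close>
lemma axis_translation:
  fixes \<gamma> g :: "complex^('n::{finite,linorder} option)^('n option)"
  assumes \<gamma>: "\<gamma> \<in> carrier SU" and lox: "loxodromic \<gamma>" and ax: "axis_geodesic \<gamma> g"
    and shift: "geodesic g t1 = act \<gamma> (geodesic g t0)"
  shows "repelling_pt \<gamma> = act g (tip (-1))" and "attracting_pt \<gamma> = act g (tip 1)" and "t0 < t1"
    and "\<exists>c. cmod c = 1 \<and> (\<forall>t. \<gamma> *v axis_vec g t = c *s axis_vec g (t + (t1 - t0))) \<and>
      inverse (autj \<gamma> (attracting_pt \<gamma>)) * inverse (autj \<gamma> (repelling_pt \<gamma>)) = c * c \<and>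
      act \<gamma> (repelling_pt \<gamma>) = repelling_pt \<gamma> \<and> act \<gamma> (attracting_pt \<gamma>) = attracting_pt \<gamma>"
proof -
  have g: "g \<in> carrier SU"
    using ax by (simp add: axis_geodesic_def)
  let ?p = "g *v lift_pt (tip 1)" and ?q = "g *v lift_pt (tip (-1))"
  let ?X = "repelling_pt \<gamma>" and ?Y = "attracting_pt \<gamma>"
  have lims: "(geodesic g \<longlongrightarrow> ?X) at_bot" "(geodesic g \<longlongrightarrow> ?Y) at_top"
    using ax by (simp_all add: axis_geodesic_def)
  show X: "?X = act g (tip (-1))"
    by (rule tendsto_unique[OF _ lims(1) geodesic_limits(2)[OF g]]) simp
  show Y: "?Y = act g (tip 1)"
    by (rule tendsto_unique[OF _ lims(2) geodesic_limits(1)[OF g]]) simp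
  have tips: "tip 1 \<in> cball 0 1" "tip (-1) \<in> cball 0 1"
    by (simp_all add: norm_tip)
  have at: "attracts \<gamma> ?Y" "attracts (inv\<^bsub>SU\<^esub> \<gamma>) ?X"
    by (rule loxodromic_attracts[OF \<gamma> lox])+
  have Yc: "?Y \<in> cball 0 1" and Xc: "?X \<in> cball 0 1"
    unfolding X Y by (intro act_in_cball[OF g] tips)+
  have fixY: "act \<gamma> ?Y = ?Y" using at(1) by (simp add: attracts_def)
  have fixX: "act \<gamma> ?X = ?X"
    using at(2) act_inv_act(2)[OF \<gamma> Xc] by (simp add: attracts_def)
  define \<nu> where "\<nu> = inverse (autj \<gamma> ?Y)"
  define \<mu> where "\<mu> = inverse (autj \<gamma> ?X)"
  have pY: "lift_pt ?Y = autj g (tip 1) *s ?p" and qX: "lift_pt ?X = autj g (tip (-1)) *s ?q"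
    unfolding X Y by (rule lift_act[OF g tips(1)], rule lift_act[OF g tips(2)])
  have cancel: "v = w" if "c *s v = c *s w" "c \<noteq> 0" for c and v w :: "complex^('n option)"
    using that by (simp add: vec_eq_iff)
  have P: "\<gamma> *v ?p = \<nu> *s ?p"
  proof (rule cancel)
    show "autj g (tip 1) *s (\<gamma> *v ?p) = autj g (tip 1) *s (\<nu> *s ?p)"
      using fixed_point_eigenvector[OF \<gamma> Yc fixY] unfolding pY \<nu>_def[symmetric] vector_scalar_commute
      by (simp add: vector_smult_assoc mult.commute)
  qed (rule autj_neq_0[OF g tips(1)])
  have Q: "\<gamma> *v ?q = \<mu> *s ?q"
  proof (rule cancel)
    show "autj g (tip (-1)) *s (\<gamma> *v ?q) = autj g (tip (-1)) *s (\<mu> *s ?q)"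
      using fixed_point_eigenvector[OF \<gamma> Xc fixX] unfolding qX \<mu>_def[symmetric] vector_scalar_commute
      by (simp add: vector_smult_assoc mult.commute)
  qed (rule autj_neq_0[OF g tips(2)])
  have pq: "herm ?p ?q = -2"
    by (simp add: SU_herm[OF g] herm_lift_tip tip_nth)
  have "\<nu> * cnj \<mu> * herm ?p ?q = herm ?p ?q"
    using SU_herm[OF \<gamma>, of ?p ?q] unfolding P Q by (simp only: herm_scale_left herm_scale_right mult_ac)
  then have \<nu>\<mu>: "\<nu> * cnj \<mu> = 1" unfolding pq by simp
  define T where "T = t1 - t0"
  have move: "\<gamma> *v axis_vec g t = (\<nu> * of_real (exp t / 2)) *s ?p + (\<mu> * of_real (exp (- t) / 2)) *s ?q" for t
    by (simp add: axis_vec_eq matrix_vector_right_distrib vector_scalar_commute P Q vector_smult_assoc mult.commute)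
  define v where "v = \<gamma> *v axis_vec g t0"
  define w where "w = axis_vec g t1"
  have vN: "v $ None \<noteq> 0"
    unfolding v_def axis_vec_def matrix_vector_mul_assoc
    by (rule SU_denominator_neq_0) (auto intro!: SU_mult_closed \<gamma> g a_mat_SU)
  have wN: "w $ None \<noteq> 0"
    unfolding w_def by (rule geodesic_eq(3)[OF g])
  have "proj_pt v = proj_pt w"
    using shift by (simp add: geodesic_eq(2)[OF g] v_def w_def act_proj_pt geodesic_eq(3)[OF g])
  then have "inverse (v $ None) *s v = inverse (w $ None) *s w"
    using lift_proj_pt[OF vN] lift_proj_pt[OF wN] by simp
  then have "(v $ None) *s (inverse (v $ None) *s v) = (v $ None) *s (inverse (w $ None) *s w)" by simp
  then have vw: "v = (v $ None / w $ None) *s w"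
    using vN by (simp add: vector_smult_assoc divide_inverse)
  define c where "c = v $ None / w $ None"
  have "(\<nu> * of_real (exp t0 / 2)) *s ?p + (\<mu> * of_real (exp (- t0) / 2)) *s ?q
      = (c * of_real (exp t1 / 2)) *s ?p + (c * of_real (exp (- t1) / 2)) *s ?q"
    using vw unfolding c_def[symmetric] by (simp add: v_def w_def move) (simp add: axis_vec_eq vec_scale_add vector_smult_assoc)
  from axis_coords_unique[OF g this]
  have 1: "\<nu> * of_real (exp t0) = c * of_real (exp t1)" and 2: "\<mu> * of_real (exp (- t0)) = c * of_real (exp (- t1))"
    by simp_all
  have \<nu>c: "\<nu> = c * of_real (exp T)"
  proof -
    have "\<nu> * of_real (exp t0) * of_real (exp (- t0)) = c * of_real (exp t1) * of_real (exp (- t0))"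
      using 1 by simp
    then show ?thesis
      by (simp only: mult.assoc of_real_mult[symmetric] exp_add[symmetric]) (simp add: T_def)
  qed
  have \<mu>c: "\<mu> = c * of_real (exp (- T))"
  proof -
    have "\<mu> * of_real (exp (- t0)) * of_real (exp t0) = c * of_real (exp (- t1)) * of_real (exp t0)"
      using 2 by simp
    then show ?thesis
      by (simp only: mult.assoc of_real_mult[symmetric] exp_add[symmetric]) (simp add: T_def add.commute)
  qed
  have ee: "complex_of_real (exp T) * of_real (exp (- T)) = 1"
    by (simp only: of_real_mult[symmetric] exp_add[symmetric]) simp
  have "c * cnj c = 1"
  proof -
    have "\<nu> * cnj \<mu> = c * cnj c * (complex_of_real (exp T) * of_real (exp (- T)))"
      by (simp add: \<nu>c \<mu>c)
    then show ?thesis using \<nu>\<mu> ee by simp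
  qed
  then have c1: "cmod c = 1"
  proof -
    assume "c * cnj c = 1"
    then have "complex_of_real ((cmod c)\<^sup>2) = complex_of_real (1\<^sup>2)"
      unfolding complex_norm_square by simp
    then have "(cmod c)\<^sup>2 = 1\<^sup>2"
      by (simp only: of_real_eq_iff)
    then show "cmod c = 1"
      by (rule power2_eq_imp_eq) simp_all
  qed
  have \<gamma>\<omega>: "\<gamma> *v axis_vec g t = c *s axis_vec g (t + T)" for t
  proof -
    have "exp (- (t + T)) = exp (- t) * exp (- T)" by (simp add: exp_add[symmetric])
    then show ?thesis
      unfolding move \<nu>c \<mu>c unfolding axis_vec_eq exp_add by (simp add: vec_scale_add vector_smult_assoc mult_ac)
  qed
  have geo: "act \<gamma> (geodesic g t) = geodesic g (t + T)" for t
  proof -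
    have "c \<noteq> 0" using c1 by auto
    then show ?thesis
      by (simp add: geodesic_eq(2)[OF g] act_proj_pt geodesic_eq(3)[OF g] \<gamma>\<omega> proj_pt_scale)
  qed
  have iter: "(act \<gamma> ^^ m) (geodesic g 0) = geodesic g (real m * T)" for m
    by (induction m) (simp_all add: geo algebra_simps)
  have ball: "geodesic g 0 \<in> ball 0 1"
    unfolding geodesic_eq(1)[OF g] by (intro act_in_ball SU_mult_closed g a_mat_SU) simp
  then have lim: "(\<lambda>m. geodesic g (real m * T)) \<longlonglongrightarrow> ?Y"
    using at(1) unfolding attracts_def iter[symmetric] by blast
  have sph: "?Y \<in> sphere 0 1" using at(1) by (simp add: attracts_def)
  have "T > 0"
  proof (rule ccontr)
    assume "\<not> T > 0"
    then consider "T = 0" | "T < 0" by linarith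
    then show False
    proof cases
      case 1
      then have "geodesic g 0 = ?Y"
        using lim by (simp add: LIMSEQ_const_iff)
      with ball sph show False by simp
    next
      case 2
      have "filterlim (\<lambda>m. real m * T) at_bot sequentially"
        using 2 by real_asymp
      then have "(\<lambda>m. geodesic g (real m * T)) \<longlonglongrightarrow> act g (tip (-1))"
        by (rule filterlim_compose[OF geodesic_limits(2)[OF g]])
      then have "act g (tip (-1)) = act g (tip 1)"
        using LIMSEQ_unique[OF _ lim] unfolding Y by blast
      then have "tip (-1) = (tip 1 :: complex^('n::{finite,linorder}))"
        using act_inv_act(1)[OF g tips(1)] act_inv_act(1)[OF g tips(2)] by simp
      from arg_cong[where f = "\<lambda>v. v $ Max UNIV", OF this] show False
        unfolding tip_nth by simp
    qed
  qed
  then show "t0 < t1" by (simp add: T_def)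
  have "\<nu> * \<mu> = c * c"
  proof -
    have "\<nu> * \<mu> = c * c * (complex_of_real (exp T) * of_real (exp (- T)))"
      by (simp add: \<nu>c \<mu>c)
    then show ?thesis using ee by simp
  qed
  then show "\<exists>c. cmod c = 1 \<and> (\<forall>t. \<gamma> *v axis_vec g t = c *s axis_vec g (t + (t1 - t0))) \<and>
      inverse (autj \<gamma> ?Y) * inverse (autj \<gamma> ?X) = c * c \<and> act \<gamma> ?X = ?X \<and> act \<gamma> ?Y = ?Y"
    using c1 \<gamma>\<omega> fixX fixY unfolding \<nu>_def \<mu>_def T_def by blast
qed

text \<open>The lifts of the fixed points are eigenvectors, with eigenvalues the inverses of the factors of automorphy. The
form is invariant, so each of the two factors of \<open>Q\<close> picks up \<open>autj \<gamma> z\<close> and the conjugate of an eigenvalue.\<close>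
lemma Qform_act:
  assumes \<gamma>: "\<gamma> \<in> carrier SU" and z: "z \<in> ball 0 1"
    and fixX: "repelling_pt \<gamma> \<in> cball 0 1" "act \<gamma> (repelling_pt \<gamma>) = repelling_pt \<gamma>"
    and fixY: "attracting_pt \<gamma> \<in> cball 0 1" "act \<gamma> (attracting_pt \<gamma>) = attracting_pt \<gamma>"
  shows "Qform \<gamma> (act \<gamma> z) * cnj (inverse (autj \<gamma> (attracting_pt \<gamma>)) * inverse (autj \<gamma> (repelling_pt \<gamma>)))
     = autj \<gamma> z ^ 2 * Qform \<gamma> z"
proof -
  have z': "z \<in> cball 0 1" using z by auto
  have *: "herm (lift_pt (act \<gamma> z)) (lift_pt y) * cnj (inverse (autj \<gamma> y)) = autj \<gamma> z * herm (lift_pt z) (lift_pt y)"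
    if "y \<in> cball 0 1" "act \<gamma> y = y" for y
  proof -
    have "cnj (inverse (autj \<gamma> y)) * herm (lift_pt (act \<gamma> z)) (lift_pt y) = herm (lift_pt (act \<gamma> z)) (\<gamma> *v lift_pt y)"
      by (simp only: fixed_point_eigenvector[OF \<gamma> that] herm_scale_right)
    also have "\<dots> = autj \<gamma> z * herm (lift_pt z) (lift_pt y)"
      by (simp only: lift_act[OF \<gamma> z'] herm_scale_left SU_herm[OF \<gamma>])
    finally show ?thesis by (simp add: mult.commute)
  qed
  let ?X = "repelling_pt \<gamma>" and ?Y = "attracting_pt \<gamma>"
  have "Qform \<gamma> (act \<gamma> z) * cnj (inverse (autj \<gamma> ?Y) * inverse (autj \<gamma> ?X))
      = (herm (lift_pt (act \<gamma> z)) (lift_pt ?X) * cnj (inverse (autj \<gamma> ?X)))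
        * (herm (lift_pt (act \<gamma> z)) (lift_pt ?Y) * cnj (inverse (autj \<gamma> ?Y)))"
    unfolding Qform_def complex_cnj_mult by (simp only: mult_ac)
  also have "\<dots> = autj \<gamma> z ^ 2 * Qform \<gamma> z"
    unfolding *[OF fixX] *[OF fixY] Qform_def power2_eq_square by (simp only: mult_ac)
  finally show ?thesis .
qed

lemma Qform_neq_0:
  assumes "z \<in> ball 0 1" "repelling_pt \<gamma> \<in> cball 0 1" "attracting_pt \<gamma> \<in> cball 0 1"
  shows "Qform \<gamma> z \<noteq> 0"
  unfolding Qform_def using herm_lift_neq_0[OF assms(1,2)] herm_lift_neq_0[OF assms(1,3)] by simp

text \<open>Comparing \<open>Qform_act\<close> with the transformation rule of \<open>q\<close> at the origin, where \<open>Q\<close> does not vanish.\<close>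
lemma translation_phase:
  assumes \<gamma>: "\<gamma> \<in> carrier SU"
    and fixX: "repelling_pt \<gamma> \<in> cball 0 1" "act \<gamma> (repelling_pt \<gamma>) = repelling_pt \<gamma>"
    and fixY: "attracting_pt \<gamma> \<in> cball 0 1" "act \<gamma> (attracting_pt \<gamma>) = attracting_pt \<gamma>"
    and c: "inverse (autj \<gamma> (attracting_pt \<gamma>)) * inverse (autj \<gamma> (repelling_pt \<gamma>)) = c * c"
    and inv: "slash k (qfun k \<gamma>) \<gamma> 0 = qfun k \<gamma> 0"
  shows "c ^ (2 * k) = 1"
proof -
  have 0: "0 \<in> ball 0 (1::real)" "(0 :: complex^'a) \<in> ball 0 1" "(0 :: complex^'a) \<in> cball 0 1" by simp_all
  have Q0: "Qform \<gamma> 0 \<noteq> 0" by (rule Qform_neq_0[OF 0(2) fixX(1) fixY(1)])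
  have j0: "autj \<gamma> 0 \<noteq> 0" by (rule autj_neq_0[OF \<gamma> 0(3)])
  have Q: "Qform \<gamma> (act \<gamma> 0) * cnj (c * c) = autj \<gamma> 0 ^ 2 * Qform \<gamma> 0"
    using Qform_act[OF \<gamma> 0(2) fixX fixY] unfolding c .
  have "inverse (Qform \<gamma> (act \<gamma> 0) ^ k) * autj \<gamma> 0 ^ (2 * k) = inverse (Qform \<gamma> 0 ^ k)"
    using inv by (simp add: slash_def qfun_def)
  moreover have Q1: "Qform \<gamma> (act \<gamma> 0) \<noteq> 0"
    using Q Q0 j0 by auto
  ultimately have "Qform \<gamma> 0 ^ k * autj \<gamma> 0 ^ (2 * k) = Qform \<gamma> (act \<gamma> 0) ^ k"
    using Q0 by (simp add: field_simps)
  then have "Qform \<gamma> 0 ^ k * (autj \<gamma> 0 ^ 2) ^ k = Qform \<gamma> (act \<gamma> 0) ^ k"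
    unfolding power_mult .
  moreover have "(Qform \<gamma> (act \<gamma> 0) * cnj (c * c)) ^ k = (autj \<gamma> 0 ^ 2 * Qform \<gamma> 0) ^ k"
    using Q by simp
  ultimately have "Qform \<gamma> (act \<gamma> 0) ^ k * cnj (c * c) ^ k = Qform \<gamma> (act \<gamma> 0) ^ k * 1"
    unfolding power_mult_distrib[of "Qform \<gamma> (act \<gamma> 0)"] power_mult_distrib[of "autj \<gamma> 0 ^ 2"]
    by (simp only: mult.commute mult_1)
  then have "cnj (c * c) ^ k = 1"
    using Q1 by (metis mult_cancel_left power_not_zero)
  then have "cnj (c ^ (2 * k)) = cnj 1"
    by (simp add: power_mult power2_eq_square)
  then show ?thesis
    by (simp only: complex_cnj_cancel_iff)
qed

section \<open>The reproducing formula\<close>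

lemma cusp_form_facts:
  assumes "f \<in> cusp_forms k \<Gamma>"
  shows "holomorphic_vec_on f (ball 0 1)"
    and "\<gamma> \<in> \<Gamma> \<Longrightarrow> z \<in> ball 0 1 \<Longrightarrow> slash k f \<gamma> z = f z"
    and "\<exists>M\<ge>0. \<forall>z\<in>ball 0 1. cmod (f z) * height z ^ k \<le> M"
proof -
  show "holomorphic_vec_on f (ball 0 1)" "\<gamma> \<in> \<Gamma> \<Longrightarrow> z \<in> ball 0 1 \<Longrightarrow> slash k f \<gamma> z = f z"
    using assms by (simp_all add: cusp_forms_def)
  have "bounded ((\<lambda>z. cmod (f z) * height z ^ k) ` ball 0 1)"
    using assms by (simp add: cusp_forms_def)
  then obtain M where M: "\<forall>z\<in>ball 0 1. \<bar>cmod (f z) * height z ^ k\<bar> \<le> M"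
    unfolding bounded_iff by auto
  have "cmod (f z) * height z ^ k \<le> max M 0" if "z \<in> ball 0 1" for z
    using bspec[OF M that] by linarith
  then show "\<exists>M\<ge>0. \<forall>z\<in>ball 0 1. cmod (f z) * height z ^ k \<le> M"
    by (intro exI[of _ "max M 0"]) simp
qed

lemma holomorphic_vec_continuous:
  assumes "holomorphic_vec_on f S"
  shows "continuous_on S f"
proof (intro continuous_at_imp_continuous_on ballI)
  fix z assume "z \<in> S"
  then obtain f' where "(f has_derivative f') (at z)"
    using assms unfolding holomorphic_vec_on_def by blast
  then show "isCont f z" by (rule has_derivative_continuous)
qed

text \<open>On a complex line through the origin the coordinates of \<open>act g\<close> are quotients of affine functions of the parameter,
and the derivative of \<open>f\<close> is complex linear.\<close>
lemma slash_holomorphic_line: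
  fixes f :: "complex^'n::finite \<Rightarrow> complex"
  assumes f: "holomorphic_vec_on f (ball 0 1)" and g: "g \<in> carrier SU"
  shows "(\<lambda>c. slash k f g (c *s w)) holomorphic_on {c. c *s w \<in> ball 0 1}"
proof (rule holomorphic_onI)
  fix c assume "c \<in> {c. c *s w \<in> ball 0 1}"
  then have cw: "c *s w \<in> ball 0 1" by simp
  then have cw': "c *s w \<in> cball 0 1" by auto
  define p where "p = g *v lift_pt 0"
  define q where "q = g *v (lift_pt w - lift_pt 0)"
  have lin: "g *v lift_pt (c *s w) = p + c *s q" for c
  proof -
    have "lift_pt (c *s w) = lift_pt 0 + c *s (lift_pt w - lift_pt 0)"
      by (rule vec_option_eqI) simp_all
    then show ?thesis
      by (simp only: p_def q_def matrix_vector_right_distrib vector_scalar_commute)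
  qed
  have nz: "p $ None + c * q $ None \<noteq> 0"
    using SU_denominator_neq_0[OF g cw'] by (simp add: lin)
  have j: "autj g (c *s w) = inverse (p $ None + c * q $ None)" for c
    by (simp add: autj_def lin)
  have a: "act g (c *s w) $ i = (p $ Some i + c * q $ Some i) / (p $ None + c * q $ None)" for c i
    by (simp add: act_def lin)
  define d where "d i = (q $ Some i * (p $ None + c * q $ None) - (p $ Some i + c * q $ Some i) * q $ None)
      / ((p $ None + c * q $ None) * (p $ None + c * q $ None))" for i
  have d: "((\<lambda>c. act g (c *s w) $ i) has_field_derivative d i) (at c)" for i
    unfolding a d_def using nz by (intro DERIV_divide) (auto intro!: derivative_eq_intros)
  have act': "((\<lambda>c. act g (c *s w)) has_derivative (\<lambda>x. x *s (\<chi> i. d i))) (at c)"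
  proof (rule has_derivative_componentwise_within[THEN iffD2], rule ballI)
    fix b :: "complex^'n" assume "b \<in> Basis"
    then obtain i u where b: "b = axis i u" unfolding Basis_vec_def by auto
    have "((\<lambda>c. act g (c *s w) $ i) has_derivative (\<lambda>x. x * d i)) (at c)"
      using d[of i] by (simp add: has_field_derivative_def mult_commute_abs)
    then show "((\<lambda>c. act g (c *s w) \<bullet> b) has_derivative (\<lambda>x. (x *s (\<chi> i. d i)) \<bullet> b)) (at c)"
      unfolding b inner_axis by (simp add: has_derivative_inner_left)
  qed
  have "act g (c *s w) \<in> ball 0 1" by (rule act_in_ball[OF g cw])
  then obtain f' where f': "(f has_derivative f') (at (act g (c *s w)))" and f'lin: "\<And>c v. f' (c *s v) = c * f' v"
    using bspec[OF f[unfolded holomorphic_vec_on_def]] by metis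
  have "((\<lambda>c. f (act g (c *s w))) has_derivative (\<lambda>x. f' (x *s (\<chi> i. d i)))) (at c)"
    by (rule has_derivative_compose[OF act' f'])
  then have F: "((\<lambda>c. f (act g (c *s w))) has_field_derivative f' (\<chi> i. d i)) (at c)"
    by (simp add: has_field_derivative_def f'lin mult_commute_abs)
  have "((\<lambda>c. p $ None + c * q $ None) has_field_derivative q $ None) (at c)"
    by (auto intro!: derivative_eq_intros)
  from DERIV_inverse'[OF this nz]
  have J: "((\<lambda>c. autj g (c *s w)) has_field_derivative
      - (inverse (p $ None + c * q $ None) * q $ None * inverse (p $ None + c * q $ None))) (at c)"
    unfolding j .
  from DERIV_mult[OF F DERIV_power[OF J, of "2 * k"]]
  have "(\<lambda>c. slash k f g (c *s w)) field_differentiable (at c)"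
    unfolding slash_def field_differentiable_def by (rule exI)
  then show "(\<lambda>c. slash k f g (c *s w)) field_differentiable (at c within {c. c *s w \<in> ball 0 1})"
    by (rule field_differentiable_at_within)
qed

definition kernel :: "nat \<Rightarrow> complex^('n::finite option) \<Rightarrow> complex^'n \<Rightarrow> complex" where
  "kernel k \<omega> z = inverse (herm (lift_pt z) \<omega> ^ (2 * k))"

text \<open>The integrand of the pairing of \<open>f\<close> with the kernel of weight \<open>2k\<close> at the vector \<open>\<omega>\<close>, cut off outside the ball so that
it is Borel on the whole space.\<close>
definition reproducing_term :: "nat \<Rightarrow> (complex^'n::finite \<Rightarrow> complex) \<Rightarrow> complex^('n option) \<Rightarrow> complex^'n \<Rightarrow> complex" where
  "reproducing_term k f \<omega> z = indicator (ball 0 1) z *\<^sub>R (f z * cnj (kernel k \<omega> z) * of_real (height z ^ (2 * k)))"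

lemma borel_measurable_reproducing_term:
  fixes f :: "complex^'n::finite \<Rightarrow> complex"
  assumes f: "continuous_on (ball 0 1) f"
  shows "reproducing_term k f \<omega> \<in> borel_measurable borel"
proof -
  define F where "F z = indicator (ball 0 1) z *\<^sub>R f z" for z
  have [measurable]: "F \<in> borel_measurable borel"
    unfolding F_def by (rule borel_measurable_continuous_on_indicator[OF _ f]) simp
  have [measurable]: "(\<lambda>z. cnj (kernel k \<omega> z)) \<in> borel_measurable borel"
    unfolding kernel_def
    by (intro measurable_compose[OF _ borel_measurable_continuous_onI[of cnj]] continuous_intros) measurable
  have "(\<lambda>z. F z * cnj (kernel k \<omega> z) * of_real (height z ^ (2 * k))) \<in> borel_measurable borel"
    by measurable
  then show ?thesis
    by (simp add: reproducing_term_def[abs_def] F_def)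
qed

text \<open>After the substitution \<open>z = G w\<close> the kernel at \<open>G e\<close> cancels against the conjugate factor of automorphy: up to sign, the
pairing of \<open>G w\<close> with \<open>G e\<close> is the factor of automorphy itself.\<close>
lemma reproducing_term_act:
  assumes G: "G \<in> carrier SU" and w: "w \<in> ball 0 1"
  shows "reproducing_term k f (G *v lift_pt 0) (act G w) = slash k f G w * of_real (height w ^ (2 * k))"
proof -
  have w': "w \<in> cball 0 1" using w by auto
  have j: "autj G w \<noteq> 0" by (rule autj_neq_0[OF G w'])
  have "herm (lift_pt (act G w)) (G *v lift_pt 0) = - autj G w"
    by (simp add: lift_act[OF G w'] herm_scale_left SU_herm[OF G] herm_lift)
  then have K: "kernel k (G *v lift_pt 0) (act G w) = inverse (autj G w ^ (2 * k))"
    by (simp add: kernel_def)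
  have "complex_of_real ((cmod (autj G w))\<^sup>2) ^ (2 * k) = (autj G w * cnj (autj G w)) ^ (2 * k)"
    by (simp add: complex_norm_square del: of_real_power)
  then have h: "complex_of_real (height (act G w) ^ (2 * k)) = autj G w ^ (2 * k) * cnj (autj G w ^ (2 * k)) * of_real (height w ^ (2 * k))"
    by (simp add: height_act[OF G w'] power_mult_distrib)
  show ?thesis
    using act_in_ball[OF G w] j unfolding reproducing_term_def K h slash_def by simp
qed

lemma slash_height_bound:
  assumes G: "G \<in> carrier SU" and w: "w \<in> ball 0 1" and M: "\<And>z. z \<in> ball 0 1 \<Longrightarrow> cmod (f z) * height z ^ k \<le> M"
  shows "cmod (slash k f G w * of_real (height w ^ (2 * k))) \<le> M * height w ^ k"
proof -
  have w': "w \<in> cball 0 1" using w by auto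
  have h: "height w > 0" using w by (simp only: height_pos_iff)
  have "cmod (slash k f G w * of_real (height w ^ (2 * k))) = (cmod (f (act G w)) * height (act G w) ^ k) * height w ^ k"
  proof -
    have "height (act G w) ^ k = cmod (autj G w) ^ (2 * k) * height w ^ k"
      by (simp only: height_act[OF G w'] power_mult_distrib power_mult)
    moreover have "height w ^ (2 * k) = height w ^ k * height w ^ k"
      by (simp add: mult_2 power_add)
    moreover have "cmod (of_real (height w ^ (2 * k))) = height w ^ (2 * k)"
      using h by (simp only: norm_of_real abs_of_nonneg zero_le_power less_imp_le)
    ultimately show ?thesis
      by (simp only: slash_def norm_mult norm_power mult_ac)
  qed
  also have "\<dots> \<le> M * height w ^ k"
    using M[OF act_in_ball[OF G w]] h by (intro mult_right_mono) auto
  finally show ?thesis .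
qed

text \<open>By \<open>reproducing_term_act\<close> and the invariance of the volume, the integral is that of \<open>f|G\<close> against \<open>height^(2k) dV\<close>, to which
the mean value property applies. The bound on the norms is uniform in \<open>G\<close>, which makes the later exchange of
integrations possible.\<close>
theorem reproducing_formula:
  fixes f :: "complex^'n::finite \<Rightarrow> complex"
  assumes hol: "holomorphic_vec_on f (ball 0 1)" and M: "\<forall>z\<in>ball 0 1. cmod (f z) * height z ^ k \<le> M"
    and k: "CARD('n) + 1 \<le> k" and G: "G \<in> carrier SU"
  shows "integrable inv_vol (reproducing_term k f (G *v lift_pt 0))"
    and "(\<integral>z. norm (reproducing_term k f (G *v lift_pt 0) z) \<partial>inv_vol)
        \<le> M * (\<integral>z. indicator (ball 0 1) z * height z ^ k \<partial>(inv_vol :: (complex^'n) measure))"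
    and "(\<integral>z. reproducing_term k f (G *v lift_pt 0) z \<partial>inv_vol) =
       slash k f G 0 * of_real (4 ^ CARD('n) * pi ^ CARD('n) * fact (2 * k - CARD('n) - 1) / fact (2 * k - 1))"
proof -
  let ?V = "inv_vol :: (complex^'n) measure"
  let ?R = "reproducing_term k f (G *v lift_pt 0)"
  let ?S = "\<lambda>w. indicator (ball 0 1) w *\<^sub>R (slash k f G w * of_real (height w ^ (2 * k)))"
  have cont: "continuous_on (ball 0 1) f" by (rule holomorphic_vec_continuous[OF hol])
  have R [measurable]: "?R \<in> borel_measurable borel"
    by (rule borel_measurable_reproducing_term[OF cont])
  have RS: "AE w in ?V. ?R (act G w) = ?S w"
    using AE_inv_vol_ball
  proof eventually_elim
    case (elim w)
    then show ?case using reproducing_term_act[OF G elim, of k f] by simp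
  qed
  have Smeas: "?S \<in> borel_measurable ?V"
  proof -
    have "?S w = indicator (ball 0 1) w *\<^sub>R ?R (act G w)" for w
      using reproducing_term_act[OF G, of w k f] by (cases "w \<in> ball 0 1") simp_all
    then have "?S = (\<lambda>w. indicator (ball 0 1) w *\<^sub>R ?R (act G w))" by (rule ext)
    also have "\<dots> \<in> borel_measurable ?V"
    proof -
      show ?thesis by measurable
    qed
    finally show ?thesis .
  qed
  have inth: "integrable ?V (\<lambda>z. indicator (ball 0 1) z * height z ^ k)"
    by (rule integrable_height_power[OF k])
  have bound: "norm (?S w) \<le> M * (indicator (ball 0 1) w * height w ^ k)" for w
    using slash_height_bound[OF G _ bspec[OF M], of w] by (cases "w \<in> ball 0 1") simp_all
  have intS: "integrable ?V ?S"
  proof (rule Bochner_Integration.integrable_bound[OF integrable_mult_right[OF inth, of M] Smeas], rule AE_I2)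
    show "norm (?S w) \<le> norm (M * (indicator (ball 0 1) w * height w ^ k))" for w
      using order_trans[OF bound abs_ge_self] by (simp only: real_norm_def)
  qed
  have dV: "distr ?V borel (act G) = ?V" by (rule distr_inv_vol_act[OF G])
  have "integrable ?V (\<lambda>w. ?R (act G w))"
    by (subst integrable_cong_AE[OF _ Smeas RS]) (measurable, rule intS)
  then have "integrable (distr ?V borel (act G)) ?R"
    by (subst integrable_distr_eq) auto
  then show "integrable inv_vol ?R" by (simp add: dV)
  have "(\<integral>z. norm (?R z) \<partial>?V) = (\<integral>z. norm (?R z) \<partial>distr ?V borel (act G))"
    by (simp add: dV)
  also have "\<dots> = (\<integral>w. norm (?R (act G w)) \<partial>?V)"
    by (rule integral_distr) measurable
  also have "\<dots> = (\<integral>w. norm (?S w) \<partial>?V)"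
  proof (rule integral_cong_AE)
    show "AE w in ?V. norm (?R (act G w)) = norm (?S w)"
      using RS by eventually_elim (simp only:)
    show "(\<lambda>w. norm (?S w)) \<in> borel_measurable ?V" by (rule measurable_compose[OF Smeas borel_measurable_norm])
  qed measurable
  also have "\<dots> \<le> (\<integral>w. M * (indicator (ball 0 1) w * height w ^ k) \<partial>?V)"
    by (intro integral_mono integrable_norm intS integrable_mult_right inth bound)
  also have "\<dots> = M * (\<integral>w. indicator (ball 0 1) w * height w ^ k \<partial>?V)"
    by simp
  finally show "(\<integral>z. norm (?R z) \<partial>inv_vol) \<le> M * (\<integral>z. indicator (ball 0 1) z * height z ^ k \<partial>?V)" .
  have k2: "CARD('n) + 1 < 2 * k" using k by simp
  have "(\<integral>z. ?R z \<partial>?V) = (\<integral>z. ?R z \<partial>distr ?V borel (act G))"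
    by (simp add: dV)
  also have "\<dots> = (\<integral>w. ?R (act G w) \<partial>?V)"
    by (rule integral_distr) measurable
  also have "\<dots> = (\<integral>w. ?S w \<partial>?V)"
    by (rule integral_cong_AE[OF _ Smeas RS]) measurable
  also have "\<dots> = slash k f G 0 * of_real (\<integral>z. indicator (ball 0 1) z * height z ^ (2 * k) \<partial>?V)"
    by (rule ball_mean_value[OF slash_holomorphic_line[OF hol G] intS integral_height_power(1)[OF k2]])
  also have "(\<integral>z. indicator (ball 0 1) z * height z ^ (2 * k) \<partial>?V) = 4 ^ CARD('n) * pi ^ CARD('n) * fact (2 * k - CARD('n) - 1) / fact (2 * k - 1)"
    by (rule integral_height_power(2)[OF k2])
  finally show "(\<integral>z. ?R z \<partial>inv_vol) = slash k f G 0 * of_real (4 ^ CARD('n) * pi ^ CARD('n) * fact (2 * k - CARD('n) - 1) / fact (2 * k - 1))" .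
qed

section \<open>Kernels along the axis\<close>

abbreviation SU_pow :: "complex^('n::finite option)^('n option) \<Rightarrow> int \<Rightarrow> complex^('n option)^('n option)" where
  "SU_pow \<gamma> m \<equiv> \<gamma> [^]\<^bsub>SU\<^esub> m"

lemma SU_pow_facts:
  assumes "\<gamma> \<in> carrier SU"
  shows SU_pow_closed: "SU_pow \<gamma> m \<in> carrier SU"
    and SU_pow_add: "SU_pow \<gamma> (m + n) = SU_pow \<gamma> m ** SU_pow \<gamma> n"
    and SU_pow_0: "SU_pow \<gamma> 0 = mat 1"
    and SU_pow_1: "SU_pow \<gamma> 1 = \<gamma>"
proof -
  interpret group SU by (rule group_SU)
  show "SU_pow \<gamma> m \<in> carrier SU" "SU_pow \<gamma> (m + n) = SU_pow \<gamma> m ** SU_pow \<gamma> n"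
    "SU_pow \<gamma> 0 = mat 1" "SU_pow \<gamma> 1 = \<gamma>"
    using assms by (simp_all add: int_pow_mult)
qed

lemma axis_vec_pow:
  assumes \<gamma>: "\<gamma> \<in> carrier SU" and step: "\<And>t. \<gamma> *v axis_vec g t = c *s axis_vec g (t + T)"
    and c: "c ^ (2 * k) = 1" and k: "k > 0"
  shows "\<exists>d. d ^ (2 * k) = 1 \<and> (\<forall>t. SU_pow \<gamma> m *v axis_vec g t = d *s axis_vec g (t + of_int m * T))"
proof (induction m rule: int_induct[where k = 0])
  case base
  show ?case by (rule exI[of _ 1]) (simp add: SU_pow_0[OF \<gamma>])
next
  case (step1 m)
  then obtain d where d: "d ^ (2 * k) = 1" "\<And>t. SU_pow \<gamma> m *v axis_vec g t = d *s axis_vec g (t + of_int m * T)"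
    by blast
  have "SU_pow \<gamma> (m + 1) *v axis_vec g t = (c * d) *s axis_vec g (t + of_int (m + 1) * T)" for t
  proof -
    have "SU_pow \<gamma> (m + 1) *v axis_vec g t = SU_pow \<gamma> m *v (\<gamma> *v axis_vec g t)"
      by (simp only: SU_pow_add[OF \<gamma>] SU_pow_1[OF \<gamma>] matrix_vector_mul_assoc)
    also have "\<dots> = (c * d) *s axis_vec g ((t + T) + of_int m * T)"
      by (simp only: step vector_scalar_commute d vector_smult_assoc)
    finally show ?thesis by (simp add: algebra_simps)
  qed
  moreover have "(c * d) ^ (2 * k) = 1"
    by (simp only: power_mult_distrib c d mult_1)
  ultimately show ?case by blast
next
  case (step2 m)
  then obtain d where d: "d ^ (2 * k) = 1" "\<And>t. SU_pow \<gamma> m *v axis_vec g t = d *s axis_vec g (t + of_int m * T)"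
    by blast
  have c0: "c \<noteq> 0" using c k by (auto simp: zero_power)
  have "SU_pow \<gamma> (m - 1) *v axis_vec g t = (d / c) *s axis_vec g (t + of_int (m - 1) * T)" for t
  proof -
    have "\<gamma> *v axis_vec g (t - T) = c *s axis_vec g t"
      by (simp add: step)
    then have "(1 / c) *s (\<gamma> *v axis_vec g (t - T)) = (1 / c) *s (c *s axis_vec g t)" by simp
    then have "axis_vec g t = (1 / c) *s (\<gamma> *v axis_vec g (t - T))"
      using c0 by (simp add: vector_smult_assoc)
    then have "SU_pow \<gamma> (m - 1) *v axis_vec g t = (1 / c) *s ((SU_pow \<gamma> (m - 1) ** SU_pow \<gamma> 1) *v axis_vec g (t - T))"
      by (simp only: vector_scalar_commute SU_pow_1[OF \<gamma>] matrix_vector_mul_assoc)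
    also have "SU_pow \<gamma> (m - 1) ** SU_pow \<gamma> 1 = SU_pow \<gamma> m"
      using SU_pow_add[OF \<gamma>, of "m - 1" 1] by simp
    finally show ?thesis
      by (simp add: d(2) vector_smult_assoc) (simp add: algebra_simps)
  qed
  moreover have "(d / c) ^ (2 * k) = 1"
    by (simp only: power_divide c d div_by_1)
  ultimately show ?case by blast
qed

text \<open>Distinct powers translate the axis by distinct amounts.\<close>
lemma SU_pow_inj:
  assumes g: "g \<in> carrier SU" and T: "T \<noteq> 0" and k: "k > 0"
    and pow: "\<And>m. \<exists>d. d ^ (2 * k) = 1 \<and> (\<forall>t. SU_pow \<gamma> m *v axis_vec g t = d *s axis_vec g (t + of_int m * T))"
  shows "inj (SU_pow \<gamma>)"
proof (rule injI)
  fix m n assume eq: "SU_pow \<gamma> m = SU_pow \<gamma> n"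
  obtain d where d: "d ^ (2 * k) = 1" "\<And>t. SU_pow \<gamma> m *v axis_vec g t = d *s axis_vec g (t + of_int m * T)"
    using pow[of m] by blast
  obtain e where e: "\<And>t. SU_pow \<gamma> n *v axis_vec g t = e *s axis_vec g (t + of_int n * T)"
    using pow[of n] by blast
  have "d \<noteq> 0" using d(1) k by (auto simp: zero_power)
  moreover have "d *s axis_vec g (0 + of_int m * T) = e *s axis_vec g (0 + of_int n * T)"
    using d(2)[of 0] e[of 0] eq by simp
  ultimately have "0 + of_int m * T = 0 + of_int n * T"
    using axis_vec_proportional[OF g] by blast
  then show "m = n" using T by simp
qed

text \<open>The automorphy factors of \<open>f\<close>, of the kernel and of the height cancel, so moving the point by \<open>\<gamma>\<close> amounts to moving the
vector of the kernel back; the phase \<open>d\<close> disappears in the power.\<close>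
lemma reproducing_term_translate:
  assumes \<gamma>: "\<gamma> \<in> carrier SU" and u: "u \<in> ball 0 1" and f: "slash k f \<gamma> u = f u"
    and \<omega>: "\<gamma> *v \<omega>' = d *s \<omega>" and d: "d ^ (2 * k) = 1"
  shows "reproducing_term k f \<omega> (act \<gamma> u) = reproducing_term k f \<omega>' u"
proof -
  have u': "u \<in> cball 0 1" using u by auto
  have j: "autj \<gamma> u \<noteq> 0" by (rule autj_neq_0[OF \<gamma> u'])
  have "cnj d * herm (lift_pt (act \<gamma> u)) \<omega> = herm (lift_pt (act \<gamma> u)) (\<gamma> *v \<omega>')"
    by (simp only: \<omega> herm_scale_right)
  also have "\<dots> = autj \<gamma> u * herm (lift_pt u) \<omega>'"
    by (simp only: lift_act[OF \<gamma> u'] herm_scale_left SU_herm[OF \<gamma>])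
  finally have "(cnj d * herm (lift_pt (act \<gamma> u)) \<omega>) ^ (2 * k) = (autj \<gamma> u * herm (lift_pt u) \<omega>') ^ (2 * k)"
    by (rule arg_cong)
  moreover have "cnj d ^ (2 * k) = 1"
    using arg_cong[where f = cnj, OF d] by simp
  ultimately have "herm (lift_pt (act \<gamma> u)) \<omega> ^ (2 * k) = autj \<gamma> u ^ (2 * k) * herm (lift_pt u) \<omega>' ^ (2 * k)"
    by (simp only: power_mult_distrib mult_1)
  then have K: "kernel k \<omega> (act \<gamma> u) = inverse (autj \<gamma> u ^ (2 * k)) * kernel k \<omega>' u"
    by (simp only: kernel_def inverse_mult_distrib)
  have "complex_of_real ((cmod (autj \<gamma> u))\<^sup>2) ^ (2 * k) = (autj \<gamma> u * cnj (autj \<gamma> u)) ^ (2 * k)"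
    by (simp only: complex_norm_square)
  then have h: "complex_of_real (height (act \<gamma> u) ^ (2 * k)) = autj \<gamma> u ^ (2 * k) * cnj (autj \<gamma> u ^ (2 * k)) * of_real (height u ^ (2 * k))"
    by (simp add: height_act[OF \<gamma> u'] power_mult_distrib)
  have fu: "f u = f (act \<gamma> u) * autj \<gamma> u ^ (2 * k)"
    using f by (simp add: slash_def)
  show ?thesis
    using act_in_ball[OF \<gamma> u] u j unfolding reproducing_term_def K h fu by simp
qed

text \<open>The integral of \<open>cosh(t)^(-2k)\<close> over the real line, that is, \<open>2^(2k-1) B(k, k)\<close>.\<close>
definition beta_const :: "nat \<Rightarrow> real" where
  "beta_const k = 2 ^ (2 * k - 1) * (fact (k - 1))\<^sup>2 / fact (2 * k - 1)"

text \<open>The product of the factors by which the null vectors \<open>g p\<close> and \<open>g q\<close> differ from the lifts of the fixed points. It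
has the modulus of \<open>\<alpha>\<close> and carries the phase that \<open>|\<alpha>|\<close> forgets.\<close>
definition axis_scale :: "complex^('n::{finite,linorder} option)^('n option) \<Rightarrow> complex" where
  "axis_scale g = autj g (tip (-1)) * autj g (tip 1)"

lemma Qform_axis:
  assumes g: "g \<in> carrier SU"
    and X: "repelling_pt \<gamma> = act g (tip (-1))" and Y: "attracting_pt \<gamma> = act g (tip 1)"
  shows "Qform \<gamma> z = cnj (axis_scale g) * (herm (lift_pt z) (g *v lift_pt (tip 1)) * herm (lift_pt z) (g *v lift_pt (tip (-1))))"
proof -
  have tips: "tip 1 \<in> cball 0 1" "tip (-1) \<in> cball 0 1" by (simp_all add: norm_tip)
  show ?thesis
    unfolding Qform_def X Y lift_act[OF g tips(1)] lift_act[OF g tips(2)] herm_scale_right axis_scale_def complex_cnj_mult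
    by (simp only: mult_ac)
qed

lemma axis_scale_neq_0: "g \<in> carrier SU \<Longrightarrow> axis_scale g \<noteq> 0"
  using autj_neq_0[of g "tip 1"] autj_neq_0[of g "tip (-1)"] by (simp add: axis_scale_def norm_tip)

lemma herm_axis_vec:
  "herm x (axis_vec g t) = (of_real (exp t) * herm x (g *v lift_pt (tip 1)) + of_real (exp (- t)) * herm x (g *v lift_pt (tip (-1)))) / 2"
  unfolding axis_vec_eq herm_add_right herm_scale_right by (simp add: field_simps)

text \<open>In the coordinates in which the axis is standard, the product is \<open>|j|\<^sup>2 (1 - w) (1 + cnj w)\<close> for the last coordinate \<open>w\<close>, which
lies in the unit disc.\<close>
lemma axis_kernel_positive:
  assumes g: "g \<in> carrier SU" and u: "u \<in> ball 0 1"
  shows "Re (herm (lift_pt u) (g *v lift_pt (tip 1)) * cnj (herm (lift_pt u) (g *v lift_pt (tip (-1))))) > 0"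
proof -
  define w where "w = act (inv\<^bsub>SU\<^esub> g) u"
  have w: "w \<in> ball 0 1" unfolding w_def by (rule act_in_ball[OF SU_inv_closed[OF g] u])
  then have w': "w \<in> cball 0 1" by auto
  have uw: "u = act g w" unfolding w_def using act_inv_act(2)[OF g, of u] u by simp
  have h: "herm (lift_pt u) (g *v lift_pt (tip s)) = autj g w * (w $ Max UNIV * cnj s - 1)" for s
    unfolding uw lift_act[OF g w'] herm_scale_left SU_herm[OF g] herm_lift_tip by simp
  have "herm (lift_pt u) (g *v lift_pt (tip 1)) * cnj (herm (lift_pt u) (g *v lift_pt (tip (-1))))
     = (autj g w * cnj (autj g w)) * ((1 - w $ Max UNIV) * (1 + cnj (w $ Max UNIV)))"
    unfolding h by (simp add: algebra_simps)
  also have "autj g w * cnj (autj g w) = of_real ((cmod (autj g w))\<^sup>2)"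
    by (simp only: complex_norm_square)
  finally have "Re (herm (lift_pt u) (g *v lift_pt (tip 1)) * cnj (herm (lift_pt u) (g *v lift_pt (tip (-1)))))
     = (cmod (autj g w))\<^sup>2 * Re ((1 - w $ Max UNIV) * (1 + cnj (w $ Max UNIV)))"
    by (simp del: of_real_power)
  also have "Re ((1 - w $ Max UNIV) * (1 + cnj (w $ Max UNIV))) = 1 - (cmod (w $ Max UNIV))\<^sup>2"
    by (simp add: cmod_power2) (simp add: algebra_simps power2_eq_square)
  finally have eq: "Re (herm (lift_pt u) (g *v lift_pt (tip 1)) * cnj (herm (lift_pt u) (g *v lift_pt (tip (-1)))))
     = (cmod (autj g w))\<^sup>2 * (1 - (cmod (w $ Max UNIV))\<^sup>2)" .
  have "cmod (w $ Max UNIV) < 1"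
    using Finite_Cartesian_Product.norm_nth_le[of w "Max UNIV"] w by simp
  then have "(cmod (w $ Max UNIV))\<^sup>2 < 1" by (simp add: abs_square_less_1)
  then show ?thesis
    unfolding eq using autj_neq_0[OF g w'] by simp
qed

lemma reproducing_line_integral:
  assumes g: "g \<in> carrier SU" and u: "u \<in> ball 0 1" and k: "k > 0"
    and X: "repelling_pt \<gamma> = act g (tip (-1))" and Y: "attracting_pt \<gamma> = act g (tip 1)"
  shows "\<exists>\<Psi>. (\<forall>s t. s \<le> t \<longrightarrow> (\<integral>r. indicator {s..t} r *\<^sub>R reproducing_term k f (axis_vec g r) u \<partial>lborel) = \<Psi> t - \<Psi> s) \<and>
     (\<Psi> \<longlongrightarrow> 0) at_bot \<and>
     (\<Psi> \<longlongrightarrow> of_real (beta_const k) * axis_scale g ^ k * (f u * cnj (qfun k \<gamma> u) * of_real (height u ^ (2 * k)))) at_top"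
proof -
  let ?a = "herm (lift_pt u) (g *v lift_pt (tip 1))"
  let ?b = "herm (lift_pt u) (g *v lift_pt (tip (-1)))"
  let ?E = "\<lambda>t::real. of_real (exp t) * ?a + of_real (exp (- t)) * ?b"
  let ?C = "f u * of_real (height u ^ (2 * k))"
  obtain \<Phi> where \<Phi>: "\<And>s t. s \<le> t \<Longrightarrow> ((\<lambda>t. inverse ((?E t / 2) ^ (2 * k))) has_integral \<Phi> t - \<Phi> s) {s..t}"
    and bot: "(\<Phi> \<longlongrightarrow> 0) at_bot"
    and top: "(\<Phi> \<longlongrightarrow> of_real (2 ^ (2 * k - 1) * (fact (k - 1))\<^sup>2 / fact (2 * k - 1)) * inverse ((?a * ?b) ^ k)) at_top"
    using kernel_line_integral(2)[OF axis_kernel_positive[OF g u] k] by blast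
  have E0: "?E t \<noteq> 0" for t
    by (rule kernel_line_integral(1)[OF axis_kernel_positive[OF g u] k])
  define \<Psi> where "\<Psi> t = ?C * cnj (\<Phi> t)" for t
  have R: "reproducing_term k f (axis_vec g r) u = ?C * cnj (inverse ((?E r / 2) ^ (2 * k)))" for r
    using u by (simp add: reproducing_term_def kernel_def herm_axis_vec)
  have "(\<integral>r. indicator {s..t} r *\<^sub>R reproducing_term k f (axis_vec g r) u \<partial>lborel) = \<Psi> t - \<Psi> s" if st: "s \<le> t" for s t
  proof -
    have "continuous_on {s..t} (\<lambda>r. ?C * cnj (inverse ((?E r / 2) ^ (2 * k))))"
      using E0 by (intro continuous_intros) auto
    then have int: "set_integrable lborel {s..t} (\<lambda>r. ?C * cnj (inverse ((?E r / 2) ^ (2 * k))))"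
      by (rule borel_integrable_atLeastAtMost')
    have "((cnj \<circ> (\<lambda>t. inverse ((?E t / 2) ^ (2 * k)))) has_integral cnj (\<Phi> t - \<Phi> s)) {s..t}"
      unfolding has_integral_cnj by (rule \<Phi>[OF st])
    then have "((\<lambda>r. ?C * (cnj \<circ> (\<lambda>t. inverse ((?E t / 2) ^ (2 * k)))) r) has_integral ?C * cnj (\<Phi> t - \<Phi> s)) {s..t}"
      by (rule has_integral_mult_right)
    then have "integral {s..t} (\<lambda>r. ?C * cnj (inverse ((?E r / 2) ^ (2 * k)))) = \<Psi> t - \<Psi> s"
      unfolding o_def \<Psi>_def complex_cnj_diff right_diff_distrib by (rule integral_unique)
    then show ?thesis
      unfolding R using set_borel_integral_eq_integral(2)[OF int] by (simp only: set_lebesgue_integral_def)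
  qed
  moreover have "(\<Psi> \<longlongrightarrow> 0) at_bot"
  proof -
    have "(\<Psi> \<longlongrightarrow> ?C * cnj 0) at_bot"
      unfolding \<Psi>_def by (intro tendsto_intros bot)
    then show ?thesis by simp
  qed
  moreover have "(\<Psi> \<longlongrightarrow> of_real (beta_const k) * axis_scale g ^ k * (f u * cnj (qfun k \<gamma> u) * of_real (height u ^ (2 * k)))) at_top"
  proof -
    have s0: "axis_scale g \<noteq> 0" by (rule axis_scale_neq_0[OF g])
    have "Qform \<gamma> u ^ k = cnj (axis_scale g) ^ k * (?a * ?b) ^ k"
      unfolding Qform_axis[OF g X Y] by (simp only: power_mult_distrib mult_ac)
    then have "inverse ((?a * ?b) ^ k) = cnj (axis_scale g) ^ k * qfun k \<gamma> u"
      using s0 by (simp add: qfun_def)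
    then have "cnj (of_real (2 ^ (2 * k - 1) * (fact (k - 1))\<^sup>2 / fact (2 * k - 1)) * inverse ((?a * ?b) ^ k))
       = of_real (beta_const k) * (axis_scale g ^ k * cnj (qfun k \<gamma> u))"
      by (simp only: beta_const_def complex_cnj_mult complex_cnj_complex_of_real complex_cnj_power complex_cnj_cnj)
    moreover have "(\<Psi> \<longlongrightarrow> ?C * cnj (of_real (2 ^ (2 * k - 1) * (fact (k - 1))\<^sup>2 / fact (2 * k - 1)) * inverse ((?a * ?b) ^ k))) at_top"
      unfolding \<Psi>_def by (intro tendsto_mult tendsto_const tendsto_cnj top)
    ultimately show ?thesis by (simp only: mult_ac)
  qed
  ultimately show ?thesis by blast
qed

lemma filterlim_symmetric_intervals:
  "filterlim (\<lambda>N. {- int N..int N}) (finite_subsets_at_top UNIV) sequentially"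
proof (rule filterlim_finite_subsets_at_top[THEN iffD2], intro allI impI)
  fix X :: "int set" assume X: "finite X \<and> X \<subseteq> UNIV"
  define N0 where "N0 = nat (Max (insert 0 (abs ` X)))"
  have "X \<subseteq> {- int N..int N}" if "N \<ge> N0" for N
  proof
    fix x assume "x \<in> X"
    then have "\<bar>x\<bar> \<le> Max (insert 0 (abs ` X))"
      using X by (intro Max_ge) auto
    also have "\<dots> \<le> int N" using that by (simp add: N0_def)
    finally show "x \<in> {- int N..int N}" by auto
  qed
  then show "\<forall>\<^sub>F N in sequentially. finite {- int N..int N} \<and> X \<subseteq> {- int N..int N} \<and> {- int N..int N} \<subseteq> UNIV"
    unfolding eventually_sequentially by (intro exI[of _ N0]) auto
qed

text \<open>An unconditionally convergent sum over the integers is the limit of its sums over \<open>{-N..N}\<close>, and these telescope.\<close>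
lemma infsum_telescope:
  fixes A :: "int \<Rightarrow> complex"
  assumes sum: "(\<lambda>m. A (1 - m) - A (- m)) summable_on UNIV"
    and top: "(\<lambda>N. A (int N)) \<longlonglongrightarrow> L" and bot: "(\<lambda>N. A (- int N)) \<longlonglongrightarrow> 0"
  shows "infsum (\<lambda>m. A (1 - m) - A (- m)) UNIV = L"
proof -
  have tele: "sum (\<lambda>m. A (1 - m) - A (- m)) {- int N..int N} = A (int (Suc N)) - A (- int N)" for N
  proof (induction N)
    case 0
    then show ?case by simp
  next
    case (Suc N)
    have "{- int (Suc N)..int (Suc N)} = insert (int (Suc N)) (insert (- int (Suc N)) {- int N..int N})"
      by auto
    then have "sum (\<lambda>m. A (1 - m) - A (- m)) {- int (Suc N)..int (Suc N)}
        = (A (1 - int (Suc N)) - A (- int (Suc N))) + ((A (1 + int (Suc N)) - A (int (Suc N))) + (A (int (Suc N)) - A (- int N)))"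
      by (simp only: Suc) (simp add: Suc add.commute)
    then show ?case by (simp add: add.commute)
  qed
  have "((\<lambda>m. A (1 - m) - A (- m)) has_sum infsum (\<lambda>m. A (1 - m) - A (- m)) UNIV) UNIV"
    by (rule has_sum_infsum[OF sum])
  then have "(sum (\<lambda>m. A (1 - m) - A (- m)) \<longlongrightarrow> infsum (\<lambda>m. A (1 - m) - A (- m)) UNIV) (finite_subsets_at_top UNIV)"
    by (simp add: has_sum_def)
  from filterlim_compose[OF this filterlim_symmetric_intervals]
  have "(\<lambda>N. A (int (Suc N)) - A (- int N)) \<longlonglongrightarrow> infsum (\<lambda>m. A (1 - m) - A (- m)) UNIV"
    by (simp only: tele)
  moreover have "(\<lambda>N. A (int (Suc N)) - A (- int N)) \<longlonglongrightarrow> L - 0"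
    by (intro tendsto_diff LIMSEQ_Suc[OF top] bot)
  ultimately show ?thesis
    using LIMSEQ_unique by fastforce
qed

section \<open>Averages of kernels over one period\<close>

definition axis_average :: "nat \<Rightarrow> (complex^('n::{finite,linorder}) \<Rightarrow> complex) \<Rightarrow> complex^('n option)^('n option) \<Rightarrow>
    real \<Rightarrow> real \<Rightarrow> complex^('n::{finite,linorder}) \<Rightarrow> complex" where
  "axis_average k f g t0 t1 z = (\<integral>t. indicator {t0..t1} t *\<^sub>R reproducing_term k f (axis_vec g t) z \<partial>lborel)"

lemma borel_measurable_axis_term:
  fixes f :: "complex^('n::{finite,linorder}) \<Rightarrow> complex"
  assumes f: "continuous_on (ball 0 1) f"
  shows "(\<lambda>(t, z). indicator {t0..t1::real} t *\<^sub>R reproducing_term k f (axis_vec g t) z) \<in> borel_measurable (lborel \<Otimes>\<^sub>M inv_vol)"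
proof -
  define F where "F z = indicator (ball 0 1) z *\<^sub>R f z" for z
  have F [measurable]: "F \<in> borel_measurable borel"
    unfolding F_def by (rule borel_measurable_continuous_on_indicator[OF _ f]) simp
  define a where "a z = herm (lift_pt z) (g *v lift_pt (tip 1))" for z :: "(complex, 'n) vec"
  define b where "b z = herm (lift_pt z) (g *v lift_pt (tip (-1)))" for z :: "(complex, 'n) vec"
  have [measurable]: "a \<in> borel_measurable borel" "b \<in> borel_measurable borel"
    unfolding a_def b_def by measurable
  have [measurable]: "cnj \<in> borel_measurable borel"
    by (intro borel_measurable_continuous_onI continuous_intros)
  have "(\<lambda>p. indicator {t0..t1} (fst p) *\<^sub>R (F (snd p) *
      cnj (inverse (((of_real (exp (fst p)) * a (snd p) + of_real (exp (- fst p)) * b (snd p)) / 2) ^ (2 * k))) *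
      of_real (height (snd p) ^ (2 * k)))) \<in> borel_measurable (lborel \<Otimes>\<^sub>M inv_vol)"
    by measurable
  then show ?thesis
    by (simp add: case_prod_unfold reproducing_term_def kernel_def herm_axis_vec F_def a_def b_def)
qed

text \<open>Fubini, justified by the bound in \<open>reproducing_formula\<close>, which does not depend on the point of the axis.\<close>
lemma axis_average_integral:
  fixes f :: "complex^('n::{finite,linorder}) \<Rightarrow> complex"
  assumes hol: "holomorphic_vec_on f (ball 0 1)" and M: "\<forall>z\<in>ball 0 1. cmod (f z) * height z ^ k \<le> M"
    and k: "CARD('n) + 1 \<le> k" and g: "g \<in> carrier SU"
  shows "integrable inv_vol (axis_average k f g t0 t1)"
    and "(\<integral>z. axis_average k f g t0 t1 z \<partial>inv_vol) =
       of_real (4 ^ CARD('n) * pi ^ CARD('n) * fact (2 * k - CARD('n) - 1) / fact (2 * k - 1))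
       * integral {t0..t1} (\<lambda>t. slash k f (g ** a_mat t) 0)"
proof -
  let ?V = "inv_vol :: ((complex, 'n) vec) measure"
  let ?K = "M * (\<integral>z. indicator (ball 0 1) z * height z ^ k \<partial>?V)"
  let ?v = "4 ^ CARD('n) * pi ^ CARD('n) * fact (2 * k - CARD('n) - 1) / fact (2 * k - 1) :: real"
  let ?H = "\<lambda>t z. indicator {t0..t1::real} t *\<^sub>R reproducing_term k f (axis_vec g t) z"
  have G: "g ** a_mat t \<in> carrier SU" for t by (intro SU_mult_closed g a_mat_SU)
  note rep = reproducing_formula[OF hol M k G, folded axis_vec_def]
  have meas: "(\<lambda>(t, z). ?H t z) \<in> borel_measurable (lborel \<Otimes>\<^sub>M ?V)"
    by (rule borel_measurable_axis_term[OF holomorphic_vec_continuous[OF hol]])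
  interpret V: sigma_finite_measure ?V by (rule sigma_finite_inv_vol)
  interpret pair_sigma_finite lborel ?V ..
  have Hint: "integrable (lborel \<Otimes>\<^sub>M ?V) (\<lambda>(t, z). ?H t z)"
  proof (rule Fubini_integrable[OF meas])
    show "AE t in lborel. integrable ?V (\<lambda>z. case (t, z) of (t, z) \<Rightarrow> ?H t z)"
      using rep(1) by (intro AE_I2) simp
    have nn: "(\<integral>z. norm (case (t, z) of (t, z) \<Rightarrow> ?H t z) \<partial>?V) = indicator {t0..t1} t * (\<integral>z. norm (reproducing_term k f (axis_vec g t) z) \<partial>?V)" for t
      by simp
    show "integrable lborel (\<lambda>t. \<integral>z. norm (case (t, z) of (t, z) \<Rightarrow> ?H t z) \<partial>?V)"
    proof (rule Bochner_Integration.integrable_bound)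
      show "integrable lborel (\<lambda>t::real. indicator {t0..t1} t * ?K)"
        by (intro integrable_mult_left integrable_real_indicator) (auto simp: emeasure_lborel_Icc_eq)
      show "(\<lambda>t. \<integral>z. norm (case (t, z) of (t, z) \<Rightarrow> ?H t z) \<partial>?V) \<in> borel_measurable lborel"
      proof (rule V.borel_measurable_lebesgue_integral)
        show "(\<lambda>(t, z). norm (case (t, z) of (t, z) \<Rightarrow> ?H t z)) \<in> borel_measurable (lborel \<Otimes>\<^sub>M ?V)"
          using measurable_compose[OF meas borel_measurable_norm]
          by (simp only: case_prod_unfold fst_conv snd_conv)
      qed
      show "AE t in lborel. norm (\<integral>z. norm (case (t, z) of (t, z) \<Rightarrow> ?H t z) \<partial>?V) \<le> norm (indicator {t0..t1} t * ?K)"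
      proof (rule AE_I2)
        fix t
        have "0 \<le> (\<integral>z. norm (reproducing_term k f (axis_vec g t) z) \<partial>?V)" by simp
        then have "\<bar>\<integral>z. norm (reproducing_term k f (axis_vec g t) z) \<partial>?V\<bar> \<le> \<bar>?K\<bar>"
          using rep(2)[of t] by linarith
        then show "norm (\<integral>z. norm (case (t, z) of (t, z) \<Rightarrow> ?H t z) \<partial>?V) \<le> norm (indicator {t0..t1} t * ?K)"
          unfolding nn real_norm_def abs_mult by (rule mult_left_mono) simp
      qed
    qed
  qed
  have "integrable ?V (\<lambda>z. \<integral>t. ?H t z \<partial>lborel)"
    by (rule integrable_snd[OF Hint])
  then show "integrable inv_vol (axis_average k f g t0 t1)"
    by (simp add: axis_average_def[abs_def])
  have inner: "(\<integral>z. ?H t z \<partial>?V) = indicator {t0..t1} t *\<^sub>R (of_real ?v * slash k f (g ** a_mat t) 0)" for t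
    unfolding integral_scaleR_right rep(3) by (simp only: mult.commute)
  have "integrable lborel (\<lambda>t. \<integral>z. ?H t z \<partial>?V)"
    by (rule integrable_fst[OF Hint])
  then have "set_integrable lborel {t0..t1} (\<lambda>t. of_real ?v * slash k f (g ** a_mat t) 0)"
    unfolding inner set_integrable_def .
  from set_borel_integral_eq_integral(2)[OF this]
  have "(\<integral>t. indicator {t0..t1} t *\<^sub>R (of_real ?v * slash k f (g ** a_mat t) 0) \<partial>lborel)
      = integral {t0..t1} (\<lambda>t. of_real ?v * slash k f (g ** a_mat t) 0)"
    unfolding set_lebesgue_integral_def .
  also have "\<dots> = of_real ?v * integral {t0..t1} (\<lambda>t. slash k f (g ** a_mat t) 0)"
    by (rule integral_mult_right)
  finally have I: "(\<integral>t. \<integral>z. ?H t z \<partial>?V \<partial>lborel) = of_real ?v * integral {t0..t1} (\<lambda>t. slash k f (g ** a_mat t) 0)"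
    unfolding inner .
  have "(\<integral>z. axis_average k f g t0 t1 z \<partial>?V) = (\<integral>z. \<integral>t. ?H t z \<partial>lborel \<partial>?V)"
    by (simp only: axis_average_def)
  also have "\<dots> = (\<integral>t. \<integral>z. ?H t z \<partial>?V \<partial>lborel)"
    by (rule Fubini_integral[OF Hint])
  finally show "(\<integral>z. axis_average k f g t0 t1 z \<partial>inv_vol) = of_real ?v * integral {t0..t1} (\<lambda>t. slash k f (g ** a_mat t) 0)"
    unfolding I .
qed

text \<open>The \<open>m\<close>-th translate of the period integral is the integral over the period shifted by \<open>-m T\<close>, that is, a difference of
values of a primitive \<open>\<Psi>\<close>. The values telescope to the integral over the whole line. Only the convergence of the sum is
assumed; it holds almost everywhere by unfolding.\<close>
lemma axis_average_orbit_sum: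
  fixes f :: "complex^('n::{finite,linorder}) \<Rightarrow> complex"
  assumes g: "g \<in> carrier SU" and \<gamma>: "\<gamma> \<in> carrier SU" and k: "k > 0" and t01: "t0 < t1"
    and f: "\<And>m u. u \<in> ball 0 1 \<Longrightarrow> slash k f (SU_pow \<gamma> m) u = f u"
    and pow: "\<And>m. \<exists>d. d ^ (2 * k) = 1 \<and> (\<forall>t. SU_pow \<gamma> m *v axis_vec g t = d *s axis_vec g (t + of_int m * (t1 - t0)))"
    and X: "repelling_pt \<gamma> = act g (tip (-1))" and Y: "attracting_pt \<gamma> = act g (tip 1)"
    and u: "u \<in> ball 0 1"
    and sum: "(\<lambda>m. axis_average k f g t0 t1 (act (SU_pow \<gamma> m) u)) summable_on UNIV"
  shows "infsum (\<lambda>m. axis_average k f g t0 t1 (act (SU_pow \<gamma> m) u)) UNIV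
      = of_real (beta_const k) * axis_scale g ^ k * (f u * cnj (qfun k \<gamma> u) * of_real (height u ^ (2 * k)))" (is "_ = ?L")
proof -
  define T where "T = t1 - t0"
  have T: "T > 0" using t01 by (simp add: T_def)
  obtain \<Psi> where \<Psi>: "\<And>s t. s \<le> t \<Longrightarrow> (\<integral>r. indicator {s..t} r *\<^sub>R reproducing_term k f (axis_vec g r) u \<partial>lborel) = \<Psi> t - \<Psi> s"
    and bot: "(\<Psi> \<longlongrightarrow> 0) at_bot" and top: "(\<Psi> \<longlongrightarrow> ?L) at_top"
    using reproducing_line_integral[OF g u k X Y, of f] by blast
  define A where "A j = \<Psi> (t0 + of_int j * T)" for j
  have term_eq: "axis_average k f g t0 t1 (act (SU_pow \<gamma> m) u) = A (1 - m) - A (- m)" for m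
  proof -
    obtain d where d: "d ^ (2 * k) = 1" "\<And>t. SU_pow \<gamma> m *v axis_vec g t = d *s axis_vec g (t + of_int m * T)"
      using pow[of m] unfolding T_def[symmetric] by blast
    have tr: "reproducing_term k f (axis_vec g (t + of_int m * T)) (act (SU_pow \<gamma> m) u) = reproducing_term k f (axis_vec g t) u" for t
      by (rule reproducing_term_translate[OF SU_pow_closed[OF \<gamma>] u f[OF u] d(2) d(1)])
    have "axis_average k f g t0 t1 (act (SU_pow \<gamma> m) u)
        = (\<integral>r. indicator {t0..t1} (of_int m * T + 1 * r) *\<^sub>R reproducing_term k f (axis_vec g (of_int m * T + 1 * r)) (act (SU_pow \<gamma> m) u) \<partial>lborel)"
      unfolding axis_average_def by (subst lborel_integral_real_affine[of 1 _ "of_int m * T"]) simp_all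
    also have "\<dots> = (\<integral>r. indicator {t0 - of_int m * T..t1 - of_int m * T} r *\<^sub>R reproducing_term k f (axis_vec g r) u \<partial>lborel)"
    proof (rule Bochner_Integration.integral_cong[OF refl])
      fix r
      have "of_int m * T + 1 * r \<in> {t0..t1} \<longleftrightarrow> r \<in> {t0 - of_int m * T..t1 - of_int m * T}"
        by auto
      then show "indicator {t0..t1} (of_int m * T + 1 * r) *\<^sub>R reproducing_term k f (axis_vec g (of_int m * T + 1 * r)) (act (SU_pow \<gamma> m) u)
        = indicator {t0 - of_int m * T..t1 - of_int m * T} r *\<^sub>R reproducing_term k f (axis_vec g r) u"
        using tr[of r] by (simp add: indicator_def add.commute)
    qed
    also have "\<dots> = \<Psi> (t1 - of_int m * T) - \<Psi> (t0 - of_int m * T)"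
      using t01 by (intro \<Psi>) simp
    also have "\<dots> = A (1 - m) - A (- m)"
      by (simp add: A_def T_def algebra_simps)
    finally show ?thesis .
  qed
  show ?thesis
    unfolding term_eq
  proof (rule infsum_telescope)
    show "(\<lambda>m. A (1 - m) - A (- m)) summable_on UNIV"
      using sum unfolding term_eq .
    have "filterlim (\<lambda>N. t0 + real N * T) at_top sequentially"
      using T by real_asymp
    from filterlim_compose[OF top this] show "(\<lambda>N. A (int N)) \<longlonglongrightarrow> ?L"
      by (simp add: A_def)
    have "filterlim (\<lambda>N. t0 + - real N * T) at_bot sequentially"
      using T by real_asymp
    from filterlim_compose[OF bot this] show "(\<lambda>N. A (- int N)) \<longlonglongrightarrow> 0"
      by (simp add: A_def)
  qed
qed

text \<open>The right cosets of the cyclic group generated by \<open>\<gamma>\<close>, written out as sets of products.\<close>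
definition cyclic_cosets :: "(complex^('n::finite option)^('n option)) set \<Rightarrow> complex^('n option)^('n option) \<Rightarrow> (complex^('n option)^('n option)) set set" where
  "cyclic_cosets \<Gamma> \<gamma> = (\<lambda>\<delta>. range (\<lambda>m. SU_pow \<gamma> m ** \<delta>)) ` \<Gamma>"

lemma rcosets_eq_cyclic_cosets:
  assumes "\<gamma> \<in> carrier SU"
  shows "rcosets\<^bsub>SU\<lparr>carrier := \<Gamma>\<rparr>\<^esub> (generate SU {\<gamma>}) = cyclic_cosets \<Gamma> \<gamma>"
proof -
  have "generate SU {\<gamma>} = range (SU_pow \<gamma>)"
    using group.generate_pow[OF group_SU assms] by (auto simp: image_def)
  then show ?thesis
    by (auto simp: RCOSETS_def r_coset_def cyclic_cosets_def image_def)
qed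

lemma cyclic_coset_eq:
  assumes \<gamma>: "\<gamma> \<in> carrier SU" and \<delta>: "\<delta> \<in> range (\<lambda>m. SU_pow \<gamma> m ** \<epsilon>)"
  shows "range (\<lambda>m. SU_pow \<gamma> m ** \<epsilon>) = range (\<lambda>m. SU_pow \<gamma> m ** \<delta>)"
proof -
  obtain n where n: "\<delta> = SU_pow \<gamma> n ** \<epsilon>" using \<delta> by blast
  have 1: "SU_pow \<gamma> m ** \<delta> = SU_pow \<gamma> (m + n) ** \<epsilon>" for m
    by (simp only: n SU_pow_add[OF \<gamma>] matrix_mul_assoc)
  have 2: "SU_pow \<gamma> m ** \<epsilon> = SU_pow \<gamma> (m - n) ** \<delta>" for m
    by (simp add: 1)
  show ?thesis
  proof
    show "range (\<lambda>m. SU_pow \<gamma> m ** \<epsilon>) \<subseteq> range (\<lambda>m. SU_pow \<gamma> m ** \<delta>)"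
      unfolding 2 by blast
    show "range (\<lambda>m. SU_pow \<gamma> m ** \<delta>) \<subseteq> range (\<lambda>m. SU_pow \<gamma> m ** \<epsilon>)"
      unfolding 1 by blast
  qed
qed

lemma cyclic_cosets_facts:
  assumes \<Gamma>: "subgroup \<Gamma> SU" and \<gamma>: "\<gamma> \<in> \<Gamma>" and C: "C \<in> cyclic_cosets \<Gamma> \<gamma>"
  shows "C \<subseteq> \<Gamma>" and "\<delta> \<in> C \<Longrightarrow> C = range (\<lambda>m. SU_pow \<gamma> m ** \<delta>)" and "(SOME \<delta>. \<delta> \<in> C) \<in> C"
proof -
  have \<gamma>c: "\<gamma> \<in> carrier SU" by (rule subgroup_in_SU[OF \<Gamma> \<gamma>])
  obtain \<epsilon> where \<epsilon>: "\<epsilon> \<in> \<Gamma>" "C = range (\<lambda>m. SU_pow \<gamma> m ** \<epsilon>)"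
    using C by (auto simp: cyclic_cosets_def)
  have "SU_pow \<gamma> m \<in> \<Gamma>" for m
    by (rule group.subgroup_int_pow_closed[OF group_SU \<Gamma> \<gamma>])
  then show "C \<subseteq> \<Gamma>"
    using \<epsilon> subgroup_mult[OF \<Gamma>] by auto
  show "\<delta> \<in> C \<Longrightarrow> C = range (\<lambda>m. SU_pow \<gamma> m ** \<delta>)"
    unfolding \<epsilon>(2) by (rule cyclic_coset_eq[OF \<gamma>c])
  show "(SOME \<delta>. \<delta> \<in> C) \<in> C"
  proof (rule someI)
    show "SU_pow \<gamma> 0 ** \<epsilon> \<in> C"
      unfolding \<epsilon>(2) by (rule rangeI)
  qed
qed

text \<open>The cosets partition \<open>\<Gamma>\<close>: the disjoint union of the cosets maps bijectively to \<open>\<Gamma>\<close>, because every element determines its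
coset.\<close>
lemma infsum_cyclic_cosets:
  fixes F :: "complex^('n::finite option)^('n option) \<Rightarrow> complex"
  assumes \<Gamma>: "subgroup \<Gamma> SU" and \<gamma>: "\<gamma> \<in> \<Gamma>" and sum: "F summable_on \<Gamma>"
  shows "infsum F \<Gamma> = infsum (\<lambda>C. infsum F C) (cyclic_cosets \<Gamma> \<gamma>)"
proof -
  let ?R = "cyclic_cosets \<Gamma> \<gamma>"
  note fac = cyclic_cosets_facts[OF \<Gamma> \<gamma>]
  have \<gamma>c: "\<gamma> \<in> carrier SU" by (rule subgroup_in_SU[OF \<Gamma> \<gamma>])
  have bij: "bij_betw snd (Sigma ?R (\<lambda>C. C)) \<Gamma>"
  proof (rule bij_betw_imageI)
    show "inj_on snd (Sigma ?R (\<lambda>C. C))"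
    proof (rule inj_onI)
      fix p q assume p: "p \<in> Sigma ?R (\<lambda>C. C)" and q: "q \<in> Sigma ?R (\<lambda>C. C)" and eq: "snd p = snd q"
      have "fst p = range (\<lambda>m. SU_pow \<gamma> m ** snd p)"
        using p by (intro fac(2)) auto
      moreover have "fst q = range (\<lambda>m. SU_pow \<gamma> m ** snd q)"
        using q by (intro fac(2)) auto
      ultimately show "p = q" using eq by (simp add: prod_eq_iff)
    qed
    show "snd ` Sigma ?R (\<lambda>C. C) = \<Gamma>"
    proof
      show "snd ` Sigma ?R (\<lambda>C. C) \<subseteq> \<Gamma>" by (auto dest: fac(1)[THEN subsetD])
      show "\<Gamma> \<subseteq> snd ` Sigma ?R (\<lambda>C. C)"
      proof
        fix \<delta> assume "\<delta> \<in> \<Gamma>"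
        moreover have "\<delta> = SU_pow \<gamma> 0 ** \<delta>" by (simp add: SU_pow_0[OF \<gamma>c])
        ultimately have "(range (\<lambda>m. SU_pow \<gamma> m ** \<delta>), \<delta>) \<in> Sigma ?R (\<lambda>C. C)"
          unfolding cyclic_cosets_def by blast
        then show "\<delta> \<in> snd ` Sigma ?R (\<lambda>C. C)" by force
      qed
    qed
  qed
  have "(\<lambda>p. F (snd p)) summable_on Sigma ?R (\<lambda>C. C)"
    using summable_on_reindex_bij_betw[OF bij, of F] sum by simp
  then have "(\<lambda>(C, \<delta>). F \<delta>) summable_on Sigma ?R (\<lambda>C. C)"
    by (simp add: case_prod_unfold)
  from infsum_Sigma'_banach[OF this]
  have "infsum (\<lambda>C. infsum F C) ?R = infsum (\<lambda>p. F (snd p)) (Sigma ?R (\<lambda>C. C))"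
    by (simp add: case_prod_unfold)
  also have "\<dots> = infsum F \<Gamma>"
    by (rule infsum_reindex_bij_betw[OF bij])
  finally show ?thesis ..
qed

section \<open>The inner product with the relative Poincare series\<close>

text \<open>As an integral over the countable set of cosets the series is measurable even where it does not converge.\<close>
lemma borel_measurable_rel_poincare:
  assumes \<Gamma>: "subgroup \<Gamma> SU" and disc: "discrete \<Gamma>" and \<gamma>: "\<gamma> \<in> \<Gamma>"
  shows "rel_poincare k \<Gamma> \<gamma> \<in> borel_measurable borel"
proof -
  have \<gamma>c: "\<gamma> \<in> carrier SU" by (rule subgroup_in_SU[OF \<Gamma> \<gamma>])
  have cnt: "countable (cyclic_cosets \<Gamma> \<gamma>)"
    unfolding cyclic_cosets_def by (intro countable_image countable_discrete_subgroup[OF \<Gamma> disc])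
  interpret sigma_finite_measure "count_space (cyclic_cosets \<Gamma> \<gamma>)"
    by (rule sigma_finite_measure_count_space_countable[OF cnt])
  have [measurable]: "qfun k \<gamma> \<in> borel_measurable borel"
    unfolding qfun_def[abs_def] Qform_def by measurable
  have sl: "slash k (qfun k \<gamma>) \<delta> \<in> borel_measurable borel" for \<delta>
    unfolding slash_def[abs_def] by measurable
  have "(\<lambda>(C, z). slash k (qfun k \<gamma>) (SOME \<delta>. \<delta> \<in> C) z) \<in> borel_measurable (count_space (cyclic_cosets \<Gamma> \<gamma>) \<Otimes>\<^sub>M borel)"
    by (rule measurable_pair_measure_countable1[OF cnt]) (simp add: sl)
  from measurable_pair_swap[OF this]
  have "(\<lambda>(z, C). slash k (qfun k \<gamma>) (SOME \<delta>. \<delta> \<in> C) z) \<in> borel_measurable (borel \<Otimes>\<^sub>M count_space (cyclic_cosets \<Gamma> \<gamma>))"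
    by (simp add: case_prod_unfold)
  from borel_measurable_lebesgue_integral[OF this]
  show ?thesis
    by (simp add: rel_poincare_def[abs_def] rcosets_eq_cyclic_cosets[OF \<gamma>c] infsum_eq_integral_count_space)
qed

lemma slash_pair_invariant:
  assumes \<delta>: "\<delta> \<in> carrier SU" and z: "z \<in> ball 0 1" and f: "slash k f \<delta> z = f z"
  shows "f (act \<delta> z) * cnj (q (act \<delta> z)) * of_real (height (act \<delta> z) ^ (2 * k))
    = f z * cnj (slash k q \<delta> z) * of_real (height z ^ (2 * k))"
proof -
  have z': "z \<in> cball 0 1" using z by auto
  have "complex_of_real ((cmod (autj \<delta> z))\<^sup>2) ^ (2 * k) = (autj \<delta> z * cnj (autj \<delta> z)) ^ (2 * k)"
    by (simp only: complex_norm_square)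
  then have h: "complex_of_real (height (act \<delta> z) ^ (2 * k)) = autj \<delta> z ^ (2 * k) * cnj (autj \<delta> z ^ (2 * k)) * of_real (height z ^ (2 * k))"
    by (simp add: height_act[OF \<delta> z'] power_mult_distrib)
  show ?thesis
    unfolding h f[symmetric] by (simp add: slash_def)
qed

text \<open>The proof computes the integral of the period average over the ball in two ways. Unfolding gives a sum over \<open>\<Gamma>\<close> inside
the fundamental domain, which regroups into the series (\<open>orbit_sum\<close>); Fubini and the reproducing formula give the
integral over the period. A constant factor may be
moved across an infinite sum whether or not it converges, which pulls the constants out of the series.\<close>
lemma petersson_rel_poincare:
  fixes \<Gamma> :: "(complex^('n::{finite,linorder} option)^('n option)) set"
    and f :: "complex^('n::{finite,linorder}) \<Rightarrow> complex"
  assumes \<Gamma>: "subgroup \<Gamma> SU" and disc: "discrete \<Gamma>"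
    and k: "CARD('n) + 1 \<le> k" and f: "f \<in> cusp_forms k \<Gamma>"
    and \<gamma>: "\<gamma> \<in> \<Gamma>" and lox: "loxodromic \<gamma>"
    and inv: "slash k (qfun k \<gamma>) \<gamma> 0 = qfun k \<gamma> 0"
    and ax: "axis_geodesic \<gamma> g" and shift: "geodesic g t1 = act \<gamma> (geodesic g t0)"
  shows "of_real (beta_const k) * axis_scale g ^ k * petersson k \<Gamma> f (rel_poincare k \<Gamma> \<gamma>)
    = of_real (4 ^ CARD('n) * pi ^ CARD('n) * fact (2 * k - CARD('n) - 1) / fact (2 * k - 1))
       * integral {t0..t1} (\<lambda>t. slash k f (g ** a_mat t) 0)"
proof -
  let ?V = "inv_vol :: ((complex, 'n) vec) measure"
  let ?\<phi> = "axis_average k f g t0 t1"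
  let ?\<Theta> = "rel_poincare k \<Gamma> \<gamma>"
  let ?\<kappa> = "of_real (beta_const k) * axis_scale g ^ k :: complex"
  let ?st = "\<lambda>z. of_nat (card {\<gamma>\<in>\<Gamma>. act \<gamma> z = z}) :: complex"
  have g: "g \<in> carrier SU" using ax by (simp add: axis_geodesic_def)
  have \<gamma>c: "\<gamma> \<in> carrier SU" by (rule subgroup_in_SU[OF \<Gamma> \<gamma>])
  have k0: "k > 0" using k by simp
  note tr = axis_translation[OF \<gamma>c lox ax shift]
  obtain c where step: "\<And>t. \<gamma> *v axis_vec g t = c *s axis_vec g (t + (t1 - t0))"
    and cc: "inverse (autj \<gamma> (attracting_pt \<gamma>)) * inverse (autj \<gamma> (repelling_pt \<gamma>)) = c * c"
    and fixX: "act \<gamma> (repelling_pt \<gamma>) = repelling_pt \<gamma>" and fixY: "act \<gamma> (attracting_pt \<gamma>) = attracting_pt \<gamma>"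
    using tr(4) by blast
  have "repelling_pt \<gamma> \<in> cball 0 1" "attracting_pt \<gamma> \<in> cball 0 1"
    unfolding tr(1,2) by (intro act_in_cball[OF g]; simp add: norm_tip)+
  then have phase: "c ^ (2 * k) = 1"
    using translation_phase[OF \<gamma>c _ fixX _ fixY cc inv] by blast
  note pow = axis_vec_pow[OF \<gamma>c step phase k0]
  have inj: "inj (SU_pow \<gamma>)"
    using tr(3) by (intro SU_pow_inj[OF g _ k0 pow]) simp
  have pow\<Gamma>: "SU_pow \<gamma> m \<in> \<Gamma>" for m
    by (rule group.subgroup_int_pow_closed[OF group_SU \<Gamma> \<gamma>])
  note fac = cusp_form_facts[OF f]
  obtain M where M: "\<forall>z\<in>ball 0 1. cmod (f z) * height z ^ k \<le> M"
    using fac(3) by blast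
  note avg = axis_average_integral[OF fac(1) M k g, of t0 t1]
  define D where "D = (SOME D. fundamental_domain \<Gamma> D)"
  have D: "fundamental_domain \<Gamma> D"
    unfolding D_def using fundamental_domain_exists[OF \<Gamma> disc] by (rule someI_ex)
  have Dm: "D \<in> sets borel" and DB: "D \<subseteq> ball 0 1"
    using D by (simp_all add: fundamental_domain_def)
  have orbit_sum: "infsum (\<lambda>\<delta>. ?\<phi> (act \<delta> z)) \<Gamma> = ?\<kappa> * (f z * cnj (?\<Theta> z) * of_real (height z ^ (2 * k)))"
    if z: "z \<in> ball 0 1" and sum: "(\<lambda>\<delta>. ?\<phi> (act \<delta> z)) summable_on \<Gamma>" for z
  proof -
    have z': "z \<in> cball 0 1" using z by auto
    have coset: "infsum (\<lambda>\<delta>. ?\<phi> (act \<delta> z)) C = (?\<kappa> * f z * of_real (height z ^ (2 * k))) * cnj (slash k (qfun k \<gamma>) (SOME \<delta>. \<delta> \<in> C) z)"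
      if C: "C \<in> cyclic_cosets \<Gamma> \<gamma>" for C
    proof -
      note cf = cyclic_cosets_facts[OF \<Gamma> \<gamma> C]
      define \<delta> where "\<delta> = (SOME \<delta>. \<delta> \<in> C)"
      have \<delta>C: "\<delta> \<in> C" unfolding \<delta>_def by (rule cf(3))
      then have \<delta>\<Gamma>: "\<delta> \<in> \<Gamma>" using cf(1) by blast
      then have \<delta>c: "\<delta> \<in> carrier SU" by (rule subgroup_in_SU[OF \<Gamma>])
      have CR: "C = range (\<lambda>m. SU_pow \<gamma> m ** \<delta>)" by (rule cf(2)[OF \<delta>C])
      have "inj (\<lambda>m. SU_pow \<gamma> m ** \<delta>)"
      proof (rule injI)
        fix m n assume "SU_pow \<gamma> m ** \<delta> = SU_pow \<gamma> n ** \<delta>"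
        then have "(SU_pow \<gamma> m ** \<delta>) ** inv\<^bsub>SU\<^esub> \<delta> = (SU_pow \<gamma> n ** \<delta>) ** inv\<^bsub>SU\<^esub> \<delta>" by simp
        then have "SU_pow \<gamma> m = SU_pow \<gamma> n"
          by (simp only: matrix_mul_assoc[symmetric] SU_inv_mul[OF \<delta>c] matrix_mul_rid)
        then show "m = n" by (rule injD[OF inj])
      qed
      then have bij: "bij_betw (\<lambda>m. SU_pow \<gamma> m ** \<delta>) UNIV C"
        unfolding CR by (rule inj_on_imp_bij_betw)
      have u: "act \<delta> z \<in> ball 0 1" by (rule act_in_ball[OF \<delta>c z])
      have act_eq: "act (SU_pow \<gamma> m ** \<delta>) z = act (SU_pow \<gamma> m) (act \<delta> z)" for m
        by (rule act_mult[OF \<delta>c z'])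
      have "(\<lambda>\<delta>. ?\<phi> (act \<delta> z)) summable_on C"
        by (rule summable_on_subset_banach[OF sum cf(1)])
      then have sumU: "(\<lambda>m. ?\<phi> (act (SU_pow \<gamma> m) (act \<delta> z))) summable_on UNIV"
        using summable_on_reindex_bij_betw[OF bij, of "\<lambda>\<delta>. ?\<phi> (act \<delta> z)"] unfolding act_eq by simp
      have "infsum (\<lambda>\<delta>. ?\<phi> (act \<delta> z)) C = infsum (\<lambda>m. ?\<phi> (act (SU_pow \<gamma> m) (act \<delta> z))) UNIV"
        using infsum_reindex_bij_betw[OF bij, of "\<lambda>\<delta>. ?\<phi> (act \<delta> z)"] unfolding act_eq by simp
      also have "\<dots> = ?\<kappa> * (f (act \<delta> z) * cnj (qfun k \<gamma> (act \<delta> z)) * of_real (height (act \<delta> z) ^ (2 * k)))"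
        by (rule axis_average_orbit_sum[OF g \<gamma>c k0 tr(3) fac(2)[OF pow\<Gamma>] pow tr(1,2) u sumU])
      also have "f (act \<delta> z) * cnj (qfun k \<gamma> (act \<delta> z)) * of_real (height (act \<delta> z) ^ (2 * k))
          = f z * cnj (slash k (qfun k \<gamma>) \<delta> z) * of_real (height z ^ (2 * k))"
        by (rule slash_pair_invariant[OF \<delta>c z fac(2)[OF \<delta>\<Gamma> z]])
      finally show ?thesis
        unfolding \<delta>_def by (simp only: mult_ac)
    qed
    have "infsum (\<lambda>\<delta>. ?\<phi> (act \<delta> z)) \<Gamma> = infsum (\<lambda>C. infsum (\<lambda>\<delta>. ?\<phi> (act \<delta> z)) C) (cyclic_cosets \<Gamma> \<gamma>)"
      by (rule infsum_cyclic_cosets[OF \<Gamma> \<gamma> sum])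
    also have "\<dots> = infsum (\<lambda>C. (?\<kappa> * f z * of_real (height z ^ (2 * k))) * cnj (slash k (qfun k \<gamma>) (SOME \<delta>. \<delta> \<in> C) z)) (cyclic_cosets \<Gamma> \<gamma>)"
      by (rule infsum_cong) (rule coset)
    also have "\<dots> = (?\<kappa> * f z * of_real (height z ^ (2 * k))) * cnj (?\<Theta> z)"
      unfolding infsum_cmult_right' infsum_cnj rel_poincare_def rcosets_eq_cyclic_cosets[OF \<gamma>c] ..
    finally show ?thesis by (simp only: mult_ac)
  qed
  let ?P = "\<lambda>z. f z * cnj (?\<Theta> z) * of_real (height z ^ (2 * k))"
  \<comment> \<open>Almost everywhere equal integrands have equal integrals only if both are measurable.\<close>
  have lhs_meas: "(\<lambda>z. indicator D z *\<^sub>R (infsum (\<lambda>\<delta>. ?\<phi> (act \<delta> z)) \<Gamma> / ?st z)) \<in> borel_measurable ?V"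
    and rhs_meas: "(\<lambda>z. ?\<kappa> * (indicator D z *\<^sub>R (?P z / ?st z))) \<in> borel_measurable ?V"
  proof -
    have cnt: "countable \<Gamma>" by (rule countable_discrete_subgroup[OF \<Gamma> disc])
    have [measurable]: "domain_weight \<Gamma> D \<in> borel_measurable borel"
      by (rule borel_measurable_domain_weight[OF cnt Dm])
    have w: "indicator D z *\<^sub>R (x / ?st z) = domain_weight \<Gamma> D z *\<^sub>R x" for x :: complex and z
      by (simp add: domain_weight_def indicator_def scaleR_conv_of_real)
    have [measurable]: "?\<phi> \<in> borel_measurable borel"
      using borel_measurable_integrable[OF avg(1)] by simp
    interpret sigma_finite_measure "count_space \<Gamma>"
      by (rule sigma_finite_measure_count_space_countable[OF cnt])
    have "(\<lambda>(\<delta>, z). ?\<phi> (act \<delta> z)) \<in> borel_measurable (count_space \<Gamma> \<Otimes>\<^sub>M borel)"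
      by (rule measurable_pair_measure_countable1[OF cnt]) simp
    from measurable_pair_swap[OF this]
    have "(\<lambda>(z, \<delta>). ?\<phi> (act \<delta> z)) \<in> borel_measurable (borel \<Otimes>\<^sub>M count_space \<Gamma>)"
      by (simp add: case_prod_unfold)
    from borel_measurable_lebesgue_integral[OF this]
    have [measurable]: "(\<lambda>z. infsum (\<lambda>\<delta>. ?\<phi> (act \<delta> z)) \<Gamma>) \<in> borel_measurable borel"
      by (simp add: infsum_eq_integral_count_space)
    show "(\<lambda>z. indicator D z *\<^sub>R (infsum (\<lambda>\<delta>. ?\<phi> (act \<delta> z)) \<Gamma> / ?st z)) \<in> borel_measurable ?V"
      unfolding w by measurable
    define F where "F z = indicator (ball 0 1) z *\<^sub>R f z" for z
    have [measurable]: "F \<in> borel_measurable borel"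
      unfolding F_def by (rule borel_measurable_continuous_on_indicator[OF _ holomorphic_vec_continuous[OF fac(1)]]) simp
    have [measurable]: "?\<Theta> \<in> borel_measurable borel"
      by (rule borel_measurable_rel_poincare[OF \<Gamma> disc \<gamma>])
    have [measurable]: "cnj \<in> borel_measurable borel"
      by (intro borel_measurable_continuous_onI continuous_intros)
    have eq: "?\<kappa> * (indicator D z *\<^sub>R (?P z / ?st z)) = domain_weight \<Gamma> D z *\<^sub>R (?\<kappa> * (F z * cnj (?\<Theta> z) * of_real (height z ^ (2 * k))))" for z
      using DB unfolding w by (auto simp: F_def domain_weight_def indicator_def scaleR_conv_of_real)
    show "(\<lambda>z. ?\<kappa> * (indicator D z *\<^sub>R (?P z / ?st z))) \<in> borel_measurable ?V"
      unfolding eq by measurable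
  qed
  have "(\<integral>z. ?\<phi> z \<partial>?V) = (\<integral>z. indicator D z *\<^sub>R (infsum (\<lambda>\<delta>. ?\<phi> (act \<delta> z)) \<Gamma> / ?st z) \<partial>?V)"
    by (rule orbit_unfolding(2)[OF \<Gamma> disc D avg(1)])
  also have "\<dots> = (\<integral>z. ?\<kappa> * (indicator D z *\<^sub>R (?P z / ?st z)) \<partial>?V)"
  proof (rule integral_cong_AE[OF lhs_meas rhs_meas])
    show "AE z in ?V. indicator D z *\<^sub>R (infsum (\<lambda>\<delta>. ?\<phi> (act \<delta> z)) \<Gamma> / ?st z) = ?\<kappa> * (indicator D z *\<^sub>R (?P z / ?st z))"
      using orbit_unfolding(1)[OF \<Gamma> disc D avg(1)]
    proof eventually_elim
      case (elim z)
      show ?case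
      proof (cases "z \<in> D")
        case True
        then have "z \<in> ball 0 1" using DB by blast
        from orbit_sum[OF this elim[rule_format, OF True]] show ?thesis
          using True by simp
      qed simp
    qed
  qed
  also have "\<dots> = ?\<kappa> * (\<integral>z. indicator D z *\<^sub>R (?P z / ?st z) \<partial>?V)"
    by (rule integral_mult_right_zero)
  also have "(\<integral>z. indicator D z *\<^sub>R (?P z / ?st z) \<partial>?V) = petersson k \<Gamma> f ?\<Theta>"
    unfolding petersson_def quotient_integral_def set_lebesgue_integral_def D_def ..
  finally show ?thesis
    using avg(2) by simp
qed

lemma slash_geodesic:
  assumes g: "g \<in> carrier SU"
    and X: "repelling_pt \<gamma> = act g (tip (-1))" and Y: "attracting_pt \<gamma> = act g (tip 1)"
  shows "f (geodesic g t) * Qform \<gamma> (geodesic g t) ^ k = cnj (axis_scale g) ^ k * slash k f (g ** a_mat t) 0"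
proof -
  let ?G = "g ** a_mat t"
  have G: "?G \<in> carrier SU" by (intro SU_mult_closed g a_mat_SU)
  have l: "lift_pt (geodesic g t) = autj ?G 0 *s axis_vec g t"
    unfolding geodesic_eq(1)[OF g] axis_vec_def by (rule lift_act[OF G]) simp
  have pq: "herm (lift_pt (tip 1)) (lift_pt (tip 1)) = 0" "herm (lift_pt (tip (-1))) (lift_pt (tip (-1))) = 0"
    "herm (lift_pt (tip 1)) (lift_pt (tip (-1))) = -2" "herm (lift_pt (tip (-1))) (lift_pt (tip 1)) = -2"
    by (simp_all add: herm_lift_tip tip_nth)
  have "herm (axis_vec g t) (g *v lift_pt (tip 1)) = - of_real (exp (- t))"
    "herm (axis_vec g t) (g *v lift_pt (tip (-1))) = - of_real (exp t)"
    by (simp_all add: axis_vec_eq herm_add_left herm_scale_left SU_herm[OF g] pq)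
  then have "herm (axis_vec g t) (g *v lift_pt (tip 1)) * herm (axis_vec g t) (g *v lift_pt (tip (-1))) = of_real (exp (- t) * exp t)"
    by simp
  then have 1: "herm (axis_vec g t) (g *v lift_pt (tip 1)) * herm (axis_vec g t) (g *v lift_pt (tip (-1))) = 1"
    by (simp only: exp_add[symmetric]) simp
  have "Qform \<gamma> (geodesic g t) = cnj (axis_scale g) * (autj ?G 0 ^ 2 *
     (herm (axis_vec g t) (g *v lift_pt (tip 1)) * herm (axis_vec g t) (g *v lift_pt (tip (-1)))))"
    unfolding Qform_axis[OF g X Y] l herm_scale_left power2_eq_square by (simp only: mult_ac)
  then have "Qform \<gamma> (geodesic g t) ^ k = cnj (axis_scale g) ^ k * autj ?G 0 ^ (2 * k)"
    unfolding 1 by (simp add: power_mult_distrib power_mult)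
  then show ?thesis
    by (simp add: slash_def geodesic_eq(1)[OF g])
qed

lemma alpha_axis:
  assumes g: "g \<in> carrier SU"
    and X: "repelling_pt \<gamma> = act g (tip (-1))" and Y: "attracting_pt \<gamma> = act g (tip 1)"
  shows "cmod (alpha \<gamma>) = cmod (axis_scale g)"
proof -
  have tips: "tip 1 \<in> cball 0 1" "tip (-1) \<in> cball 0 1" by (simp_all add: norm_tip)
  have "herm (g *v lift_pt (tip (-1))) (g *v lift_pt (tip 1)) = -2"
    by (simp add: SU_herm[OF g] herm_lift_tip tip_nth)
  then have "alpha \<gamma> = autj g (tip (-1)) * cnj (autj g (tip 1))"
    unfolding alpha_def X Y lift_act[OF g tips(1)] lift_act[OF g tips(2)] herm_scale_left herm_scale_right by simp
  then show ?thesis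
    by (simp add: axis_scale_def norm_mult)
qed

theorem theorem11:
  fixes \<Gamma> :: "(complex^('n::{finite,linorder} option)^('n option)) set"
    and \<gamma>\<^sub>0 g :: "complex^('n option)^('n option)"
    and f :: "complex^('n::{finite,linorder}) \<Rightarrow> complex"
    and z\<^sub>0 :: "complex^('n::{finite,linorder})"
    and \<kappa> t\<^sub>0 t\<^sub>1 :: real and k :: nat
  assumes "lattice_in_SU \<Gamma>"
    and "\<kappa> \<ge> 1" and "2 * \<kappa> \<in> \<int>" and "real k = (real CARD('n) + 1) * \<kappa>"
    and "f \<in> cusp_forms k \<Gamma>"
    and "\<gamma>\<^sub>0 \<in> \<Gamma>" and "loxodromic \<gamma>\<^sub>0"
    and "\<forall>z\<in>ball 0 1. slash k (qfun k \<gamma>\<^sub>0) \<gamma>\<^sub>0 z = qfun k \<gamma>\<^sub>0 z"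
    and "axis_geodesic \<gamma>\<^sub>0 g" and "geodesic g t\<^sub>0 = z\<^sub>0" and "geodesic g t\<^sub>1 = act \<gamma>\<^sub>0 z\<^sub>0"
  shows "petersson k \<Gamma> f (rel_poincare k \<Gamma> \<gamma>\<^sub>0) =
      of_real (cmod (alpha \<gamma>\<^sub>0) powr (- 2 * (real CARD('n) + 1) * \<kappa>) *
        (fact (2 * k - CARD('n) - 1) / (fact (k - 1))\<^sup>2 * pi ^ CARD('n) *
         2 powr (2 * (real CARD('n) + 1) * (1 - \<kappa>) - 1))) *
      integral {t\<^sub>0..t\<^sub>1} (\<lambda>t. f (geodesic g t) * Qform \<gamma>\<^sub>0 (geodesic g t) ^ k)"
proof -
  let ?n = "CARD('n)"
  have \<Gamma>: "subgroup \<Gamma> SU" and disc: "discrete \<Gamma>"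
    using assms(1) by (simp_all add: lattice_in_SU_def)
  have g: "g \<in> carrier SU" using assms(9) by (simp add: axis_geodesic_def)
  have \<gamma>c: "\<gamma>\<^sub>0 \<in> carrier SU" by (rule subgroup_in_SU[OF \<Gamma> assms(6)])
  have shift: "geodesic g t\<^sub>1 = act \<gamma>\<^sub>0 (geodesic g t\<^sub>0)" using assms(10,11) by simp
  note tr = axis_translation[OF \<gamma>c assms(7) assms(9) shift]
  have "(real ?n + 1) * 1 \<le> (real ?n + 1) * \<kappa>"
    using assms(2) by (intro mult_left_mono) auto
  then have k: "?n + 1 \<le> k"
    unfolding assms(4)[symmetric] by simp
  have inv: "slash k (qfun k \<gamma>\<^sub>0) \<gamma>\<^sub>0 0 = qfun k \<gamma>\<^sub>0 0" using assms(8) by simp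
  define I where "I = integral {t\<^sub>0..t\<^sub>1} (\<lambda>t. slash k f (g ** a_mat t) 0)"
  define J where "J = axis_scale g"
  have J0: "J \<noteq> 0" unfolding J_def by (rule axis_scale_neq_0[OF g])
  \<comment> \<open>The total mass of \<open>height^(2k) dV\<close>; the constant \<open>C\<close> of the formula is its quotient by \<open>beta_const k\<close>.\<close>
  define v :: real where "v = 4 ^ ?n * pi ^ ?n * fact (2 * k - ?n - 1) / fact (2 * k - 1)"
  define C :: real where "C = fact (2 * k - ?n - 1) / (fact (k - 1))\<^sup>2 * pi ^ ?n * 2 powr (2 * (real ?n + 1) * (1 - \<kappa>) - 1)"
  have main: "of_real (beta_const k) * J ^ k * petersson k \<Gamma> f (rel_poincare k \<Gamma> \<gamma>\<^sub>0) = of_real v * I"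
    unfolding J_def v_def I_def
    by (rule petersson_rel_poincare[OF \<Gamma> disc k assms(5) assms(6) assms(7) inv assms(9) shift])
  have b0: "beta_const k \<noteq> 0" by (simp add: beta_const_def)
  have vC: "v = beta_const k * C"
  proof -
    have "2 * (real ?n + 1) * (1 - \<kappa>) - 1 = real (2 * ?n + 1) - real (2 * k)"
      using assms(4) by (simp add: algebra_simps)
    then have "2 powr (2 * (real ?n + 1) * (1 - \<kappa>) - 1) = 2 powr real (2 * ?n + 1) / 2 powr real (2 * k)"
      by (simp only: powr_diff)
    also have "\<dots> = 2 ^ (2 * ?n + 1) / 2 ^ (2 * k)"
      by (simp only: powr_realpow zero_less_numeral)
    finally have p: "2 powr (2 * (real ?n + 1) * (1 - \<kappa>) - 1) = 2 ^ (2 * ?n + 1) / 2 ^ (2 * k)" .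
    have "2 * k = Suc (2 * k - 1)" using k by simp
    then have q: "(2::real) ^ (2 * k) = 2 * 2 ^ (2 * k - 1)" by (metis power_Suc)
    have r: "(2::real) ^ (2 * ?n + 1) = 2 * 4 ^ ?n" by (simp add: power_mult)
    show ?thesis
      unfolding v_def C_def beta_const_def p q r by (simp add: field_simps)
  qed
  have "\<And>t. f (geodesic g t) * Qform \<gamma>\<^sub>0 (geodesic g t) ^ k = cnj J ^ k * slash k f (g ** a_mat t) 0"
    unfolding J_def by (rule slash_geodesic[OF g tr(1,2)])
  then have int: "integral {t\<^sub>0..t\<^sub>1} (\<lambda>t. f (geodesic g t) * Qform \<gamma>\<^sub>0 (geodesic g t) ^ k) = cnj J ^ k * I"
    unfolding I_def by (simp only: integral_mult_right)
  have "cmod (alpha \<gamma>\<^sub>0) powr (- 2 * (real ?n + 1) * \<kappa>) = cmod J powr (- real (2 * k))"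
    unfolding alpha_axis[OF g tr(1,2)] J_def using assms(4) by (simp add: algebra_simps)
  also have "\<dots> = inverse (cmod J ^ (2 * k))"
    using J0 by (simp add: powr_minus powr_realpow del: of_nat_mult)
  finally have al: "cmod (alpha \<gamma>\<^sub>0) powr (- 2 * (real ?n + 1) * \<kappa>) = inverse (cmod J ^ (2 * k))" .
  have "complex_of_real (cmod J ^ (2 * k)) = J ^ k * cnj J ^ k"
  proof -
    have "complex_of_real (cmod J ^ (2 * k)) = (complex_of_real ((cmod J)\<^sup>2)) ^ k"
      by (simp add: power_mult)
    then show ?thesis by (simp only: complex_norm_square power_mult_distrib)
  qed
  \<comment> \<open>The factor \<open>|\<alpha>|^(-2k)\<close> combines with the phase hidden in \<open>Q\<^sup>k\<close> to the holomorphic power \<open>J^(-k)\<close>.\<close>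
  then have "complex_of_real (inverse (cmod J ^ (2 * k))) * (cnj J ^ k * I) = inverse (J ^ k) * I"
    using J0 by (simp add: field_simps)
  moreover have "petersson k \<Gamma> f (rel_poincare k \<Gamma> \<gamma>\<^sub>0) = of_real C * (inverse (J ^ k) * I)"
  proof -
    have "of_real (beta_const k) * J ^ k * petersson k \<Gamma> f (rel_poincare k \<Gamma> \<gamma>\<^sub>0) = of_real (beta_const k) * J ^ k * (of_real C * (inverse (J ^ k) * I))"
      unfolding main vC using J0 by simp
    then show ?thesis using b0 J0 by simp
  qed
  ultimately have "petersson k \<Gamma> f (rel_poincare k \<Gamma> \<gamma>\<^sub>0) = of_real (inverse (cmod J ^ (2 * k)) * C) * (cnj J ^ k * I)"
    by (simp only: of_real_mult mult_ac)
  then show ?thesis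
    unfolding int al C_def[symmetric] .
qed

end
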